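(* Let $d\ge2$, let $G$ be a subgroup of $\Pi_d$, let $(S,\alpha)$ be a finite area translation surface with infinite topological type, and let $(\tilde S,\tilde\alpha)$ be a cover of $(S,\alpha)$ with monodromy in $G$. If $(S,\alpha)$ has a non-divergent Teichmüller trajectory in $\mathcal O(S,\alpha)$, then the Teichmüller trajectory of the cover $t\mapsto g^t(\tilde S,\tilde\alpha)$ has an $\omega$-limit point (as $t\to+\infty$) in $\tilde{\mathcal O}_G(S,\alpha)$.
   Context: A translation surface $(S,\alpha)$ is a Riemann surface $S$ (connected, not necessarily compact; only covers are allowed to be disconnected) with a holomorphic $1$-form $\alpha$. Away from the zeros $Z$ of $\alpha$, the maps $q\mapsto\int_p^q\alpha$ give charts to $\mathbb C\cong\mathbb R^2$ that differ by translations; area is pulled back from the plane. Infinite topological type means that the fundamental group is not finitely generated. $\mathrm{SL}_\pm(2,\mathbb R)$ is the group of real $2\times2$ matrices of determinant $\pm1$; $A(S,\alpha)$ is the translation surface obtained by postcomposing all charts with the real-linear map $A$. $g^t=\mathrm{diag}(e^{-t},e^t)$. Two translation surfaces are translation equivalent if there is a homeomorphism between them which is a translation in local coordinates. $\mathcal O(S,\alpha)=\{A(S,\alpha):A\in\mathrm{SL}_\pm(2,\mathbb R)\}/(\text{translation equivalence})$ with the quotient topology from $\mathrm{SL}_\pm(2,\mathbb R)$; it is identified with $\mathrm{SL}_\pm(2,\mathbb R)/V(S,\alpha)$, where $V(S,\alpha)=\{A: A(S,\alpha)\text{ is translation equivalent to }(S,\alpha)\}$. The Teichmüller trajectory $g^t(S,\alpha)$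 is non-divergent in $\mathcal O(S,\alpha)$ if there is a sequence $t_n\to+\infty$ such that $g^{t_n}(S,\alpha)$ converges in $\mathcal O(S,\alpha)$. $\Pi_d$ is the symmetric group on $\{1,\dots,d\}$. Covers are unbranched, of degree $d$, possibly disconnected, with $1$-form pulled back from $S$. Fix a basepoint $s_0\in S\smallsetminus Z$. Labeling the fiber over $s_0$ by $\{1,\dots,d\}$, the monodromy action gives a homomorphism $\pi_1(S,s_0)\to\Pi_d$, well defined up to conjugation in $\Pi_d$ and determining the cover up to isomorphism. The cover has monodromy in $G$ if for some labeling this homomorphism takes values in $G$. $\mathrm{Hom}(\pi_1(S,s_0),G)$ carries the topology of pointwise convergence ($G$ discrete). $\mathrm{Cov}_G(S,\alpha)$ is the set of covers of $(S,\alpha)$ with monodromy in $G$ up to translation equivalence, with the quotient topology from $\Pi_d\backslash\mathrm{Hom}(\pi_1(S,s_0),G)$. $\tilde{\mathcal O}_G(S,\alpha)=\{A(\tilde S,\tilde\alpha): A\in \mathrm{SL}_\pm(2,\mathbb R),\ (\tilde S,\tilde\alpha)\in\mathrm{Cov}_G(S,\alpha)\}/(\text{translation equivalence})$, with the quotient topology from $\mathrm{SL}_\pm(2,\mathbb R)\times\mathrm{Cov}_G(S,\alpha)$. *)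

theory Defs
  imports
    "HOL-Complex_Analysis.Complex_Analysis"
    "HOL-Algebra.Sym_Groups"
    "HOL-Algebra.Generated_Groups"
begin

section \<open>Riemann surfaces with a holomorphic 1-form\<close>

text \<open>A chart is a pair of a domain and a coordinate function; the values of the coordinate
  function outside the domain are irrelevant.\<close>

type_synonym 'a chart = "'a set \<times> ('a \<Rightarrow> complex)"

definition chart_on :: "'a topology \<Rightarrow> 'a chart \<Rightarrow> bool" where
  "chart_on X c \<longleftrightarrow> (case c of (U, \<phi>) \<Rightarrow>
     openin X U \<and> open (\<phi> ` U) \<and>
     homeomorphic_map (subtopology X U) (top_of_set (\<phi> ` U)) \<phi>)"

text \<open>The 1-form is given in each chart \<open>(U, \<phi>)\<close> of the atlas by its coefficient function
  \<open>form M (U, \<phi>)\<close>, that is, \<open>\<alpha> = form M (U, \<phi>) z dz\<close> with \<open>z = \<phi> q\<close>.\<close>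

record 'a surface_form =
  topo :: "'a topology"
  atlas :: "'a chart set"
  form :: "'a chart \<Rightarrow> complex \<Rightarrow> complex"

definition holomorphic_1form :: "'a surface_form \<Rightarrow> bool" where
  "holomorphic_1form M \<longleftrightarrow>
     (\<forall>c\<in>atlas M. chart_on (topo M) c) \<and>
     topspace (topo M) = (\<Union>(U, \<phi>)\<in>atlas M. U) \<and>
     (\<forall>(U, \<phi>)\<in>atlas M. form M (U, \<phi>) holomorphic_on \<phi> ` U) \<and>
     (\<forall>(U, \<phi>)\<in>atlas M. \<forall>(V, \<psi>)\<in>atlas M.
        (\<phi> \<circ> inv_into V \<psi>) holomorphic_on \<psi> ` (U \<inter> V) \<and>
        (\<forall>q\<in>U \<inter> V. form M (V, \<psi>) (\<psi> q) =
           form M (U, \<phi>) (\<phi> q) * deriv (\<phi> \<circ> inv_into V \<psi>) (\<psi> q)))"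

definition zeros :: "'a surface_form \<Rightarrow> 'a set" where
  "zeros M = {q. \<exists>(U, \<phi>)\<in>atlas M. q \<in> U \<and> form M (U, \<phi>) (\<phi> q) = 0}"

text \<open>The 1-form of a translation surface is not identically zero.\<close>

definition translation_surface :: "'a surface_form \<Rightarrow> bool" where
  "translation_surface M \<longleftrightarrow>
     holomorphic_1form M \<and> Hausdorff_space (topo M) \<and> second_countable (topo M) \<and>
     connected_space (topo M) \<and> zeros M \<noteq> topspace (topo M)"


section \<open>The translation structure and its deformations\<close>

text \<open>A translation structure consists of the topological surface, the set of singularities (the
  zeros of the 1-form) and the translation charts off the singularities.  Deformed surfaces
  \<open>A(S, \<alpha>)\<close> are treated on this level, since their complex structure differs from that of \<open>S\<close>.\<close>

record 'a tstruct =
  ttopo :: "'a topology"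
  tsing :: "'a set"
  tcharts :: "'a chart set"

text \<open>The charts are the functions taking \<open>q\<close> to the integral of \<open>\<alpha>\<close> from \<open>p\<close> to \<open>q\<close>, on
  neighbourhoods \<open>U\<close> of \<open>p\<close> on which they are injective.  As \<open>U\<close> is convex in a complex
  coordinate \<open>\<phi>\<close>, one may integrate along the coordinate segment.\<close>

definition translation_charts :: "'a surface_form \<Rightarrow> 'a chart set" where
  "translation_charts M =
     {(U, \<zeta>) | U \<zeta>. \<exists>V \<phi> p. (V, \<phi>) \<in> atlas M \<and> openin (topo M) U \<and> p \<in> U \<and> U \<subseteq> V \<and>
        U \<inter> zeros M = {} \<and> convex (\<phi> ` U) \<and>
        \<zeta> = (\<lambda>q. contour_integral (linepath (\<phi> p) (\<phi> q)) (form M (V, \<phi>))) \<and> inj_on \<zeta> U}"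

definition tstruct_of :: "'a surface_form \<Rightarrow> 'a tstruct" where
  "tstruct_of M = \<lparr>ttopo = topo M, tsing = zeros M, tcharts = translation_charts M\<rparr>"

definition mat_act :: "real^2^2 \<Rightarrow> complex \<Rightarrow> complex" where
  "mat_act A z = Complex (A$1$1 * Re z + A$1$2 * Im z) (A$2$1 * Re z + A$2$2 * Im z)"

definition deform :: "real^2^2 \<Rightarrow> 'a tstruct \<Rightarrow> 'a tstruct" where
  "deform A F = F\<lparr>tcharts := (\<lambda>(U, \<zeta>). (U, mat_act A \<circ> \<zeta>)) ` tcharts F\<rparr>"

definition translation_equivalent :: "'a tstruct \<Rightarrow> 'b tstruct \<Rightarrow> bool" where
  "translation_equivalent F F' \<longleftrightarrow>
     (\<exists>h. homeomorphic_map (ttopo F) (ttopo F') h \<and> h ` tsing F = tsing F' \<and>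
        (\<forall>(U, \<zeta>)\<in>tcharts F. \<forall>(V, \<xi>)\<in>tcharts F'. \<forall>q\<in>U. h q \<in> V \<longrightarrow>
           (\<exists>W c. openin (ttopo F) W \<and> q \<in> W \<and> W \<subseteq> U \<and> h ` W \<subseteq> V \<and>
              (\<forall>r\<in>W. \<xi> (h r) = \<zeta> r + c))))"

text \<open>The Borel measure off the singularities that is pulled back from Lebesgue measure on the
  plane by the translation charts; it is unique on second countable surfaces.\<close>

definition area_measure :: "'a tstruct \<Rightarrow> 'a measure \<Rightarrow> bool" where
  "area_measure F \<mu> \<longleftrightarrow>
     space \<mu> = topspace (ttopo F) - tsing F \<and>
     sets \<mu> = sigma_sets (topspace (ttopo F) - tsing F)
                {U. openin (ttopo F) U \<and> U \<subseteq> topspace (ttopo F) - tsing F} \<and>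
     (\<forall>(U, \<zeta>)\<in>tcharts F. \<forall>E\<in>sets \<mu>. E \<subseteq> U \<longrightarrow> emeasure \<mu> E = emeasure lborel (\<zeta> ` E))"

definition finite_area :: "'a tstruct \<Rightarrow> bool" where
  "finite_area F \<longleftrightarrow> (\<exists>\<mu>. area_measure F \<mu> \<and> emeasure \<mu> (space \<mu>) < \<infinity>)"


section \<open>Fundamental group\<close>

definition loop_homotopic :: "'a topology \<Rightarrow> 'a \<Rightarrow> (real \<Rightarrow> 'a) \<Rightarrow> (real \<Rightarrow> 'a) \<Rightarrow> bool" where
  "loop_homotopic X x f g \<longleftrightarrow>
     homotopic_with (\<lambda>h. h 0 = x \<and> h 1 = x) (top_of_set {0..1}) X f g"

definition path_concat :: "(real \<Rightarrow> 'a) \<Rightarrow> (real \<Rightarrow> 'a) \<Rightarrow> real \<Rightarrow> 'a" where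
  "path_concat f g = (\<lambda>t. if t \<le> 1/2 then f (2 * t) else g (2 * t - 1))"

definition fundamental_group :: "'a topology \<Rightarrow> 'a \<Rightarrow> (real \<Rightarrow> 'a) set monoid" where
  "fundamental_group X x =
     \<lparr>carrier = {{g. loop_homotopic X x f g} | f. pathin X f \<and> f 0 = x \<and> f 1 = x},
      mult = (\<lambda>a b. {h. \<exists>f\<in>a. \<exists>g\<in>b. loop_homotopic X x (path_concat f g) h}),
      one = {g. loop_homotopic X x (\<lambda>_. x) g}\<rparr>"

text \<open>The base point does not matter as the surfaces in question are connected.\<close>

definition infinite_topological_type :: "'a topology \<Rightarrow> 'a \<Rightarrow> bool" where
  "infinite_topological_type X x \<longleftrightarrow>
     \<not> (\<exists>K. finite K \<and> K \<subseteq> carrier (fundamental_group X x) \<and>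
          generate (fundamental_group X x) K = carrier (fundamental_group X x))"


section \<open>Covers and monodromy\<close>

definition covering_map :: "'b topology \<Rightarrow> ('b \<Rightarrow> 'a) \<Rightarrow> 'a topology \<Rightarrow> bool" where
  "covering_map Y p X \<longleftrightarrow>
     continuous_map Y X p \<and> p ` topspace Y = topspace X \<and>
     (\<forall>x\<in>topspace X. \<exists>U. openin X U \<and> x \<in> U \<and>
        (\<exists>\<V>. \<Union>\<V> = {y \<in> topspace Y. p y \<in> U} \<and> (\<forall>V\<in>\<V>. openin Y V) \<and> pairwise disjnt \<V> \<and>
           (\<forall>V\<in>\<V>. homeomorphic_map (subtopology Y V) (subtopology X U) p)))"

text \<open>Unbranched covers \<open>p : M \<rightarrow> S\<close> of degree \<open>d\<close>, possibly disconnected: \<open>p\<close> is holomorphic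
  and the 1-form of \<open>M\<close> is the pullback of that of \<open>S\<close>.  The total space is automatically
  Hausdorff and second countable.\<close>

definition is_cover :: "nat \<Rightarrow> 'a surface_form \<Rightarrow> 'b surface_form \<Rightarrow> ('b \<Rightarrow> 'a) \<Rightarrow> bool" where
  "is_cover d S M p \<longleftrightarrow>
     holomorphic_1form M \<and> covering_map (topo M) p (topo S) \<and>
     (\<forall>x\<in>topspace (topo S). finite {y \<in> topspace (topo M). p y = x} \<and>
        card {y \<in> topspace (topo M). p y = x} = d) \<and>
     (\<forall>(U, \<phi>)\<in>atlas S. \<forall>(V, \<psi>)\<in>atlas M.
        (\<phi> \<circ> p \<circ> inv_into V \<psi>) holomorphic_on \<psi> ` {y \<in> V. p y \<in> U} \<and>
        (\<forall>y\<in>V. p y \<in> U \<longrightarrow> form M (V, \<psi>) (\<psi> y) =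
           form S (U, \<phi>) (\<phi> (p y)) * deriv (\<phi> \<circ> p \<circ> inv_into V \<psi>) (\<psi> y)))"

text \<open>\<open>\<rho>\<close> is the monodromy homomorphism for the labeling \<open>l\<close> of the fiber over \<open>s\<close>.  Since
  products in the fundamental group are concatenations from left to right, whereas permutations
  are composed from right to left, \<open>\<rho> c\<close> takes the label of the end point of a lift of a loop
  in \<open>c\<close> to the label of its starting point.  (The opposite convention gives the pointwise
  inverse, which takes values in the same subgroups.)\<close>

definition is_monodromy ::
  "nat \<Rightarrow> 'a surface_form \<Rightarrow> 'a \<Rightarrow> 'b surface_form \<Rightarrow> ('b \<Rightarrow> 'a) \<Rightarrow> ('b \<Rightarrow> nat) \<Rightarrow>
   ((real \<Rightarrow> 'a) set \<Rightarrow> nat \<Rightarrow> nat) \<Rightarrow> bool" where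
  "is_monodromy d S s M p l \<rho> \<longleftrightarrow>
     bij_betw l {y \<in> topspace (topo M). p y = s} {1..d} \<and>
     \<rho> \<in> hom (fundamental_group (topo S) s) (sym_group d) \<and>
     (\<forall>c\<in>carrier (fundamental_group (topo S) s). \<forall>\<eta>. pathin (topo M) \<eta> \<and> p \<circ> \<eta> \<in> c \<longrightarrow>
        \<rho> c (l (\<eta> 1)) = l (\<eta> 0))"

definition monodromy_in ::
  "nat \<Rightarrow> (nat \<Rightarrow> nat) set \<Rightarrow> 'a surface_form \<Rightarrow> 'a \<Rightarrow> 'b surface_form \<Rightarrow> ('b \<Rightarrow> 'a) \<Rightarrow> bool" where
  "monodromy_in d G S s M p \<longleftrightarrow>
     (\<exists>l \<rho>. is_monodromy d S s M p l \<rho> \<and> \<rho> ` carrier (fundamental_group (topo S) s) \<subseteq> G)"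

text \<open>Homomorphisms are represented as functions that are extensional on the fundamental group,
  so that the product topology is the topology of pointwise convergence.\<close>

definition hom_space ::
  "nat \<Rightarrow> (nat \<Rightarrow> nat) set \<Rightarrow> 'a surface_form \<Rightarrow> 'a \<Rightarrow>
   ((real \<Rightarrow> 'a) set \<Rightarrow> nat \<Rightarrow> nat) topology" where
  "hom_space d G S s =
     subtopology (product_topology (\<lambda>_. discrete_topology G) (carrier (fundamental_group (topo S) s)))
       (hom (fundamental_group (topo S) s) ((sym_group d)\<lparr>carrier := G\<rparr>))"


section \<open>The spaces of deformations and covers\<close>

text \<open>The quotient topology on the image of \<open>f\<close>, i.e. the one making \<open>f\<close> a quotient map.\<close>

definition quotient_topology :: "'a topology \<Rightarrow> ('a \<Rightarrow> 'b) \<Rightarrow> 'b topology" where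
  "quotient_topology X f =
     topology (\<lambda>U. U \<subseteq> f ` topspace X \<and> openin X {x \<in> topspace X. f x \<in> U})"

lemma openin_quotient_topology:
  "openin (quotient_topology X f) U \<longleftrightarrow>
     U \<subseteq> f ` topspace X \<and> openin X {x \<in> topspace X. f x \<in> U}"
proof -
  have "istopology (\<lambda>U. U \<subseteq> f ` topspace X \<and> openin X {x \<in> topspace X. f x \<in> U})"
    (is "istopology ?O")
    unfolding istopology_def
  proof safe
    fix S T assume "openin X {x \<in> topspace X. f x \<in> S}" "openin X {x \<in> topspace X. f x \<in> T}"
    then have "openin X ({x \<in> topspace X. f x \<in> S} \<inter> {x \<in> topspace X. f x \<in> T})"
      by (rule openin_Int)
    also have "{x \<in> topspace X. f x \<in> S} \<inter> {x \<in> topspace X. f x \<in> T} =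
        {x \<in> topspace X. f x \<in> S \<inter> T}" by auto
    finally show "openin X {x \<in> topspace X. f x \<in> S \<inter> T}" .
  next
    fix \<K> assume K: "\<forall>K\<in>\<K>. ?O K"
    have "openin X (\<Union>K\<in>\<K>. {x \<in> topspace X. f x \<in> K})" using K by blast
    also have "(\<Union>K\<in>\<K>. {x \<in> topspace X. f x \<in> K}) = {x \<in> topspace X. f x \<in> \<Union>\<K>}" by auto
    finally show "openin X {x \<in> topspace X. f x \<in> \<Union>\<K>}" .
  qed blast+
  then show ?thesis
    unfolding quotient_topology_def by (simp add: topology_inverse')
qed

definition SL_pm :: "(real^2^2) set" where
  "SL_pm = {A. det A = 1 \<or> det A = -1}"

definition teich_flow :: "real \<Rightarrow> real^2^2" where
  "teich_flow t = vector [vector [exp (- t), 0], vector [0, exp t]]"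

text \<open>The translation equivalence class of \<open>F\<close> inside a set \<open>T\<close> of translation structures;
  \<open>F\<close> itself may live on another type.\<close>

definition tclass :: "'b tstruct set \<Rightarrow> 'a tstruct \<Rightarrow> 'b tstruct set" where
  "tclass T F = {F' \<in> T. translation_equivalent F F'}"

definition orbit :: "'a surface_form \<Rightarrow> 'a tstruct set" where
  "orbit S = {deform A (tstruct_of S) | A. A \<in> SL_pm}"

definition orbit_space :: "'a surface_form \<Rightarrow> 'a tstruct set topology" where
  "orbit_space S =
     quotient_topology (top_of_set SL_pm) (\<lambda>A. tclass (orbit S) (deform A (tstruct_of S)))"

definition nondivergent :: "'a surface_form \<Rightarrow> bool" where
  "nondivergent S \<longleftrightarrow>
     (\<exists>(t :: nat \<Rightarrow> real) L. filterlim t at_top sequentially \<and>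
        limitin (orbit_space S)
          (\<lambda>n. tclass (orbit S) (deform (teich_flow (t n)) (tstruct_of S))) L sequentially)"

text \<open>A degree \<open>d\<close> cover of a surface on type \<open>'a\<close> is isomorphic to one whose points are pairs of
  a point of the base and a label in \<open>{1..d}\<close>, so the covers living on type \<open>'a \<times> nat\<close> represent
  all translation equivalence classes.\<close>

definition covers ::
  "nat \<Rightarrow> (nat \<Rightarrow> nat) set \<Rightarrow> 'a surface_form \<Rightarrow> 'a \<Rightarrow> ('a \<times> nat) tstruct set" where
  "covers d G S s = {tstruct_of M | M. \<exists>p. is_cover d S M p \<and> monodromy_in d G S s M p}"

text \<open>The class of the cover with monodromy \<open>\<rho>\<close>.\<close>

definition cover_class ::
  "nat \<Rightarrow> (nat \<Rightarrow> nat) set \<Rightarrow> 'a surface_form \<Rightarrow> 'a \<Rightarrow> ((real \<Rightarrow> 'a) set \<Rightarrow> nat \<Rightarrow> nat) \<Rightarrow>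
   ('a \<times> nat) tstruct set" where
  "cover_class d G S s \<rho> =
     (\<Union>M\<in>{M :: ('a \<times> nat) surface_form. \<exists>p l. is_cover d S M p \<and> is_monodromy d S s M p l \<rho>}.
        tclass (covers d G S s) (tstruct_of M))"

text \<open>Every homomorphism is the monodromy of a cover, which it determines up to isomorphism, so
  the points of this space are exactly the translation equivalence classes in \<open>covers d G S s\<close>.\<close>

definition cover_space ::
  "nat \<Rightarrow> (nat \<Rightarrow> nat) set \<Rightarrow> 'a surface_form \<Rightarrow> 'a \<Rightarrow> ('a \<times> nat) tstruct set topology" where
  "cover_space d G S s = quotient_topology (hom_space d G S s) (cover_class d G S s)"

definition deformed_covers ::
  "nat \<Rightarrow> (nat \<Rightarrow> nat) set \<Rightarrow> 'a surface_form \<Rightarrow> 'a \<Rightarrow> ('a \<times> nat) tstruct set" where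
  "deformed_covers d G S s = {deform A F | A F. A \<in> SL_pm \<and> F \<in> covers d G S s}"

definition cover_orbit_space ::
  "nat \<Rightarrow> (nat \<Rightarrow> nat) set \<Rightarrow> 'a surface_form \<Rightarrow> 'a \<Rightarrow> ('a \<times> nat) tstruct set topology" where
  "cover_orbit_space d G S s =
     quotient_topology (prod_topology (top_of_set SL_pm) (cover_space d G S s))
       (\<lambda>(A, C). \<Union>F\<in>C. tclass (deformed_covers d G S s) (deform A F))"

definition omega_limit_point :: "'a topology \<Rightarrow> (real \<Rightarrow> 'a) \<Rightarrow> 'a \<Rightarrow> bool" where
  "omega_limit_point X f x \<longleftrightarrow>
     (\<exists>t :: nat \<Rightarrow> real. filterlim t at_top sequentially \<and> limitin X (\<lambda>n. f (t n)) x sequentially)"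

end

(*
The Teichmueller trajectory of S lifts from SL_pm/V(S) to SL_pm: the projection is open, so
g^(t_n) = A_n h_n with A_n convergent and h_n in the Veech group.  The deformed cover h_n M is
again a cover of S, because h_n S is translation equivalent to S, and its monodromy rho_n still
takes values in G.  The fundamental group of a surface is countable and G is finite, so a
subsequence of rho_n converges pointwise to a homomorphism.  As g^(t_n) M is equivalent to
A_n (h_n M), it converges along this subsequence by continuity of the quotient maps.
*)

theory Submission
  imports Defs
begin

section \<open>Form-preserving maps and translation charts\<close>

text \<open>A matrix \<open>h\<close> of the Veech group acts only real-linearly, so
  \<open>h M\<close> does not inherit a complex structure from \<open>M\<close>. A translation
  equivalence \<open>f\<close> from \<open>h S\<close> to \<open>S\<close> is composed with the
  projection \<open>p\<close>, and the total space receives a new complex structure, the pullback of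
  that of \<open>S\<close> under \<open>f \<circ> p\<close>; old and new surface are compared only
  as translation structures. Since \<open>f\<close> need not fix the base point, the fiber labels
  are carried along lifts of a path \<open>\<delta>\<close> from \<open>s\<close> to the preimage of
  \<open>s\<close>. The new homomorphism then takes at each loop class the value of the old one at a
  transported class, so its image lies in the image of the old one, whatever the subgroup
  \<open>G\<close> is. Openness of the projection matters for the orbit of \<open>S\<close> only.
  For covers, convergence is established for matrices and homomorphisms and then pushed forward
  through the quotient maps. All classes consist of structures on \<open>'a \<times> nat\<close>,
  while \<open>M\<close> may live on any type; hence the deformed covers are rebuilt on that type, a
  point being encoded by its image and a number that singles it out in its fiber.\<close>

lemma chart_onD:
  assumes "chart_on X (U, \<phi>)"
  shows "openin X U" "open (\<phi> ` U)" "inj_on \<phi> U"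
    "homeomorphic_map (subtopology X U) (top_of_set (\<phi> ` U)) \<phi>"
    "continuous_map (subtopology X U) euclidean \<phi>"
proof -
  show *: "openin X U" "open (\<phi> ` U)"
    and h: "homeomorphic_map (subtopology X U) (top_of_set (\<phi> ` U)) \<phi>"
    using assms by (auto simp: chart_on_def)
  have "topspace (subtopology X U) = U"
    using * openin_subset by fastforce
  then show "inj_on \<phi> U"
    using homeomorphic_imp_injective_map[OF h] by simp
  show "continuous_map (subtopology X U) euclidean \<phi>"
    using homeomorphic_imp_continuous_map[OF h] continuous_map_into_fulltopology by blast
qed

lemma chart_image_open:
  assumes c: "chart_on X (U, \<phi>)" and W: "openin X W" "W \<subseteq> U"
  shows "open (\<phi> ` W)"
proof -
  have "openin (subtopology X U) W"
    using W by (simp add: openin_subtopology_alt inf.absorb2) (use W in blast)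
  then have "openin (top_of_set (\<phi> ` U)) (\<phi> ` W)"
    using homeomorphic_imp_open_map[OF chart_onD(4)[OF c]] by (simp add: open_map_def)
  then show ?thesis
    using chart_onD(2)[OF c] openin_open_trans by blast
qed

lemma chart_preimage_open:
  assumes c: "chart_on X (U, \<phi>)" and B: "open B"
  shows "openin X {q \<in> U. \<phi> q \<in> B}"
proof -
  have "openin (subtopology X U) {q \<in> topspace (subtopology X U). \<phi> q \<in> B}"
    using chart_onD(5)[OF c] B by (simp add: continuous_map_def)
  moreover have "topspace (subtopology X U) = U"
    using chart_onD(1)[OF c] openin_subset by fastforce
  ultimately show ?thesis
    using chart_onD(1)[OF c] openin_trans_full by fastforce
qed

text \<open>Covers both the identity of a surface and covering projections. Local injectivity
  excludes critical points, so that the zeros upstairs are precisely the preimages of the zeros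
  downstairs.\<close>

definition form_map :: "'a surface_form \<Rightarrow> 'b surface_form \<Rightarrow> ('b \<Rightarrow> 'a) \<Rightarrow> bool" where
  "form_map S M p \<longleftrightarrow>
     holomorphic_1form S \<and> holomorphic_1form M \<and> continuous_map (topo M) (topo S) p \<and>
     (\<forall>y\<in>topspace (topo M). \<exists>W. openin (topo M) W \<and> y \<in> W \<and> inj_on p W) \<and>
     (\<forall>(U, \<phi>)\<in>atlas S. \<forall>(V, \<psi>)\<in>atlas M.
        (\<phi> \<circ> p \<circ> inv_into V \<psi>) holomorphic_on \<psi> ` {y \<in> V. p y \<in> U} \<and>
        (\<forall>y\<in>V. p y \<in> U \<longrightarrow> form M (V, \<psi>) (\<psi> y) =
           form S (U, \<phi>) (\<phi> (p y)) * deriv (\<phi> \<circ> p \<circ> inv_into V \<psi>) (\<psi> y)))"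

lemma form_mapD:
  assumes "form_map S M p"
  shows "holomorphic_1form S" "holomorphic_1form M" "continuous_map (topo M) (topo S) p"
    "y \<in> topspace (topo M) \<Longrightarrow> \<exists>W. openin (topo M) W \<and> y \<in> W \<and> inj_on p W"
    "\<lbrakk>(U, \<phi>) \<in> atlas S; (V, \<psi>) \<in> atlas M\<rbrakk> \<Longrightarrow>
       (\<phi> \<circ> p \<circ> inv_into V \<psi>) holomorphic_on \<psi> ` {y \<in> V. p y \<in> U}"
    "\<lbrakk>(U, \<phi>) \<in> atlas S; (V, \<psi>) \<in> atlas M; y \<in> V; p y \<in> U\<rbrakk> \<Longrightarrow>
       form M (V, \<psi>) (\<psi> y) =
         form S (U, \<phi>) (\<phi> (p y)) * deriv (\<phi> \<circ> p \<circ> inv_into V \<psi>) (\<psi> y)"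
  using assms unfolding form_map_def by fast+

lemma holomorphic_1formD:
  assumes "holomorphic_1form M"
  shows "(U, \<phi>) \<in> atlas M \<Longrightarrow> chart_on (topo M) (U, \<phi>)"
    "topspace (topo M) = (\<Union>(U, \<phi>)\<in>atlas M. U)"
    "(U, \<phi>) \<in> atlas M \<Longrightarrow> form M (U, \<phi>) holomorphic_on \<phi> ` U"
    "\<lbrakk>(U, \<phi>) \<in> atlas M; (V, \<psi>) \<in> atlas M\<rbrakk> \<Longrightarrow>
       (\<phi> \<circ> inv_into V \<psi>) holomorphic_on \<psi> ` (U \<inter> V)"
    "\<lbrakk>(U, \<phi>) \<in> atlas M; (V, \<psi>) \<in> atlas M; q \<in> U; q \<in> V\<rbrakk> \<Longrightarrow>
       form M (V, \<psi>) (\<psi> q) = form M (U, \<phi>) (\<phi> q) * deriv (\<phi> \<circ> inv_into V \<psi>) (\<psi> q)"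
  using assms unfolding holomorphic_1form_def by (fast | blast)+

lemma atlas_chart_at:
  assumes "holomorphic_1form M" "q \<in> topspace (topo M)"
  obtains U \<phi> where "(U, \<phi>) \<in> atlas M" "q \<in> U"
  using holomorphic_1formD(2)[OF assms(1)] assms(2) by auto

text \<open>With this, compatibility of charts within one surface becomes a case of the statements
  about \<open>p\<close>: vanishing of the form does not depend on the chart, and translation charts
  differ by translations.\<close>

lemma form_map_id:
  assumes M: "holomorphic_1form M"
  shows "form_map M M id"
proof -
  have *: "{y \<in> V. id y \<in> U} = U \<inter> V" for U V :: "'a set" by auto
  show ?thesis
    unfolding form_map_def
  proof (intro conjI ballI, goal_cases)
    case (5 a)
    obtain U \<phi> where a: "a = (U, \<phi>)" by (metis surj_pair)
    have "(\<phi> \<circ> id \<circ> inv_into V \<psi>) holomorphic_on \<psi> ` {y \<in> V. id y \<in> U} \<and>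
        (\<forall>y\<in>V. id y \<in> U \<longrightarrow> form M (V, \<psi>) (\<psi> y) =
           form M (U, \<phi>) (\<phi> (id y)) * deriv (\<phi> \<circ> id \<circ> inv_into V \<psi>) (\<psi> y))"
      if "(V, \<psi>) \<in> atlas M" for V \<psi>
      using holomorphic_1formD(4,5)[OF M, of U \<phi> V \<psi>] that 5 a unfolding * by simp
    then show ?case unfolding a by blast
  next
    case (4 y)
    then show ?case by (intro exI[of _ "topspace (topo M)"]) simp
  qed (simp_all add: M)
qed

text \<open>Near \<open>y\<close> the coordinate expression of \<open>p\<close> is injective and
  holomorphic, so its derivative at \<open>\<psi> y\<close> is not 0, and the two coefficients
  differ by this nonzero factor.\<close>

lemma form_map_zero_iff:
  assumes p: "form_map S M p" and U: "(U, \<phi>) \<in> atlas S" and V: "(V, \<psi>) \<in> atlas M"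
    and y: "y \<in> V" "p y \<in> U"
  shows "form M (V, \<psi>) (\<psi> y) = 0 \<longleftrightarrow> form S (U, \<phi>) (\<phi> (p y)) = 0"
proof -
  have cU: "chart_on (topo S) (U, \<phi>)" and cV: "chart_on (topo M) (V, \<psi>)"
    using form_mapD(1,2)[OF p] U V holomorphic_1formD(1) by blast+
  have ytop: "y \<in> topspace (topo M)"
    using chart_onD(1)[OF cV] y openin_subset by blast
  obtain W where W: "openin (topo M) W" "y \<in> W" "inj_on p W"
    using form_mapD(4)[OF p ytop] by blast
  define N where "N = W \<inter> V \<inter> {r \<in> topspace (topo M). p r \<in> U}"
  have N: "openin (topo M) N" unfolding N_def
    using W(1) chart_onD(1)[OF cV] chart_onD(1)[OF cU] form_mapD(3)[OF p]
    by (intro openin_Int) (auto simp: continuous_map_def)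
  have yN: "y \<in> N" using W y ytop by (simp add: N_def)
  have "open (\<psi> ` N)"
    by (rule chart_image_open[OF cV N]) (auto simp: N_def)
  moreover have "(\<phi> \<circ> p \<circ> inv_into V \<psi>) holomorphic_on \<psi> ` N"
    by (rule holomorphic_on_subset[OF form_mapD(5)[OF p U V]]) (auto simp: N_def)
  moreover have "inj_on (\<phi> \<circ> p \<circ> inv_into V \<psi>) (\<psi> ` N)"
  proof (rule inj_onI, clarsimp)
    fix a b assume a: "a \<in> N" and b: "b \<in> N"
      and eq: "\<phi> (p (inv_into V \<psi> (\<psi> a))) = \<phi> (p (inv_into V \<psi> (\<psi> b)))"
    have i: "inv_into V \<psi> (\<psi> a) = a" "inv_into V \<psi> (\<psi> b) = b"
      using a b chart_onD(3)[OF cV] by (auto simp: N_def)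
    then have "p a = p b" using eq a b chart_onD(3)[OF cU] unfolding inj_on_def N_def by auto
    then show "\<psi> a = \<psi> b" using W(3) a b unfolding inj_on_def N_def by auto
  qed
  ultimately have "deriv (\<phi> \<circ> p \<circ> inv_into V \<psi>) (\<psi> y) \<noteq> 0"
    using holomorphic_injective_imp_regular yN by blast
  then show ?thesis
    using form_mapD(6)[OF p U V y] by simp
qed

lemma zeros_subset_topspace: "holomorphic_1form M \<Longrightarrow> zeros M \<subseteq> topspace (topo M)"
  using holomorphic_1formD(2) by (fastforce simp: zeros_def)

lemma form_map_zeros:
  assumes p: "form_map S M p"
  shows "zeros M = {y \<in> topspace (topo M). p y \<in> zeros S}"
proof (intro Set.set_eqI iffI)
  fix y assume y: "y \<in> zeros M"
  then obtain V \<psi> where V: "(V, \<psi>) \<in> atlas M" "y \<in> V" "form M (V, \<psi>) (\<psi> y) = 0"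
    by (auto simp: zeros_def)
  have yt: "y \<in> topspace (topo M)"
    using y zeros_subset_topspace[OF form_mapD(2)[OF p]] by blast
  then have "p y \<in> topspace (topo S)"
    using form_mapD(3)[OF p] by (auto simp: continuous_map_def)
  then obtain U \<phi> where "(U, \<phi>) \<in> atlas S" "p y \<in> U"
    using atlas_chart_at form_mapD(1)[OF p] by metis
  with V yt form_map_zero_iff[OF p] show "y \<in> {y \<in> topspace (topo M). p y \<in> zeros S}"
    unfolding zeros_def by blast
next
  fix y assume y: "y \<in> {y \<in> topspace (topo M). p y \<in> zeros S}"
  then obtain U \<phi> where "(U, \<phi>) \<in> atlas S" "p y \<in> U" "form S (U, \<phi>) (\<phi> (p y)) = 0"
    by (auto simp: zeros_def)
  moreover obtain V \<psi> where "(V, \<psi>) \<in> atlas M" "y \<in> V"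
    using atlas_chart_at form_mapD(2)[OF p] y by (metis (mono_tags, lifting) mem_Collect_eq)
  ultimately show "y \<in> zeros M"
    using form_map_zero_iff[OF p] unfolding zeros_def by blast
qed

section \<open>Primitives of the form and translation charts\<close>

lemma linepath_integral_primitive:
  assumes "convex C" "open C" "f holomorphic_on C" "a \<in> C"
  shows "\<And>z. z \<in> C \<Longrightarrow>
    ((\<lambda>z. contour_integral (linepath a z) f) has_field_derivative f z) (at z)"
proof -
  obtain g where g: "\<And>x. x \<in> C \<Longrightarrow> (g has_field_derivative f x) (at x within C)"
    using holomorphic_convex_primitive'[OF assms(1-3)] by blast
  have eq: "contour_integral (linepath a z) f = g z - g a" if "z \<in> C" for z
  proof -
    have "path_image (linepath a z) \<subseteq> C"
      using closed_segment_subset[OF assms(4) that assms(1)] by simp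
    then have "(f has_contour_integral g (pathfinish (linepath a z)) - g (pathstart (linepath a z))) (linepath a z)"
      by (rule contour_integral_primitive[OF g _ , rotated 2]) (simp_all add: valid_path_linepath)
    then show ?thesis by (simp add: contour_integral_unique)
  qed
  fix z assume z: "z \<in> C"
  have "(g has_field_derivative f z) (at z)"
    using g[OF z] at_within_open[OF z assms(2)] by simp
  then have "((\<lambda>z. g z - g a) has_field_derivative f z) (at z)"
    by (auto intro!: derivative_eq_intros)
  then show "((\<lambda>z. contour_integral (linepath a z) f) has_field_derivative f z) (at z)"
    by (rule has_field_derivative_transform_within_open[OF _ assms(2) z]) (simp add: eq)
qed

text \<open>Forgets the base point of the integral: later arguments need only that
  \<open>\<zeta>\<close>, read in the coordinate \<open>\<phi>\<close>, is a primitive of the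
  coefficient.\<close>

lemma translation_chartE:
  assumes M: "holomorphic_1form M" and "(U, \<zeta>) \<in> translation_charts M"
  obtains V \<phi> g where "(V, \<phi>) \<in> atlas M" "openin (topo M) U" "U \<subseteq> V" "U \<inter> zeros M = {}"
    "\<And>q. q \<in> U \<Longrightarrow> \<zeta> q = g (\<phi> q)"
    "\<And>z. z \<in> \<phi> ` U \<Longrightarrow> (g has_field_derivative form M (V, \<phi>) z) (at z)"
proof -
  obtain V \<phi> p where *: "(V, \<phi>) \<in> atlas M" "openin (topo M) U" "p \<in> U" "U \<subseteq> V" "U \<inter> zeros M = {}"
    "convex (\<phi> ` U)" "\<zeta> = (\<lambda>q. contour_integral (linepath (\<phi> p) (\<phi> q)) (form M (V, \<phi>)))"
    using assms(2) unfolding translation_charts_def by blast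
  have "open (\<phi> ` U)"
    using chart_image_open[OF holomorphic_1formD(1)[OF M *(1)] *(2,4)] .
  have hol: "form M (V, \<phi>) holomorphic_on \<phi> ` U"
    by (rule holomorphic_on_subset[OF holomorphic_1formD(3)[OF M *(1)] image_mono[OF *(4)]])
  have "\<phi> p \<in> \<phi> ` U" using *(3) by blast
  from linepath_integral_primitive[OF *(6) \<open>open (\<phi> ` U)\<close> hol this] show thesis
    by (intro that[OF *(1,2,4,5)]) (simp_all add: *(7))
qed

text \<open>A primitive \<open>G\<close> of the coefficient has nonzero derivative at a point that
  is not a zero, so it is injective on a small ball; the ball is pulled back to the surface.\<close>

lemma translation_chart_at:
  assumes M: "holomorphic_1form M" and q: "q \<in> topspace (topo M)" "q \<notin> zeros M"
  obtains U \<zeta> where "(U, \<zeta>) \<in> translation_charts M" "q \<in> U"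
proof -
  obtain V \<phi> where V: "(V, \<phi>) \<in> atlas M" "q \<in> V"
    using atlas_chart_at[OF M q(1)] by blast
  define f where "f = form M (V, \<phi>)"
  have c: "chart_on (topo M) (V, \<phi>)" using holomorphic_1formD(1)[OF M V(1)] .
  have hol: "f holomorphic_on \<phi> ` V" using holomorphic_1formD(3)[OF M V(1)] by (simp add: f_def)
  have "f (\<phi> q) \<noteq> 0" using V q by (auto simp: zeros_def f_def)
  obtain e where e: "e > 0" "ball (\<phi> q) e \<subseteq> \<phi> ` V"
    using chart_onD(2)[OF c] V(2) open_contains_ball by blast
  \<comment> \<open>Within radius \<open>e'\<close> the coefficient stays away from 0, so that the
    future chart domain avoids the zeros.\<close>
  obtain e' where e': "e' > 0" "\<And>z. dist (\<phi> q) z < e' \<Longrightarrow> f z \<noteq> 0"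
  proof -
    have "isCont f (\<phi> q)"
      using hol chart_onD(2)[OF c] V(2) by (meson continuous_on_eq_continuous_at holomorphic_on_imp_continuous_on imageI)
    then show thesis using continuous_at_avoid[of "\<phi> q" f 0] \<open>f (\<phi> q) \<noteq> 0\<close> that by blast
  qed
  define B where "B = ball (\<phi> q) (min e e')"
  define G where "G = (\<lambda>z. contour_integral (linepath (\<phi> q) z) f)"
  have B: "B \<subseteq> \<phi> ` V" "open B" "convex B" "\<phi> q \<in> B" using e e' by (auto simp: B_def)
  have G: "(G has_field_derivative f z) (at z)" if "z \<in> B" for z
    unfolding G_def using linepath_integral_primitive[OF B(3,2) holomorphic_on_subset[OF hol B(1)] B(4) that] .
  then have "G holomorphic_on B" using B(2) holomorphic_on_open by blast
  moreover have "deriv G (\<phi> q) \<noteq> 0" using DERIV_imp_deriv[OF G[OF B(4)]] \<open>f (\<phi> q) \<noteq> 0\<close> by simp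
  ultimately obtain r where r: "r > 0" "ball (\<phi> q) r \<subseteq> B" "inj_on G (ball (\<phi> q) r)"
    using has_complex_derivative_locally_injective[OF _ B(4,2)] by blast
  define U where "U = {x \<in> V. \<phi> x \<in> ball (\<phi> q) r}"
  have im: "\<phi> ` U = ball (\<phi> q) r" using r(2) B(1) by (auto simp: U_def)
  have "openin (topo M) U" unfolding U_def by (rule chart_preimage_open[OF c]) simp
  moreover have "q \<in> U" using V r by (simp add: U_def)
  \<comment> \<open>A zero may be witnessed in a different chart; the comparison for the identity
    map moves it to \<open>(V, \<phi>)\<close>, where \<open>f\<close> does not vanish on
    \<open>B\<close>.\<close>
  moreover have "U \<inter> zeros M = {}"
  proof (rule ccontr)
    assume "U \<inter> zeros M \<noteq> {}"
    then obtain x where x: "x \<in> U" "x \<in> zeros M" by blast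
    then obtain V' \<phi>' where "(V', \<phi>') \<in> atlas M" "x \<in> V'" "form M (V', \<phi>') (\<phi>' x) = 0"
      by (auto simp: zeros_def)
    then have "f (\<phi> x) = 0"
      using form_map_zero_iff[OF form_map_id[OF M] V(1), of V' \<phi>' x] x by (auto simp: U_def f_def)
    moreover have "\<phi> x \<in> B" using x r(2) by (auto simp: U_def)
    ultimately show False using e'(2) by (auto simp: B_def)
  qed
  moreover have "inj_on (G \<circ> \<phi>) U"
    using chart_onD(3)[OF c] r(3) im by (intro comp_inj_on) (auto simp: inj_on_def U_def)
  moreover have "G \<circ> \<phi> = (\<lambda>x. contour_integral (linepath (\<phi> q) (\<phi> x)) (form M (V, \<phi>)))"
    by (simp add: fun_eq_iff G_def f_def)
  moreover have "U \<subseteq> V" "convex (\<phi> ` U)" using im by (auto simp: U_def)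
  ultimately have "(U, G \<circ> \<phi>) \<in> translation_charts M"
    unfolding translation_charts_def mem_Collect_eq using V(1)
    by - (rule exI[of _ U], rule exI[of _ "G \<circ> \<phi>"], rule conjI[OF refl], rule exI[of _ V],
        rule exI[of _ \<phi>], rule exI[of _ q], intro conjI)
  from that[OF this \<open>q \<in> U\<close>] show thesis .
qed

text \<open>By the chain rule and the pullback formula the two primitives have the same derivative
  in the coordinate \<open>\<psi>\<close>. Taking for \<open>W\<close> the preimage of a ball makes
  their difference constant on all of it.\<close>

lemma form_map_translation_charts:
  assumes p: "form_map S M p" and V: "(V, \<zeta>) \<in> translation_charts M"
    and U: "(U, \<xi>) \<in> translation_charts S" and y: "y \<in> V" "p y \<in> U"
  obtains W c where "openin (topo M) W" "y \<in> W" "W \<subseteq> V" "p ` W \<subseteq> U" "\<And>r. r \<in> W \<Longrightarrow> \<xi> (p r) = \<zeta> r + c"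
proof -
  obtain V0 \<psi> gM where V0: "(V0, \<psi>) \<in> atlas M" "openin (topo M) V" "V \<subseteq> V0"
    "\<And>q. q \<in> V \<Longrightarrow> \<zeta> q = gM (\<psi> q)"
    "\<And>z. z \<in> \<psi> ` V \<Longrightarrow> (gM has_field_derivative form M (V0, \<psi>) z) (at z)"
    using translation_chartE[OF form_mapD(2)[OF p] V] by metis
  obtain U0 \<phi> gS where U0: "(U0, \<phi>) \<in> atlas S" "openin (topo S) U" "U \<subseteq> U0"
    "\<And>q. q \<in> U \<Longrightarrow> \<xi> q = gS (\<phi> q)"
    "\<And>z. z \<in> \<phi> ` U \<Longrightarrow> (gS has_field_derivative form S (U0, \<phi>) z) (at z)"
    using translation_chartE[OF form_mapD(1)[OF p] U] by metis
  have cV: "chart_on (topo M) (V0, \<psi>)" and cU: "chart_on (topo S) (U0, \<phi>)"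
    using form_mapD(1,2)[OF p] U0(1) V0(1) holomorphic_1formD(1) by blast+
  define N where "N = V \<inter> {r \<in> topspace (topo M). p r \<in> U}"
  have N: "openin (topo M) N" unfolding N_def
    using V0(2) U0(2) form_mapD(3)[OF p] by (intro openin_Int) (auto simp: continuous_map_def)
  have yN: "y \<in> N" using y V0(2) openin_subset by (fastforce simp: N_def)
  have "open (\<psi> ` N)"
    by (rule chart_image_open[OF cV N]) (use V0(3) in \<open>auto simp: N_def\<close>)
  then obtain r where r: "r > 0" "ball (\<psi> y) r \<subseteq> \<psi> ` N"
    using yN open_contains_ball by blast
  define B where "B = ball (\<psi> y) r"
  define W where "W = {x \<in> V0. \<psi> x \<in> B}"
  have "openin (topo M) W" unfolding W_def B_def by (rule chart_preimage_open[OF cV]) simp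
  have WN: "W \<subseteq> N"
  proof
    fix x assume x: "x \<in> W"
    then obtain x' where x': "x' \<in> N" "\<psi> x = \<psi> x'" using r by (auto simp: W_def B_def)
    then have "x = x'" using chart_onD(3)[OF cV] x V0(3) by (auto simp: inj_on_def W_def N_def)
    then show "x \<in> N" using x' by simp
  qed
  have "y \<in> W" using y V0(3) r by (auto simp: W_def B_def)
  define F where "F = \<phi> \<circ> p \<circ> inv_into V0 \<psi>"
  have Fx: "F (\<psi> x) = \<phi> (p x)" if "x \<in> V0" for x
    using that chart_onD(3)[OF cV] by (simp add: F_def)
  have hol: "F holomorphic_on B"
    unfolding F_def
    by (rule holomorphic_on_subset[OF form_mapD(5)[OF p U0(1) V0(1)]])
       (use r U0(3) V0(3) in \<open>force simp: B_def N_def\<close>)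
  define D where "D = (\<lambda>z. gS (F z) - gM z)"
  have D0: "(D has_field_derivative 0) (at z)" if zB: "z \<in> B" for z
  proof -
    obtain x where x: "x \<in> N" "z = \<psi> x" using zB r(2) unfolding B_def by blast
    have xV: "x \<in> V" "x \<in> V0" and px: "p x \<in> U" "p x \<in> U0" using x V0(3) U0(3) by (auto simp: N_def)
    have "(F has_field_derivative deriv F z) (at z)"
      using hol that by (simp add: B_def holomorphic_derivI)
    moreover have "(gS has_field_derivative form S (U0, \<phi>) (F z)) (at (F z))"
      using U0(5) px xV by (simp add: x(2) Fx)
    ultimately have "((\<lambda>z. gS (F z)) has_field_derivative form S (U0, \<phi>) (F z) * deriv F z) (at z)"
      using DERIV_chain2 by blast
    moreover have "(gM has_field_derivative form M (V0, \<psi>) z) (at z)"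
      using V0(5) xV x by blast
    moreover have "form M (V0, \<psi>) z = form S (U0, \<phi>) (F z) * deriv F z"
      using form_mapD(6)[OF p U0(1) V0(1) xV(2) px(2)] Fx[OF xV(2)] by (simp add: x(2) F_def)
    ultimately have "((\<lambda>z. gS (F z) - gM z) has_field_derivative
        form S (U0, \<phi>) (F z) * deriv F z - form S (U0, \<phi>) (F z) * deriv F z) (at z)"
      using DERIV_diff by metis
    then show ?thesis by (simp add: D_def)
  qed
  have "continuous_on B D"
    by (rule DERIV_continuous_on[OF has_field_derivative_at_within[OF D0]])
  then have "D constant_on B"
    by (intro DERIV_zero_connected_constant_on[of B "{}"]) (use D0 in \<open>simp_all add: B_def\<close>)
  then obtain c where c: "\<And>z. z \<in> B \<Longrightarrow> D z = c" unfolding constant_on_def by blast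
  have "\<xi> (p x) = \<zeta> x + c" if "x \<in> W" for x
  proof -
    have "x \<in> N" using that WN by blast
    then have "\<xi> (p x) = gS (F (\<psi> x))" "\<zeta> x = gM (\<psi> x)"
      using U0(4) V0(3,4) Fx by (auto simp: N_def)
    moreover have "\<psi> x \<in> B" using that by (simp add: W_def)
    ultimately show ?thesis using c[of "\<psi> x"] by (simp add: D_def algebra_simps)
  qed
  then show thesis
    using that[OF \<open>openin (topo M) W\<close> \<open>y \<in> W\<close>] WN by (auto simp: N_def)
qed

section \<open>Translation equivalence\<close>

text \<open>The condition on a single map is split off because the map itself is needed later: it is
  composed with the projection of a cover.\<close>

definition translation_iso :: "'a tstruct \<Rightarrow> 'b tstruct \<Rightarrow> ('a \<Rightarrow> 'b) \<Rightarrow> bool" where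
  "translation_iso F F' h \<longleftrightarrow>
     homeomorphic_map (ttopo F) (ttopo F') h \<and> h ` tsing F = tsing F' \<and>
     (\<forall>(U, \<zeta>)\<in>tcharts F. \<forall>(V, \<xi>)\<in>tcharts F'. \<forall>q\<in>U. h q \<in> V \<longrightarrow>
        (\<exists>W c. openin (ttopo F) W \<and> q \<in> W \<and> W \<subseteq> U \<and> h ` W \<subseteq> V \<and>
           (\<forall>r\<in>W. \<xi> (h r) = \<zeta> r + c)))"

lemma translation_equivalent_iff_iso: "translation_equivalent F F' \<longleftrightarrow> (\<exists>h. translation_iso F F' h)"
  by (simp add: translation_equivalent_def translation_iso_def)

lemma translation_isoD:
  assumes "translation_iso F F' h"
  shows "homeomorphic_map (ttopo F) (ttopo F') h" "h ` tsing F = tsing F'"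
    "\<lbrakk>(U, \<zeta>) \<in> tcharts F; (V, \<xi>) \<in> tcharts F'; q \<in> U; h q \<in> V\<rbrakk> \<Longrightarrow>
       \<exists>W c. openin (ttopo F) W \<and> q \<in> W \<and> W \<subseteq> U \<and> h ` W \<subseteq> V \<and> (\<forall>r\<in>W. \<xi> (h r) = \<zeta> r + c)"
  using assms unfolding translation_iso_def by fast+

lemma translation_isoI:
  assumes "homeomorphic_map (ttopo F) (ttopo F') h" "h ` tsing F = tsing F'"
    "\<And>U \<zeta> V \<xi> q. \<lbrakk>(U, \<zeta>) \<in> tcharts F; (V, \<xi>) \<in> tcharts F'; q \<in> U; h q \<in> V\<rbrakk> \<Longrightarrow>
       \<exists>W c. openin (ttopo F) W \<and> q \<in> W \<and> W \<subseteq> U \<and> h ` W \<subseteq> V \<and> (\<forall>r\<in>W. \<xi> (h r) = \<zeta> r + c)"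
  shows "translation_iso F F' h"
  unfolding translation_iso_def
  by (intro conjI assms(1,2), clarify, rule assms(3))

text \<open>The regularity of the set of charts that makes translation equivalence symmetric and
  transitive.\<close>

definition charted :: "'a tstruct \<Rightarrow> bool" where
  "charted F \<longleftrightarrow> tsing F \<subseteq> topspace (ttopo F) \<and>
     (\<forall>(U, \<zeta>)\<in>tcharts F. openin (ttopo F) U \<and> U \<inter> tsing F = {}) \<and>
     (\<forall>q\<in>topspace (ttopo F) - tsing F. \<exists>(U, \<zeta>)\<in>tcharts F. q \<in> U)"

lemma chartedD:
  assumes "charted F"
  shows "tsing F \<subseteq> topspace (ttopo F)"
    "(U, \<zeta>) \<in> tcharts F \<Longrightarrow> openin (ttopo F) U" "(U, \<zeta>) \<in> tcharts F \<Longrightarrow> U \<inter> tsing F = {}"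
    "q \<in> topspace (ttopo F) - tsing F \<Longrightarrow> \<exists>U \<zeta>. (U, \<zeta>) \<in> tcharts F \<and> q \<in> U"
proof -
  have *: "\<forall>(U, \<zeta>)\<in>tcharts F. openin (ttopo F) U \<and> U \<inter> tsing F = {}"
    and **: "\<forall>q\<in>topspace (ttopo F) - tsing F. \<exists>(U, \<zeta>)\<in>tcharts F. q \<in> U"
    using assms by (simp_all add: charted_def)
  show "tsing F \<subseteq> topspace (ttopo F)" using assms by (simp add: charted_def)
  show "openin (ttopo F) U" "U \<inter> tsing F = {}" if "(U, \<zeta>) \<in> tcharts F"
    using bspec[OF * that] by simp_all
  show "\<exists>U \<zeta>. (U, \<zeta>) \<in> tcharts F \<and> q \<in> U" if "q \<in> topspace (ttopo F) - tsing F"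
    using bspec[OF ** that] by force
qed

lemma chartedI:
  assumes "tsing F \<subseteq> topspace (ttopo F)"
    "\<And>U \<zeta>. (U, \<zeta>) \<in> tcharts F \<Longrightarrow> openin (ttopo F) U \<and> U \<inter> tsing F = {}"
    "\<And>q. q \<in> topspace (ttopo F) - tsing F \<Longrightarrow> \<exists>U \<zeta>. (U, \<zeta>) \<in> tcharts F \<and> q \<in> U"
  shows "charted F"
  unfolding charted_def
proof (intro conjI assms(1) ballI)
  fix q assume "q \<in> topspace (ttopo F) - tsing F"
  then obtain U \<zeta> where "(U, \<zeta>) \<in> tcharts F" "q \<in> U" using assms(3) by blast
  then show "\<exists>(U, \<zeta>)\<in>tcharts F. q \<in> U" by (intro bexI[of _ "(U, \<zeta>)"]) simp_all
qed (use assms(2) in clarify)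

section \<open>The linear action on translation structures\<close>

lemma mat_act_add: "mat_act A (z + w) = mat_act A z + mat_act A w"
  by (simp add: mat_act_def complex_eq_iff algebra_simps)

lemma mat_act_mult: "mat_act (A ** B) z = mat_act A (mat_act B z)"
  by (simp add: mat_act_def matrix_matrix_mult_def sum_2 algebra_simps)

lemma mat_act_1: "mat_act (mat 1) z = z"
  by (simp add: mat_act_def mat_def)

lemma deform_simps [simp]:
  "ttopo (deform A F) = ttopo F" "tsing (deform A F) = tsing F"
  "tcharts (deform A F) = (\<lambda>(U, \<zeta>). (U, mat_act A \<circ> \<zeta>)) ` tcharts F"
  by (simp_all add: deform_def)

lemma tstruct_of_simps [simp]:
  "ttopo (tstruct_of M) = topo M" "tsing (tstruct_of M) = zeros M"
  "tcharts (tstruct_of M) = translation_charts M"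
  by (simp_all add: tstruct_of_def)

lemma deform_deform:
  fixes F :: "'a tstruct"
  shows "deform A (deform B F) = deform (A ** B) F"
proof -
  have "(\<lambda>(U, \<zeta>). (U, mat_act A \<circ> \<zeta>)) \<circ> (\<lambda>(U, \<zeta>). (U, mat_act B \<circ> \<zeta>)) =
      (\<lambda>(U :: 'a set, \<zeta>). (U, mat_act (A ** B) \<circ> \<zeta>))"
    by (auto simp: fun_eq_iff mat_act_mult)
  then have "tcharts (deform A (deform B F)) = tcharts (deform (A ** B) F)"
    unfolding deform_simps image_comp by (rule arg_cong)
  then show ?thesis by (intro tstruct.equality) simp_all
qed

lemma deform_1: "deform (mat 1) F = F"
  by (simp add: deform_def o_def mat_act_1)

lemma charted_tstruct_of:
  assumes M: "holomorphic_1form M"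
  shows "charted (tstruct_of M)"
proof -
  have "openin (topo M) U \<and> U \<inter> zeros M = {}" if "(U, \<zeta>) \<in> translation_charts M" for U \<zeta>
    using translation_chartE[OF M that] by metis
  moreover have "\<exists>U \<zeta>. (U, \<zeta>) \<in> translation_charts M \<and> q \<in> U"
    if "q \<in> topspace (topo M) - zeros M" for q
    using translation_chart_at[OF M] that by (metis Diff_iff)
  ultimately show ?thesis
    using zeros_subset_topspace[OF M] by (intro chartedI) simp_all
qed

lemma deform_chartE:
  assumes "(U, \<xi>) \<in> tcharts (deform A F)"
  obtains \<zeta> where "(U, \<zeta>) \<in> tcharts F" "\<xi> = mat_act A \<circ> \<zeta>"
  using assms by auto

lemma deform_chartI: "(U, \<zeta>) \<in> tcharts F \<Longrightarrow> (U, mat_act A \<circ> \<zeta>) \<in> tcharts (deform A F)"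
  by force

lemma charted_deform:
  assumes "charted F"
  shows "charted (deform A F)"
proof (rule chartedI)
  show "openin (ttopo (deform A F)) U \<and> U \<inter> tsing (deform A F) = {}"
    if "(U, \<zeta>) \<in> tcharts (deform A F)" for U \<zeta>
    using deform_chartE[OF that] chartedD(2,3)[OF assms] by (metis deform_simps(1,2))
  show "\<exists>U \<zeta>. (U, \<zeta>) \<in> tcharts (deform A F) \<and> q \<in> U"
    if "q \<in> topspace (ttopo (deform A F)) - tsing (deform A F)" for q
    using chartedD(4)[OF assms] deform_chartI that by (metis deform_simps(1,2))
qed (use chartedD(1)[OF assms] in simp)

text \<open>By additivity of the matrix action an offset \<open>c\<close> between charts becomes
  \<open>mat_act A c\<close>.\<close>

lemma translation_iso_deform:
  assumes "translation_iso F F' h"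
  shows "translation_iso (deform A F) (deform A F') h"
proof (rule translation_isoI)
  fix U \<zeta>A V \<xi>A q
  assume U: "(U, \<zeta>A) \<in> tcharts (deform A F)" and V: "(V, \<xi>A) \<in> tcharts (deform A F')"
    and q: "q \<in> U" "h q \<in> V"
  obtain \<zeta> where \<zeta>: "(U, \<zeta>) \<in> tcharts F" "\<zeta>A = mat_act A \<circ> \<zeta>" by (rule deform_chartE[OF U])
  obtain \<xi> where \<xi>: "(V, \<xi>) \<in> tcharts F'" "\<xi>A = mat_act A \<circ> \<xi>" by (rule deform_chartE[OF V])
  obtain W c where W: "openin (ttopo F) W" "q \<in> W" "W \<subseteq> U" "h ` W \<subseteq> V" "\<forall>r\<in>W. \<xi> (h r) = \<zeta> r + c"
    using translation_isoD(3)[OF assms \<zeta>(1) \<xi>(1) q] by blast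
  moreover have "\<forall>r\<in>W. \<xi>A (h r) = \<zeta>A r + mat_act A c"
    using W(5) by (simp add: \<zeta>(2) \<xi>(2) mat_act_add)
  ultimately show "\<exists>W c. openin (ttopo (deform A F)) W \<and> q \<in> W \<and> W \<subseteq> U \<and> h ` W \<subseteq> V \<and>
      (\<forall>r\<in>W. \<xi>A (h r) = \<zeta>A r + c)"
    unfolding deform_simps(1) by blast
qed (use translation_isoD(1,2)[OF assms] in simp_all)

lemma translation_equivalent_deform:
  "translation_equivalent F F' \<Longrightarrow> translation_equivalent (deform A F) (deform A F')"
  using translation_iso_deform by (metis translation_equivalent_iff_iso)

lemma translation_equivalent_sym:
  assumes "translation_equivalent F F'" and F: "charted F" and F': "charted F'"
  shows "translation_equivalent F' F"
proof -
  obtain h where h: "translation_iso F F' h"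
    using assms translation_equivalent_iff_iso by blast
  obtain k where k: "homeomorphic_maps (ttopo F) (ttopo F') h k"
    using translation_isoD(1)[OF h] homeomorphic_map_maps by blast
  have kh: "\<And>x. x \<in> topspace (ttopo F) \<Longrightarrow> k (h x) = x"
    and hk: "\<And>y. y \<in> topspace (ttopo F') \<Longrightarrow> h (k y) = y"
    using k by (auto simp: homeomorphic_maps_def)
  have "translation_iso F' F k"
  proof (rule translation_isoI)
    show "homeomorphic_map (ttopo F') (ttopo F) k"
      using k by (simp add: homeomorphic_maps_map)
    show "k ` tsing F' = tsing F"
      using translation_isoD(2)[OF h] kh chartedD(1)[OF F] by (force simp: image_image)
    fix V \<xi> U \<zeta> q
    assume V: "(V, \<xi>) \<in> tcharts F'" and U: "(U, \<zeta>) \<in> tcharts F" and q: "q \<in> V" "k q \<in> U"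
    have qt: "q \<in> topspace (ttopo F')"
      using chartedD(2)[OF F' V] q openin_subset by blast
    then obtain W c where W: "openin (ttopo F) W" "k q \<in> W" "W \<subseteq> U" "h ` W \<subseteq> V"
        "\<forall>r\<in>W. \<xi> (h r) = \<zeta> r + c"
      using translation_isoD(3)[OF h U V q(2)] q(1) hk by auto
    have Wt: "W \<subseteq> topspace (ttopo F)" using W(1) openin_subset by blast
    have "openin (ttopo F') (h ` W)"
      using homeomorphic_imp_open_map[OF translation_isoD(1)[OF h]] W(1) by (simp add: open_map_def)
    moreover have "q \<in> h ` W" using hk[OF qt] W(2) by force
    moreover have "\<forall>r\<in>h ` W. \<zeta> (k r) = \<xi> r + (- c)" using W(5) Wt kh by auto
    moreover have "k ` (h ` W) \<subseteq> U" using W(3) Wt kh by (force simp: image_subset_iff subset_iff)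
    ultimately show "\<exists>W c. openin (ttopo F') W \<and> q \<in> W \<and> W \<subseteq> V \<and> k ` W \<subseteq> U \<and> (\<forall>r\<in>W. \<zeta> (k r) = \<xi> r + c)"
      using W(4) by blast
  qed
  then show ?thesis using translation_equivalent_iff_iso by blast
qed

text \<open>To compare a chart of \<open>F\<close> at \<open>q\<close> with one of
  \<open>F''\<close>, a chart of \<open>F'\<close> around \<open>h q\<close> must be interposed. It
  exists because \<open>q\<close> is not singular and \<open>h\<close> is injective and carries
  singularities onto singularities.\<close>

lemma translation_equivalent_trans:
  assumes "translation_equivalent F F'" "translation_equivalent F' F''"
    and F: "charted F" and F': "charted F'"
  shows "translation_equivalent F F''"
proof -
  obtain h where h: "translation_iso F F' h"
    using assms translation_equivalent_iff_iso by blast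
  obtain k where k: "translation_iso F' F'' k"
    using assms translation_equivalent_iff_iso by blast
  have hom: "homeomorphic_map (ttopo F) (ttopo F') h" by (rule translation_isoD(1)[OF h])
  have conth: "continuous_map (ttopo F) (ttopo F') h" and injh: "inj_on h (topspace (ttopo F))"
    using hom homeomorphic_imp_continuous_map homeomorphic_imp_injective_map by blast+
  have "translation_iso F F'' (k \<circ> h)"
  proof (rule translation_isoI)
    show "homeomorphic_map (ttopo F) (ttopo F'') (k \<circ> h)"
      using homeomorphic_map_compose hom translation_isoD(1)[OF k] by blast
    show "(k \<circ> h) ` tsing F = tsing F''"
      using translation_isoD(2)[OF h] translation_isoD(2)[OF k] by (simp flip: image_image add: comp_def)
    fix U \<zeta> U'' \<zeta>'' q
    assume U: "(U, \<zeta>) \<in> tcharts F" and U'': "(U'', \<zeta>'') \<in> tcharts F''" and q: "q \<in> U" "(k \<circ> h) q \<in> U''"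
    have qt: "q \<in> topspace (ttopo F)" "q \<notin> tsing F"
      using chartedD(2,3)[OF F U] q openin_subset by blast+
    have "h q \<notin> tsing F'"
    proof
      assume "h q \<in> tsing F'"
      then obtain q' where "q' \<in> tsing F" "h q = h q'" using translation_isoD(2)[OF h] by auto
      then show False using injh qt chartedD(1)[OF F] by (metis inj_onD subsetD)
    qed
    moreover have "h q \<in> topspace (ttopo F')" using conth qt by (auto simp: continuous_map_def)
    ultimately obtain U' \<zeta>' where U': "(U', \<zeta>') \<in> tcharts F'" "h q \<in> U'"
      using chartedD(4)[OF F'] by blast
    obtain W c where W: "openin (ttopo F) W" "q \<in> W" "W \<subseteq> U" "h ` W \<subseteq> U'" "\<forall>r\<in>W. \<zeta>' (h r) = \<zeta> r + c"
      using translation_isoD(3)[OF h U U'(1) q(1) U'(2)] by blast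
    obtain W' c' where W': "openin (ttopo F') W'" "h q \<in> W'" "W' \<subseteq> U'" "k ` W' \<subseteq> U''" "\<forall>r\<in>W'. \<zeta>'' (k r) = \<zeta>' r + c'"
      using translation_isoD(3)[OF k U'(1) U'' U'(2)] q(2) by auto
    define N where "N = W \<inter> {r \<in> topspace (ttopo F). h r \<in> W'}"
    have "openin (ttopo F) N" unfolding N_def
      using W(1) W'(1) conth by (intro openin_Int) (auto simp: continuous_map_def)
    moreover have "q \<in> N" "N \<subseteq> U" "(k \<circ> h) ` N \<subseteq> U''" using W W' qt by (auto simp: N_def)
    moreover have "\<forall>r\<in>N. \<zeta>'' ((k \<circ> h) r) = \<zeta> r + (c + c')" using W(5) W'(5) by (auto simp: N_def)
    ultimately show "\<exists>W c. openin (ttopo F) W \<and> q \<in> W \<and> W \<subseteq> U \<and> (k \<circ> h) ` W \<subseteq> U'' \<and>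
        (\<forall>r\<in>W. \<zeta>'' ((k \<circ> h) r) = \<zeta> r + c)" by blast
  qed
  then show ?thesis using translation_equivalent_iff_iso by blast
qed

text \<open>Up to constants, translation charts upstairs are those of \<open>S\<close> composed with
  the projections, so a homeomorphism lying over a translation map is itself a translation in
  charts. It is applied with \<open>f\<close> the identity, to identify covers with equal monodromy,
  and with \<open>f\<close> from \<open>A S\<close> to \<open>S\<close>, to view a deformed cover as
  a cover of \<open>S\<close>.\<close>

lemma translation_iso_lift:
  assumes p: "form_map S M p" and p': "form_map S M' p'"
    and k: "homeomorphic_map (topo M) (topo M') k"
    and f: "translation_iso (deform A (tstruct_of S)) (tstruct_of S) f"
    and comm: "\<And>y. y \<in> topspace (topo M) \<Longrightarrow> p' (k y) = f (p y)"
  shows "translation_iso (deform A (tstruct_of M)) (tstruct_of M') k"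
proof -
  have contk: "continuous_map (topo M) (topo M') k" and surjk: "k ` topspace (topo M) = topspace (topo M')"
    using k homeomorphic_imp_continuous_map homeomorphic_imp_surjective_map by blast+
  have homf: "homeomorphic_map (topo S) (topo S) f" and fz: "f ` zeros S = zeros S"
    using translation_isoD(1,2)[OF f] by simp_all
  have pt: "p y \<in> topspace (topo S)" if "y \<in> topspace (topo M)" for y
    using form_mapD(3)[OF p] that by (auto simp: continuous_map_def)
  have fz_iff: "f x \<in> zeros S \<longleftrightarrow> x \<in> zeros S" if "x \<in> topspace (topo S)" for x
  proof
    assume "f x \<in> zeros S"
    then obtain x' where "x' \<in> zeros S" "f x = f x'" using fz by auto
    then show "x \<in> zeros S"
      using homeomorphic_imp_injective_map[OF homf] that zeros_subset_topspace[OF form_mapD(1)[OF p]]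
      by (metis inj_onD subsetD)
  qed (use fz in blast)
  have kz_iff: "k y \<in> zeros M' \<longleftrightarrow> y \<in> zeros M" if "y \<in> topspace (topo M)" for y
    using that surjk comm[OF that] fz_iff[OF pt[OF that]]
    by (auto simp: form_map_zeros[OF p] form_map_zeros[OF p'])
  have zeros_k: "k ` zeros M = zeros M'"
  proof
    show "k ` zeros M \<subseteq> zeros M'"
      using kz_iff zeros_subset_topspace[OF form_mapD(2)[OF p]] by blast
    show "zeros M' \<subseteq> k ` zeros M"
    proof
      fix z assume z: "z \<in> zeros M'"
      then obtain y where "y \<in> topspace (topo M)" "z = k y"
        using surjk zeros_subset_topspace[OF form_mapD(2)[OF p']] by blast
      then show "z \<in> k ` zeros M" using kz_iff z by blast
    qed
  qed
  show ?thesis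
  proof (rule translation_isoI)
    show "homeomorphic_map (ttopo (deform A (tstruct_of M))) (ttopo (tstruct_of M')) k"
      using k by simp
    show "k ` tsing (deform A (tstruct_of M)) = tsing (tstruct_of M')"
      using zeros_k by simp
    fix V \<zeta>A V' \<zeta>' y
    assume "(V, \<zeta>A) \<in> tcharts (deform A (tstruct_of M))" and "(V', \<zeta>') \<in> tcharts (tstruct_of M')"
      and y: "y \<in> V" "k y \<in> V'"
    then obtain \<zeta> where V: "(V, \<zeta>) \<in> translation_charts M" "\<zeta>A = mat_act A \<circ> \<zeta>"
        and V': "(V', \<zeta>') \<in> translation_charts M'"
      by (metis deform_chartE tstruct_of_simps(3))
      have yt: "y \<in> topspace (topo M)" "y \<notin> zeros M"
        using translation_chartE[OF form_mapD(2)[OF p] V(1)] y openin_subset by (metis disjoint_iff subsetD)+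
      then have py: "p y \<in> topspace (topo S)" "p y \<notin> zeros S"
        using pt form_map_zeros[OF p] by blast+
      then obtain U \<xi> where U: "(U, \<xi>) \<in> translation_charts S" "p y \<in> U"
        using translation_chart_at[OF form_mapD(1)[OF p]] by metis
      have "f (p y) \<in> topspace (topo S)" "f (p y) \<notin> zeros S"
        using py fz_iff homeomorphic_imp_surjective_map[OF homf] by blast+
      then obtain U' \<xi>' where U': "(U', \<xi>') \<in> translation_charts S" "f (p y) \<in> U'"
        using translation_chart_at[OF form_mapD(1)[OF p]] by metis
      obtain W1 c1 where W1: "openin (topo M) W1" "y \<in> W1" "W1 \<subseteq> V" "p ` W1 \<subseteq> U" "\<And>r. r \<in> W1 \<Longrightarrow> \<xi> (p r) = \<zeta> r + c1"
        using form_map_translation_charts[OF p V(1) U(1) y(1) U(2)] by metis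
      have "p' (k y) \<in> U'" using comm yt U' by simp
      then obtain W2 c2 where W2: "openin (topo M') W2" "k y \<in> W2" "W2 \<subseteq> V'" "p' ` W2 \<subseteq> U'" "\<And>r. r \<in> W2 \<Longrightarrow> \<xi>' (p' r) = \<zeta>' r + c2"
        using form_map_translation_charts[OF p' V' U'(1) y(2)] by metis
      have UU: "(U, mat_act A \<circ> \<xi>) \<in> tcharts (deform A (tstruct_of S))" "(U', \<xi>') \<in> tcharts (tstruct_of S)"
        using deform_chartI[of U \<xi> "tstruct_of S" A] U(1) U'(1) by simp_all
      then obtain W3 c3 where W3: "openin (topo S) W3" "p y \<in> W3" "\<forall>r\<in>W3. \<xi>' (f r) = mat_act A (\<xi> r) + c3"
        using translation_isoD(3)[OF f UU U(2) U'(2)]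
        unfolding deform_simps(1) tstruct_of_simps(1) comp_def by blast
      define W where "W = W1 \<inter> {r \<in> topspace (topo M). k r \<in> W2} \<inter> {r \<in> topspace (topo M). p r \<in> W3}"
      have "openin (topo M) W" unfolding W_def
        using W1(1) W2(1) W3(1) contk form_mapD(3)[OF p]
        by (intro openin_Int) (auto simp: continuous_map_def)
      moreover have "y \<in> W" "W \<subseteq> V" "k ` W \<subseteq> V'" using W1 W2 W3 yt by (auto simp: W_def)
      \<comment> \<open>The offset collects three comparisons: \<open>c1\<close> from
        \<open>p\<close>, which passes through \<open>A\<close>, then \<open>c3\<close> from
        \<open>f\<close>, and \<open>c2\<close> from \<open>p'\<close>, which is traversed
        backwards.\<close>
      moreover have "\<forall>r\<in>W. \<zeta>' (k r) = (mat_act A \<circ> \<zeta>) r + (mat_act A c1 + c3 - c2)"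
      proof
        fix r assume "r \<in> W"
        then have r: "r \<in> W1" "k r \<in> W2" "p r \<in> W3" "r \<in> topspace (topo M)" by (auto simp: W_def)
        have "\<zeta>' (k r) = \<xi>' (f (p r)) - c2" using W2(5)[OF r(2)] comm[OF r(4)] by simp
        then show "\<zeta>' (k r) = (mat_act A \<circ> \<zeta>) r + (mat_act A c1 + c3 - c2)"
          using W3(3) r(3) W1(5)[OF r(1)] by (simp add: mat_act_add)
      qed
      ultimately show "\<exists>W c. openin (ttopo (deform A (tstruct_of M))) W \<and> y \<in> W \<and> W \<subseteq> V \<and> k ` W \<subseteq> V' \<and>
          (\<forall>r\<in>W. \<zeta>' (k r) = \<zeta>A r + c)"
        unfolding deform_simps(1) tstruct_of_simps(1) V(2) by blast
  qed
qed

lemma translation_iso_id: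
  assumes "holomorphic_1form M"
  shows "translation_iso (tstruct_of M) (tstruct_of M) id"
proof (rule translation_isoI)
  fix U \<zeta> V \<xi> q
  assume "(U, \<zeta>) \<in> tcharts (tstruct_of M)" "(V, \<xi>) \<in> tcharts (tstruct_of M)" "q \<in> U" "id q \<in> V"
  then show "\<exists>W c. openin (ttopo (tstruct_of M)) W \<and> q \<in> W \<and> W \<subseteq> U \<and> id ` W \<subseteq> V \<and>
      (\<forall>r\<in>W. \<xi> (id r) = \<zeta> r + c)"
    using form_map_translation_charts[OF form_map_id[OF assms], of U \<zeta> V \<xi> q] unfolding tstruct_of_simps by metis
qed simp_all

section \<open>Paths, homotopies and covering maps of abstract topologies\<close>

text \<open>A Lebesgue number argument on the unit interval. The predicate \<open>P\<close> is left
  open since it is used both for evenly covered sets and for the discs of a countable base.\<close>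

lemma pathin_subdivision:
  assumes g: "pathin X g"
    and cover: "\<And>x. x \<in> topspace X \<Longrightarrow> \<exists>U. P U \<and> openin X U \<and> x \<in> U"
  obtains N :: nat where "N > 0"
    "\<And>i. i < N \<Longrightarrow> \<exists>U. P U \<and> openin X U \<and> g ` {real i / real N..real (Suc i) / real N} \<subseteq> U"
proof -
  \<comment> \<open>Pulling the cover back to open sets of reals brings compactness of the interval
    to bear, although \<open>X\<close> is an abstract topology.\<close>
  define \<G> where "\<G> = {B. open B \<and> (\<exists>U. P U \<and> openin X U \<and> g ` (B \<inter> {0..1}) \<subseteq> U)}"
  have "{0..1} \<subseteq> \<Union>\<G>"
  proof
    fix t :: real assume t: "t \<in> {0..1}"
    then have "g t \<in> topspace X" using path_image_subset_topspace[OF g] by blast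
    then obtain U where U: "P U" "openin X U" "g t \<in> U" using cover by blast
    then have "openin (top_of_set {0..1}) {t \<in> {0..1}. g t \<in> U}"
      using g by (simp add: pathin_def continuous_map_def)
    then obtain B where B: "open B" "{t \<in> {0..1}. g t \<in> U} = {0..1} \<inter> B"
      by (auto simp: openin_open)
    have "g ` (B \<inter> {0..1}) \<subseteq> U" using B(2) by blast
    then have "B \<in> \<G>" using B(1) U(1,2) by (auto simp: \<G>_def)
    moreover have "t \<in> B" using t U(3) B(2) by blast
    ultimately show "t \<in> \<Union>\<G>" by blast
  qed
  moreover have "\<And>B. B \<in> \<G> \<Longrightarrow> open B" by (simp add: \<G>_def)
  ultimately obtain e where e: "e > 0" "\<And>x. x \<in> {0..1} \<Longrightarrow> \<exists>G\<in>\<G>. ball x e \<subseteq> G"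
    using Heine_Borel_lemma[of "{0..1::real}" \<G>] compact_Icc by metis
  obtain n where n: "inverse (real (Suc n)) < e" using reals_Archimedean[OF e(1)] by blast
  define N where "N = Suc n"
  have N: "N > 0" "1 / real N < e" using n by (auto simp: N_def inverse_eq_divide)
  show thesis
  proof (rule that[OF N(1)])
    fix i assume i: "i < N"
    have "real i / real N \<in> {0..1}" using i by simp
    then obtain G where G: "G \<in> \<G>" "ball (real i / real N) e \<subseteq> G" using e(2) by blast
    have "{real i / real N..real (Suc i) / real N} \<subseteq> ball (real i / real N) e"
    proof
      fix t assume t: "t \<in> {real i / real N..real (Suc i) / real N}"
      have "real (Suc i) / real N = real i / real N + 1 / real N" by (simp add: add_divide_distrib)
      then have "\<bar>real i / real N - t\<bar> \<le> 1 / real N" using t unfolding atLeastAtMost_iff by arith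
      then show "t \<in> ball (real i / real N) e" using N(2) by (simp add: dist_real_def)
    qed
    moreover have "{real i / real N..real (Suc i) / real N} \<subseteq> {0..1}"
    proof
      fix t assume t: "t \<in> {real i / real N..real (Suc i) / real N}"
      have "real (Suc i) / real N \<le> 1" "0 \<le> real i / real N" using i by simp_all
      then show "t \<in> {0..1}" using t by (meson atLeastAtMost_iff order_trans)
    qed
    ultimately have "g ` {real i / real N..real (Suc i) / real N} \<subseteq> g ` (G \<inter> {0..1})"
      using G(2) by blast
    then show "\<exists>U. P U \<and> openin X U \<and> g ` {real i / real N..real (Suc i) / real N} \<subseteq> U"
      using G(1) unfolding \<G>_def by (blast intro: order_trans)
  qed
qed

lemma continuous_map_join_intervals:
  fixes a b c :: real
  assumes f: "continuous_map (top_of_set {a..b}) X f" and g: "continuous_map (top_of_set {b..c}) X g"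
    and fg: "f b = g b" and ab: "a \<le> b" "b \<le> c"
  shows "continuous_map (top_of_set {a..c}) X (\<lambda>t. if t \<le> b then f t else g t)"
proof (rule continuous_map_cases_le)
  have "{x \<in> {a..c}. x \<le> b} = {a..b}" "{x \<in> {a..c}. b \<le> x} = {b..c}" using ab by auto
  then show "continuous_map (subtopology (top_of_set {a..c}) {x \<in> topspace (top_of_set {a..c}). x \<le> b}) X f"
    and "continuous_map (subtopology (top_of_set {a..c}) {x \<in> topspace (top_of_set {a..c}). b \<le> x}) X g"
    using f g ab by (simp_all add: subtopology_subtopology inf.absorb2)
qed (use fg in auto)

section \<open>Concatenation and homotopy of paths; the fundamental group\<close>

lemma path_concat_simps [simp]:
  "path_concat f g 0 = f 0" "path_concat f g 1 = g 1"
  "p \<circ> path_concat f g = path_concat (p \<circ> f) (p \<circ> g)"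
  by (auto simp: path_concat_def)

lemma pathin_path_concat:
  assumes "pathin X f" "pathin X g" "f 1 = g 0"
  shows "pathin X (path_concat f g)"
proof -
  have "continuous_map (top_of_set {0..1/2}) X (f \<circ> (\<lambda>t. 2 * t))"
    using assms(1) unfolding pathin_def
    by (rule continuous_map_compose[rotated]) (auto simp: continuous_map_in_subtopology intro!: continuous_intros)
  moreover have "continuous_map (top_of_set {1/2..1}) X (g \<circ> (\<lambda>t. 2 * t - 1))"
    using assms(2) unfolding pathin_def
    by (rule continuous_map_compose[rotated]) (auto simp: continuous_map_in_subtopology intro!: continuous_intros)
  moreover have "path_concat f g = (\<lambda>t. if t \<le> 1/2 then (f \<circ> (\<lambda>t. 2 * t)) t else (g \<circ> (\<lambda>t. 2 * t - 1)) t)"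
    by (simp add: fun_eq_iff path_concat_def)
  ultimately show ?thesis
    using continuous_map_join_intervals[of 0 "1/2" X "f \<circ> (\<lambda>t. 2 * t)" 1 "g \<circ> (\<lambda>t. 2 * t - 1)"] assms(3)
    by (simp only: pathin_def) simp
qed

lemma pathin_reverse:
  assumes "pathin X f"
  shows "pathin X (\<lambda>t. f (1 - t))"
proof -
  have "continuous_map (top_of_set {0..1}) X (f \<circ> (\<lambda>t. 1 - t))"
    using assms unfolding pathin_def
    by (rule continuous_map_compose[rotated]) (auto simp: continuous_map_in_subtopology intro!: continuous_intros)
  then show ?thesis by (simp add: pathin_def o_def)
qed

definition path_homotopic :: "'a topology \<Rightarrow> 'a \<Rightarrow> 'a \<Rightarrow> (real \<Rightarrow> 'a) \<Rightarrow> (real \<Rightarrow> 'a) \<Rightarrow> bool" where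
  "path_homotopic X x y f g \<longleftrightarrow>
     homotopic_with (\<lambda>h. h 0 = x \<and> h 1 = y) (top_of_set {0..1}) X f g"

lemma loop_homotopic_eq: "loop_homotopic X x = path_homotopic X x x"
  by (simp add: fun_eq_iff loop_homotopic_def path_homotopic_def)

lemma path_homotopic_sym: "path_homotopic X x y f g \<Longrightarrow> path_homotopic X x y g f"
  unfolding path_homotopic_def by (simp add: homotopic_with_sym)

lemma path_homotopic_trans:
  "path_homotopic X x y f g \<Longrightarrow> path_homotopic X x y g h \<Longrightarrow> path_homotopic X x y f h"
  unfolding path_homotopic_def by (rule homotopic_with_trans)

lemma path_homotopicD:
  assumes "path_homotopic X x y f g"
  shows "pathin X f" "pathin X g" "f 0 = x" "f 1 = y" "g 0 = x" "g 1 = y"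
  using homotopic_with_imp_continuous_maps[OF assms[unfolded path_homotopic_def]]
    homotopic_with_imp_property[OF assms[unfolded path_homotopic_def]]
  by (simp_all add: pathin_def)

text \<open>Paths are functions on the whole real line of which only the values on the unit interval
  count; this lemma absorbs the difference.\<close>

lemma path_homotopic_eq:
  assumes "pathin X f" "f 0 = x" "f 1 = y" "\<And>t. t \<in> {0..1} \<Longrightarrow> f t = g t"
  shows "path_homotopic X x y f g"
  using assms unfolding path_homotopic_def pathin_def by (intro homotopic_with_equal) auto

lemma path_homotopic_compose:
  assumes "path_homotopic X x y f g" "continuous_map X Y k"
  shows "path_homotopic Y (k x) (k y) (k \<circ> f) (k \<circ> g)"
  using assms unfolding path_homotopic_def
  by (rule homotopic_with_compose_continuous_map_left[of "\<lambda>h. h 0 = x \<and> h 1 = y"]) simp_all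

lemma path_homotopic_concat:
  assumes f: "path_homotopic X x y f f'" and g: "path_homotopic X y z g g'"
  shows "path_homotopic X x z (path_concat f g) (path_concat f' g')"
proof -
  let ?I = "top_of_set {0..1::real}"
  obtain h where h: "continuous_map (prod_topology ?I ?I) X h" "\<And>t. h (0, t) = f t" "\<And>t. h (1, t) = f' t"
      "\<And>u. u \<in> {0..1} \<Longrightarrow> h (u, 0) = x \<and> h (u, 1) = y"
    using f unfolding path_homotopic_def homotopic_with_def by auto
  obtain k where k: "continuous_map (prod_topology ?I ?I) X k" "\<And>t. k (0, t) = g t" "\<And>t. k (1, t) = g' t"
      "\<And>u. u \<in> {0..1} \<Longrightarrow> k (u, 0) = y \<and> k (u, 1) = z"
    using g unfolding path_homotopic_def homotopic_with_def by auto
  \<comment> \<open>The first coordinate is the homotopy parameter and the second the path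
    parameter, so the gluing runs along \<open>snd w = 1/2\<close>, where both homotopies rest at
    \<open>y\<close>.\<close>
  define H where "H = (\<lambda>w :: real \<times> real. if snd w \<le> 1/2 then h (fst w, 2 * snd w) else k (fst w, 2 * snd w - 1))"
  let ?J = "top_of_set ({0..1} \<times> {0..1::real})"
  have IJ: "prod_topology ?I ?I = ?J"
    by (simp add: subtopology_Times)
  have h': "continuous_map ?J X h" and k': "continuous_map ?J X k" using h(1) k(1) IJ by simp_all
  have "continuous_map ?J X H"
    unfolding H_def
  proof (rule continuous_map_cases_le)
    have "continuous_map (top_of_set {w \<in> {0..1} \<times> {0..1}. snd w \<le> 1/2}) X (h \<circ> (\<lambda>w. (fst w, 2 * snd w)))"
      by (rule continuous_map_compose[OF _ h']) (auto simp: continuous_map_in_subtopology intro!: continuous_intros)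
    then show "continuous_map (subtopology ?J {w \<in> topspace ?J. snd w \<le> 1/2}) X (\<lambda>w. h (fst w, 2 * snd w))"
      by (simp add: subtopology_subtopology inf.absorb2 o_def Collect_conj_eq)
    have "continuous_map (top_of_set {w \<in> {0..1} \<times> {0..1}. 1/2 \<le> snd w}) X (k \<circ> (\<lambda>w. (fst w, 2 * snd w - 1)))"
      by (rule continuous_map_compose[OF _ k']) (auto simp: continuous_map_in_subtopology intro!: continuous_intros)
    then show "continuous_map (subtopology ?J {w \<in> topspace ?J. 1/2 \<le> snd w}) X (\<lambda>w. k (fst w, 2 * snd w - 1))"
      by (simp add: subtopology_subtopology inf.absorb2 o_def Collect_conj_eq)
    show "h (fst w, 2 * snd w) = k (fst w, 2 * snd w - 1)" if "w \<in> topspace ?J" "snd w = 1/2" for w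
    proof -
      have "2 * snd w = 1" "fst w \<in> {0..1}" using that by auto
      then show ?thesis using h(4) k(4) by simp
    qed
  qed (auto intro!: continuous_intros)
  then have "continuous_map (prod_topology ?I ?I) X H" by (simp only: IJ)
  moreover have "\<And>t. H (0, t) = path_concat f g t" "\<And>t. H (1, t) = path_concat f' g' t"
    by (auto simp: H_def path_concat_def h(2,3) k(2,3))
  moreover have "\<And>u. u \<in> {0..1} \<Longrightarrow> H (u, 0) = x \<and> H (u, 1) = z"
    using h(4) k(4) by (auto simp: H_def)
  ultimately show ?thesis
    unfolding path_homotopic_def homotopic_with_def by blast
qed

lemma fundamental_group_carrierE:
  assumes "c \<in> carrier (fundamental_group X x)"
  obtains f where "pathin X f" "f 0 = x" "f 1 = x" "c = {g. path_homotopic X x x f g}" "f \<in> c"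
proof -
  obtain f where f: "pathin X f" "f 0 = x" "f 1 = x" "c = {g. path_homotopic X x x f g}"
    using assms by (auto simp: fundamental_group_def loop_homotopic_eq)
  then show thesis using that path_homotopic_eq[of X f x x f] by blast
qed

lemma fundamental_group_carrierI:
  "pathin X f \<Longrightarrow> f 0 = x \<Longrightarrow> f 1 = x \<Longrightarrow> {g. path_homotopic X x x f g} \<in> carrier (fundamental_group X x)"
  by (auto simp: fundamental_group_def loop_homotopic_eq)

lemma fundamental_group_class:
  assumes "c \<in> carrier (fundamental_group X x)" "f \<in> c"
  shows "pathin X f" "f 0 = x" "f 1 = x" "c = {g. path_homotopic X x x f g}"
proof -
  obtain f0 where f0: "c = {g. path_homotopic X x x f0 g}"
    using fundamental_group_carrierE[OF assms(1)] by metis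
  then have *: "path_homotopic X x x f0 f" using assms(2) by simp
  then show "pathin X f" "f 0 = x" "f 1 = x" using path_homotopicD by metis+
  show "c = {g. path_homotopic X x x f g}"
    unfolding f0 using * path_homotopic_sym path_homotopic_trans by (metis (lifting))
qed

text \<open>The product ranges over all pairs of representatives; as concatenation respects
  homotopy, a single pair determines it.\<close>

lemma fundamental_group_mult:
  assumes c: "c \<in> carrier (fundamental_group X x)" "f \<in> c"
    and c': "c' \<in> carrier (fundamental_group X x)" "g \<in> c'"
  shows "c \<otimes>\<^bsub>fundamental_group X x\<^esub> c' = {h. path_homotopic X x x (path_concat f g) h}"
    "path_concat f g \<in> c \<otimes>\<^bsub>fundamental_group X x\<^esub> c'"
    "c \<otimes>\<^bsub>fundamental_group X x\<^esub> c' \<in> carrier (fundamental_group X x)"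
proof -
  note F = fundamental_group_class[OF c] and G = fundamental_group_class[OF c']
  have P: "pathin X (path_concat f g)" using F G pathin_path_concat by metis
  have "path_homotopic X x x (path_concat f g) h"
    if "f' \<in> c" "g' \<in> c'" "path_homotopic X x x (path_concat f' g') h" for f' g' h
    using path_homotopic_trans[OF path_homotopic_concat[of X x x f f' x g g'] that(3)] that(1,2) F(4) G(4) by blast
  then show eq: "c \<otimes>\<^bsub>fundamental_group X x\<^esub> c' = {h. path_homotopic X x x (path_concat f g) h}"
    using c(2) c'(2) by (auto simp: fundamental_group_def loop_homotopic_eq)
  show "path_concat f g \<in> c \<otimes>\<^bsub>fundamental_group X x\<^esub> c'"
    unfolding eq using P F G by (simp add: path_homotopic_eq)
  show "c \<otimes>\<^bsub>fundamental_group X x\<^esub> c' \<in> carrier (fundamental_group X x)"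
    unfolding eq using P F G by (simp add: fundamental_group_carrierI)
qed

section \<open>Lifting paths through covering maps\<close>

definition evenly_covered :: "'b topology \<Rightarrow> ('b \<Rightarrow> 'a) \<Rightarrow> 'a topology \<Rightarrow> 'a set \<Rightarrow> 'b set set \<Rightarrow> bool" where
  "evenly_covered Y p X U \<V> \<longleftrightarrow>
     \<Union>\<V> = {y \<in> topspace Y. p y \<in> U} \<and> (\<forall>V\<in>\<V>. openin Y V) \<and> pairwise disjnt \<V> \<and>
     (\<forall>V\<in>\<V>. homeomorphic_map (subtopology Y V) (subtopology X U) p)"

lemma covering_mapD:
  assumes "covering_map Y p X"
  shows "continuous_map Y X p" "p ` topspace Y = topspace X"
    "x \<in> topspace X \<Longrightarrow> \<exists>U. (\<exists>\<V>. evenly_covered Y p X U \<V>) \<and> openin X U \<and> x \<in> U"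
  using assms unfolding covering_map_def evenly_covered_def by blast+

text \<open>The inverse \<open>s\<close> of \<open>p\<close> on the sheet through \<open>y\<close>
  is the local section from which lifts are assembled.\<close>

lemma evenly_covered_sheet:
  assumes e: "evenly_covered Y p X U \<V>" and U: "openin X U" and y: "y \<in> topspace Y" "p y \<in> U"
  obtains V s where "V \<in> \<V>" "openin Y V" "y \<in> V" "p ` V = U" "inj_on p V"
    "continuous_map (subtopology X U) Y s" "\<And>x. x \<in> U \<Longrightarrow> s x \<in> V \<and> p (s x) = x"
    "\<And>v. v \<in> V \<Longrightarrow> s (p v) = v"
proof -
  obtain V where V: "V \<in> \<V>" "y \<in> V" using e y unfolding evenly_covered_def by blast
  then have o: "openin Y V" and h: "homeomorphic_map (subtopology Y V) (subtopology X U) p"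
    using e unfolding evenly_covered_def by blast+
  have t: "topspace (subtopology Y V) = V" "topspace (subtopology X U) = U"
    using o U openin_subset by fastforce+
  obtain s where s: "homeomorphic_maps (subtopology Y V) (subtopology X U) p s"
    using h homeomorphic_map_maps by blast
  then have "continuous_map (subtopology X U) Y s"
      "\<And>x. x \<in> U \<Longrightarrow> s x \<in> V \<and> p (s x) = x" "\<And>v. v \<in> V \<Longrightarrow> s (p v) = v"
    unfolding homeomorphic_maps_def using t
    by (auto simp: continuous_map_in_subtopology Pi_iff)
  then show thesis
    using that[OF V(1) o V(2)] homeomorphic_imp_surjective_map[OF h] homeomorphic_imp_injective_map[OF h] t by simp
qed

text \<open>The set \<open>D\<close> where the lifts agree is open and closed. At each point compare
  the sheets containing the two values: on a common sheet injectivity of \<open>p\<close> forces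
  agreement nearby, and distinct sheets are disjoint, which forces disagreement nearby.\<close>

lemma covering_lift_unique:
  assumes p: "covering_map Y p X" and Z: "connected_space Z"
    and f: "continuous_map Z Y f" and g: "continuous_map Z Y g"
    and eq: "\<And>z. z \<in> topspace Z \<Longrightarrow> p (f z) = p (g z)"
    and z0: "z0 \<in> topspace Z" "f z0 = g z0" and z: "z \<in> topspace Z"
  shows "f z = g z"
proof -
  define D where "D = {z \<in> topspace Z. f z = g z}"
  have loc: "\<exists>N. openin Z N \<and> z \<in> N \<and> (if z \<in> D then N \<subseteq> D else N \<subseteq> topspace Z - D)"
    if z: "z \<in> topspace Z" for z
  proof -
    have fz: "f z \<in> topspace Y" and gz: "g z \<in> topspace Y"
      using f g z by (auto simp: continuous_map_def)
    then have "p (f z) \<in> topspace X"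
      using covering_mapD(1)[OF p] by (auto simp: continuous_map_def)
    then obtain U \<V> where e: "evenly_covered Y p X U \<V>" and U: "openin X U" "p (f z) \<in> U"
      using covering_mapD(3)[OF p] by blast
    have "p (g z) \<in> U" using U eq z by simp
    obtain V where V: "V \<in> \<V>" "openin Y V" "f z \<in> V" "inj_on p V"
      using evenly_covered_sheet[OF e U(1) fz U(2)] by metis
    obtain V' where V': "V' \<in> \<V>" "openin Y V'" "g z \<in> V'" "inj_on p V'"
      using evenly_covered_sheet[OF e U(1) gz \<open>p (g z) \<in> U\<close>] by metis
    define N where "N = {z \<in> topspace Z. f z \<in> V} \<inter> {z \<in> topspace Z. g z \<in> V'}"
    have N: "openin Z N" "z \<in> N" unfolding N_def
      using f g V V' z by (auto simp: continuous_map_def intro!: openin_Int)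
    show ?thesis
    proof (cases "V = V'")
      case True
      then have "z' \<in> D" if "z' \<in> N" for z'
        using that V(4) eq[of z'] unfolding N_def D_def inj_on_def by blast
      then have "N \<subseteq> D" by blast
      then show ?thesis using N by (intro exI[of _ N]) auto
    next
      case False
      then have "disjnt V V'" using e V V' unfolding evenly_covered_def pairwise_def by blast
      then have "N \<inter> D = {}" unfolding N_def D_def disjnt_def by auto
      moreover have "N \<subseteq> topspace Z" by (auto simp: N_def)
      ultimately show ?thesis using N by (intro exI[of _ N]) auto
    qed
  qed
  have "openin Z D"
    by (subst openin_subopen) (use loc in \<open>metis D_def mem_Collect_eq\<close>)
  moreover have "openin Z (topspace Z - D)"
    by (subst openin_subopen) (use loc in \<open>metis DiffE\<close>)
  then have "closedin Z D" by (auto simp: closedin_def D_def)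
  ultimately have "D = {} \<or> D = topspace Z"
    using Z by (auto simp: connected_space_clopen_in)
  then show ?thesis using z0 z by (auto simp: D_def)
qed

lemma covering_path_lift_unique:
  assumes "covering_map Y p X" "pathin Y f" "pathin Y g"
    and "\<And>t. t \<in> {0..1} \<Longrightarrow> p (f t) = p (g t)" and "t0 \<in> {0..1}" "f t0 = g t0" "t \<in> {0..1}"
  shows "f t = g t"
  using covering_lift_unique[OF assms(1), of "top_of_set {0..1::real}" f g t0 t] assms
  by (simp add: pathin_def connected_space_subtopology)

text \<open>The interval is cut into pieces that run in evenly covered sets, and the lift is
  prolonged piece by piece with a local section.\<close>

lemma covering_path_lift:
  assumes p: "covering_map Y p X" and g: "pathin X g" and y: "y \<in> topspace Y" "p y = g 0"
  obtains \<eta> where "pathin Y \<eta>" "\<eta> 0 = y" "\<And>t. t \<in> {0..1} \<Longrightarrow> p (\<eta> t) = g t"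
proof -
  obtain N :: nat where N: "N > 0"
    "\<And>i. i < N \<Longrightarrow> \<exists>U. (\<exists>\<V>. evenly_covered Y p X U \<V>) \<and> openin X U \<and>
        g ` {real i / real N..real (Suc i) / real N} \<subseteq> U"
    using pathin_subdivision[OF g, of "\<lambda>U. \<exists>\<V>. evenly_covered Y p X U \<V>"] covering_mapD(3)[OF p] by blast
  have "\<exists>\<eta>. continuous_map (top_of_set {0..real i / real N}) Y \<eta> \<and> \<eta> 0 = y \<and>
      (\<forall>t\<in>{0..real i / real N}. p (\<eta> t) = g t)" if "i \<le> N" for i
    using that
  proof (induction i)
    case 0
    then show ?case using y by (intro exI[of _ "\<lambda>_. y"]) simp
  next
    case (Suc i)
    define a b where "a = real i / real N" and "b = real (Suc i) / real N"
    have ab: "0 \<le> a" "a \<le> b" "b \<le> 1"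
      using Suc.prems N(1) by (simp_all add: a_def b_def divide_right_mono)
    obtain \<eta> where \<eta>: "continuous_map (top_of_set {0..a}) Y \<eta>" "\<eta> 0 = y" "\<forall>t\<in>{0..a}. p (\<eta> t) = g t"
      using Suc by (auto simp: a_def)
    obtain U \<V> where U: "evenly_covered Y p X U \<V>" "openin X U" "g ` {a..b} \<subseteq> U"
      using N(2)[of i] Suc.prems by (auto simp: a_def b_def)
    have "\<eta> a \<in> topspace Y" "p (\<eta> a) \<in> U"
      using \<eta>(1,3) ab U(3) by (auto simp: continuous_map_def Pi_iff)
    then obtain V s where s: "\<eta> a \<in> V" "continuous_map (subtopology X U) Y s"
        "\<And>x. x \<in> U \<Longrightarrow> s x \<in> V \<and> p (s x) = x" "\<And>v. v \<in> V \<Longrightarrow> s (p v) = v"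
      using evenly_covered_sheet[OF U(1,2)] by metis
    have "continuous_map (top_of_set {a..b}) (subtopology X U) g"
    proof -
      have "continuous_map (subtopology (top_of_set {0..1}) {a..b}) X g"
        using g continuous_map_from_subtopology unfolding pathin_def by blast
      then show ?thesis
        using U(3) ab by (auto simp: continuous_map_in_subtopology subtopology_subtopology inf.absorb2)
    qed
    then have sg: "continuous_map (top_of_set {a..b}) Y (s \<circ> g)"
      using s(2) continuous_map_compose by blast
    \<comment> \<open>The section was taken on the sheet that contains \<open>\<eta> a\<close>, so
      the old and the new piece fit together.\<close>
    have "\<eta> a = (s \<circ> g) a" using s(1,4) \<eta>(3) ab by (metis atLeastAtMost_iff comp_apply order_refl)
    then have "continuous_map (top_of_set {0..b}) Y (\<lambda>t. if t \<le> a then \<eta> t else (s \<circ> g) t)"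
      using continuous_map_join_intervals[OF \<eta>(1) sg] ab by blast
    moreover have "\<forall>t\<in>{0..b}. p (if t \<le> a then \<eta> t else (s \<circ> g) t) = g t"
      using \<eta>(3) s(3) U(3) by (auto simp: image_subset_iff)
    ultimately show ?case
      unfolding b_def[symmetric] using \<eta>(2) ab by (intro exI[of _ "\<lambda>t. if t \<le> a then \<eta> t else (s \<circ> g) t"]) simp
  qed
  from this[of N] show thesis
    using that N(1) by (auto simp: pathin_def)
qed

section \<open>Countability of the fundamental group\<close>

lemma chart_on_restrict:
  assumes c: "chart_on X (U, \<phi>)" and W: "openin X W" "W \<subseteq> U"
  shows "chart_on X (W, \<phi>)"
proof -
  have "topspace (subtopology X U) = U" using chart_onD(1)[OF c] openin_subset by fastforce
  then have "\<phi> ` (topspace (subtopology X U) \<inter> W) = topspace (top_of_set (\<phi> ` U)) \<inter> \<phi> ` W"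
    using W(2) by (simp add: inf.absorb2 image_mono)
  from homeomorphic_map_subtopologies[OF chart_onD(4)[OF c] this]
  have "homeomorphic_map (subtopology (subtopology X U) W) (subtopology (top_of_set (\<phi> ` U)) (\<phi> ` W)) \<phi>" .
  then have "homeomorphic_map (subtopology X W) (top_of_set (\<phi> ` W)) \<phi>"
    using W(2) by (simp add: subtopology_subtopology inf.absorb2 image_mono)
  then show ?thesis
    using chart_image_open[OF c W] W(1) by (simp add: chart_on_def)
qed

text \<open>The chart need not belong to an atlas, so atlas charts may be shrunk freely. Only
  convexity of the coordinate image is demanded, which suffices for joining points and for extending
  maps.\<close>

definition disc :: "'a topology \<Rightarrow> 'a set \<Rightarrow> bool" where
  "disc X D \<longleftrightarrow> (\<exists>\<phi>. chart_on X (D, \<phi>) \<and> convex (\<phi> ` D))"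

lemma disc_open: "disc X D \<Longrightarrow> openin X D"
  using chart_onD(1) by (auto simp: disc_def)

lemma disc_neighbourhood:
  assumes M: "holomorphic_1form M" and N: "openin (topo M) N" "q \<in> N"
  obtains D where "disc (topo M) D" "q \<in> D" "D \<subseteq> N"
proof -
  have "q \<in> topspace (topo M)" using N openin_subset by blast
  then obtain U \<phi> where U: "(U, \<phi>) \<in> atlas M" "q \<in> U" using atlas_chart_at[OF M] by metis
  have c: "chart_on (topo M) (U, \<phi>)" by (rule holomorphic_1formD(1)[OF M U(1)])
  have NU: "openin (topo M) (N \<inter> U)" using N(1) chart_onD(1)[OF c] by blast
  then have c': "chart_on (topo M) (N \<inter> U, \<phi>)" using chart_on_restrict[OF c] by blast
  obtain r where r: "r > 0" "ball (\<phi> q) r \<subseteq> \<phi> ` (N \<inter> U)"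
    using chart_onD(2)[OF c'] N(2) U(2) open_contains_ball by blast
  define D where "D = {x \<in> N \<inter> U. \<phi> x \<in> ball (\<phi> q) r}"
  have "openin (topo M) D" unfolding D_def by (rule chart_preimage_open[OF c']) simp
  then have "chart_on (topo M) (D, \<phi>)" by (rule chart_on_restrict[OF c']) (auto simp: D_def)
  moreover have "\<phi> ` D = ball (\<phi> q) r" using r(2) by (auto simp: D_def)
  ultimately have "disc (topo M) D" unfolding disc_def by (metis convex_ball)
  then show thesis using that N(2) U(2) r(1) by (auto simp: D_def)
qed

lemma disc_chartE:
  assumes "disc X D"
  obtains \<phi> \<sigma> where "continuous_map (subtopology X D) euclidean \<phi>" "convex (\<phi> ` D)"
    "continuous_map (top_of_set (\<phi> ` D)) X \<sigma>" "\<And>x. x \<in> D \<Longrightarrow> \<sigma> (\<phi> x) = (x :: 'a)"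
    "\<And>z :: complex. z \<in> \<phi> ` D \<Longrightarrow> \<sigma> z \<in> D"
proof -
  obtain \<phi> where c: "chart_on X (D, \<phi>)" "convex (\<phi> ` D)" using assms by (auto simp: disc_def)
  have t: "topspace (subtopology X D) = D" using chart_onD(1)[OF c(1)] openin_subset by fastforce
  obtain \<sigma> where s: "homeomorphic_maps (subtopology X D) (top_of_set (\<phi> ` D)) \<phi> \<sigma>"
    using chart_onD(4)[OF c(1)] homeomorphic_map_maps by blast
  then have "continuous_map (top_of_set (\<phi> ` D)) X \<sigma>" "\<And>x. x \<in> D \<Longrightarrow> \<sigma> (\<phi> x) = x"
      "\<And>z. z \<in> \<phi> ` D \<Longrightarrow> \<sigma> z \<in> D"
    unfolding homeomorphic_maps_def t by (auto simp: continuous_map_in_subtopology)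
  then show thesis using that[OF chart_onD(5)[OF c(1)] c(2)] by blast
qed

lemma disc_path_connected:
  assumes "disc X D" "x \<in> D" "y \<in> D"
  obtains g where "pathin X g" "g 0 = x" "g 1 = y" "\<And>t. t \<in> {0..1} \<Longrightarrow> g t \<in> D"
proof -
  obtain \<phi> \<sigma> where s: "continuous_map (subtopology X D) euclidean \<phi>" "convex (\<phi> ` D)"
    "continuous_map (top_of_set (\<phi> ` D)) X \<sigma>" "\<And>x. x \<in> D \<Longrightarrow> \<sigma> (\<phi> x) = x"
    "\<And>z :: complex. z \<in> \<phi> ` D \<Longrightarrow> \<sigma> z \<in> D"
    using disc_chartE[OF assms(1)] by metis
  have "closed_segment (\<phi> x) (\<phi> y) \<subseteq> \<phi> ` D"
    using s(2) assms(2,3) by (simp add: closed_segment_subset)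
  then have l: "linepath (\<phi> x) (\<phi> y) t \<in> \<phi> ` D" if "t \<in> {0..1}" for t
    using that by (metis linepath_in_path subsetD)
  then have "continuous_map (top_of_set {0..1}) (top_of_set (\<phi> ` D)) (linepath (\<phi> x) (\<phi> y))"
    by (simp add: image_subset_iff_funcset[symmetric] image_subset_iff continuous_on_linepath)
  then have "pathin X (\<sigma> \<circ> linepath (\<phi> x) (\<phi> y))"
    unfolding pathin_def using s(3) continuous_map_compose by blast
  then show thesis
    by (rule that) (use s(4,5) assms(2,3) l in \<open>simp_all add: linepath_0' linepath_1'\<close>)
qed

text \<open>The boundary of a square, mapped into a convex set, extends over the square by Dugundji's
  theorem.\<close>

lemma disc_fill_square:
  fixes a b :: real
  assumes D: "disc X D" and ab: "a < b"
    and \<alpha>: "continuous_map (top_of_set {a..b}) X \<alpha>" "\<alpha> ` {a..b} \<subseteq> D"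
    and \<beta>: "continuous_map (top_of_set {a..b}) X \<beta>" "\<beta> ` {a..b} \<subseteq> D"
    and \<gamma>: "pathin X \<gamma>" "\<gamma> ` {0..1} \<subseteq> D" and \<delta>: "pathin X \<delta>" "\<delta> ` {0..1} \<subseteq> D"
    and corners: "\<alpha> a = \<gamma> 0" "\<alpha> b = \<delta> 0" "\<beta> a = \<gamma> 1" "\<beta> b = \<delta> 1"
  obtains H where "continuous_map (top_of_set ({0..1} \<times> {a..b})) X H"
    "\<And>t. t \<in> {a..b} \<Longrightarrow> H (0 :: real, t) = \<alpha> t" "\<And>t. t \<in> {a..b} \<Longrightarrow> H (1, t) = \<beta> t"
    "\<And>u. u \<in> {0..1} \<Longrightarrow> H (u, a) = \<gamma> u" "\<And>u. u \<in> {0..1} \<Longrightarrow> H (u, b) = \<delta> u"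
proof -
  obtain \<phi> \<sigma> where s: "continuous_map (subtopology X D) euclidean \<phi>" "convex (\<phi> ` D)"
    "continuous_map (top_of_set (\<phi> ` D)) X \<sigma>" "\<And>x. x \<in> D \<Longrightarrow> \<sigma> (\<phi> x) = x"
    "\<And>z :: complex. z \<in> \<phi> ` D \<Longrightarrow> \<sigma> z \<in> D"
    using disc_chartE[OF D] by metis
  have cont: "continuous_on T (\<phi> \<circ> f)" if "continuous_map (top_of_set T) X f" "f ` T \<subseteq> D" for T :: "real set" and f
  proof -
    have "continuous_map (top_of_set T) (subtopology X D) f"
      using that by (simp add: continuous_map_in_subtopology image_subset_iff_funcset)
    from continuous_map_compose[OF this s(1)] show ?thesis by simp
  qed
  have cs: "continuous_on (A \<times> B) (\<lambda>w. (\<phi> \<circ> f) (fst w))" if "continuous_on A (\<phi> \<circ> f)" for A B :: "real set" and f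
    by (rule continuous_on_compose2[OF that]) (auto intro!: continuous_intros)
  have ct: "continuous_on (A \<times> B) (\<lambda>w. (\<phi> \<circ> f) (snd w))" if "continuous_on B (\<phi> \<circ> f)" for A B :: "real set" and f
    by (rule continuous_on_compose2[OF that]) (auto intro!: continuous_intros)
  \<comment> \<open>The map on the four sides of the square. The sides over 0 and 1 take precedence;
    the equations \<open>corners\<close> make the choice at the corners immaterial.\<close>
  define F where "F = (\<lambda>w :: real \<times> real. if fst w = 0 then \<phi> (\<alpha> (snd w)) else if fst w = 1 then \<phi> (\<beta> (snd w))
      else if snd w = a then \<phi> (\<gamma> (fst w)) else \<phi> (\<delta> (fst w)))"
  let ?L = "{0::real} \<times> {a..b}" and ?R = "{1::real} \<times> {a..b}" and ?B = "{0..1::real} \<times> {a}" and ?T = "{0..1::real} \<times> {b}"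
  let ?S = "((?L \<union> ?R) \<union> ?B) \<union> ?T"
  have FL: "F w = (\<phi> \<circ> \<alpha>) (snd w)" if "w \<in> ?L" for w using that by (auto simp: F_def)
  have FR: "F w = (\<phi> \<circ> \<beta>) (snd w)" if "w \<in> ?R" for w using that by (auto simp: F_def)
  have FB: "F w = (\<phi> \<circ> \<gamma>) (fst w)" if "w \<in> ?B" for w using that corners by (auto simp: F_def)
  have FT: "F w = (\<phi> \<circ> \<delta>) (fst w)" if "w \<in> ?T" for w using that corners ab by (auto simp: F_def)
  have "continuous_on ?L F"
    by (subst continuous_on_cong[OF refl FL], assumption) (rule ct[OF cont[OF \<alpha>]])
  moreover have "continuous_on ?R F"
    by (subst continuous_on_cong[OF refl FR], assumption) (rule ct[OF cont[OF \<beta>]])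
  moreover have "continuous_on ?B F"
    by (subst continuous_on_cong[OF refl FB], assumption) (rule cs[OF cont[OF \<gamma>(1)[unfolded pathin_def] \<gamma>(2)]])
  moreover have "continuous_on ?T F"
    by (subst continuous_on_cong[OF refl FT], assumption) (rule cs[OF cont[OF \<delta>(1)[unfolded pathin_def] \<delta>(2)]])
  moreover have cl: "closed ?L" "closed ?R" "closed ?B" "closed ?T" by (intro closed_Times; simp)+
  ultimately have contF: "continuous_on ?S F"
    by (intro continuous_on_closed_Un closed_Un)
  have FD: "F ` ?S \<subseteq> \<phi> ` D"
  proof (rule image_subsetI)
    fix w assume "w \<in> ?S"
    then consider "w \<in> ?L" | "w \<in> ?R" | "w \<in> ?B" | "w \<in> ?T" by blast
    then show "F w \<in> \<phi> ` D"
    proof cases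
      case 1
      then have "\<alpha> (snd w) \<in> D" using \<alpha>(2) by auto
      then show ?thesis using FL[OF 1] by simp
    next
      case 2
      then have "\<beta> (snd w) \<in> D" using \<beta>(2) by auto
      then show ?thesis using FR[OF 2] by simp
    next
      case 3
      then have "\<gamma> (fst w) \<in> D" using \<gamma>(2) by auto
      then show ?thesis using FB[OF 3] by simp
    next
      case 4
      then have "\<delta> (fst w) \<in> D" using \<delta>(2) by auto
      then show ?thesis using FT[OF 4] by simp
    qed
  qed
  \<comment> \<open>Dugundji's theorem asks for a non-empty convex target.\<close>
  have "\<alpha> a \<in> D" using \<alpha>(2) ab by auto
  then have "\<phi> ` D \<noteq> {}" by blast
  moreover have "closedin (top_of_set ({0..1} \<times> {a..b})) ?S"
    by (rule closed_subset) (use cl ab in \<open>auto intro!: closed_Un\<close>)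
  ultimately obtain g where g: "continuous_on ({0..1} \<times> {a..b}) g" "g ` ({0..1} \<times> {a..b}) \<subseteq> \<phi> ` D"
      "\<And>w. w \<in> ?S \<Longrightarrow> g w = F w"
    using Dugundji[OF s(2) _ _ contF FD] by metis
  have "continuous_map (top_of_set ({0..1} \<times> {a..b})) (top_of_set (\<phi> ` D)) g"
    using g(1,2) by (simp add: image_subset_iff_funcset)
  then have "continuous_map (top_of_set ({0..1} \<times> {a..b})) X (\<sigma> \<circ> g)"
    using s(3) continuous_map_compose by blast
  then show thesis
  proof (rule that)
    show "(\<sigma> \<circ> g) (0, t) = \<alpha> t" "(\<sigma> \<circ> g) (1, t) = \<beta> t" if "t \<in> {a..b}" for t
    proof -
      have "(0, t) \<in> ?L" "(1, t) \<in> ?R" using that by auto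
      then have "g (0, t) = \<phi> (\<alpha> t)" "g (1, t) = \<phi> (\<beta> t)" using g(3) FL FR by auto
      moreover have "\<alpha> t \<in> D" "\<beta> t \<in> D" using \<alpha>(2) \<beta>(2) that by blast+
      ultimately show "(\<sigma> \<circ> g) (0, t) = \<alpha> t" "(\<sigma> \<circ> g) (1, t) = \<beta> t" using s(4) by simp_all
    qed
    show "(\<sigma> \<circ> g) (u, a) = \<gamma> u" "(\<sigma> \<circ> g) (u, b) = \<delta> u" if "u \<in> {0..1}" for u
    proof -
      have "(u, a) \<in> ?B" "(u, b) \<in> ?T" using that by auto
      then have "g (u, a) = \<phi> (\<gamma> u)" "g (u, b) = \<phi> (\<delta> u)" using g(3) FB FT by auto
      moreover have "\<gamma> u \<in> D" "\<delta> u \<in> D" using \<gamma>(2) \<delta>(2) that by blast+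
      ultimately show "(\<sigma> \<circ> g) (u, a) = \<gamma> u" "(\<sigma> \<circ> g) (u, b) = \<delta> u" using s(4) by simp_all
    qed
  qed
qed

text \<open>Discs form a base, but there may be uncountably many. For each pair of members
  \<open>A\<close>, \<open>B\<close> of a countable base that has a disc in between, one such disc
  is chosen. The chosen disc may differ from the given one, but it still contains \<open>A\<close>,
  hence the point, and stays inside \<open>B\<close>.\<close>

lemma countable_disc_base:
  assumes M: "holomorphic_1form M" and sc: "second_countable (topo M)"
  obtains \<D> where "countable \<D>" "\<And>D. D \<in> \<D> \<Longrightarrow> disc (topo M) D"
    "\<And>U x. openin (topo M) U \<Longrightarrow> x \<in> U \<Longrightarrow> \<exists>D\<in>\<D>. x \<in> D \<and> D \<subseteq> U"
proof -
  obtain \<B> where \<B>: "countable \<B>" "\<And>V. V \<in> \<B> \<Longrightarrow> openin (topo M) V"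
    "\<And>U x. openin (topo M) U \<Longrightarrow> x \<in> U \<Longrightarrow> \<exists>V\<in>\<B>. x \<in> V \<and> V \<subseteq> U"
    using sc unfolding second_countable_def by metis
  define ok where "ok = (\<lambda>(A, B) D. disc (topo M) D \<and> A \<subseteq> D \<and> D \<subseteq> B)"
  define \<D> where "\<D> = (\<lambda>P. SOME D. ok P D) ` {P \<in> \<B> \<times> \<B>. \<exists>D. ok P D}"
  show thesis
  proof
    show "countable \<D>" unfolding \<D>_def
      by (intro countable_image countable_subset[OF _ countable_SIGMA[OF \<B>(1) \<B>(1)]]) blast
    have "ok P (SOME D. ok P D)" if "\<exists>D. ok P D" for P using someI_ex[OF that] .
    then have *: "\<And>D. D \<in> \<D> \<Longrightarrow> \<exists>P. ok P D" unfolding \<D>_def by blast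
    then show "\<And>D. D \<in> \<D> \<Longrightarrow> disc (topo M) D" unfolding ok_def by force
    fix U x assume U: "openin (topo M) U" "x \<in> U"
    obtain B where B: "B \<in> \<B>" "x \<in> B" "B \<subseteq> U" using \<B>(3)[OF U] by blast
    obtain D where D: "disc (topo M) D" "x \<in> D" "D \<subseteq> B" using disc_neighbourhood[OF M \<B>(2)[OF B(1)] B(2)] by blast
    obtain A where A: "A \<in> \<B>" "x \<in> A" "A \<subseteq> D" using \<B>(3)[OF disc_open[OF D(1)] D(2)] by blast
    define D' where "D' = (SOME D. ok (A, B) D)"
    have ex: "\<exists>D. ok (A, B) D" using A D unfolding ok_def by blast
    then have "D' \<in> \<D>" using A(1) B(1) unfolding \<D>_def D'_def by blast
    moreover have "ok (A, B) D'" unfolding D'_def by (rule someI_ex[OF ex])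
    then have "A \<subseteq> D'" "D' \<subseteq> B" by (simp_all add: ok_def)
    ultimately show "\<exists>D\<in>\<D>. x \<in> D \<and> D \<subseteq> U" using A(2) B(3) by blast
  qed
qed

text \<open>A chain of discs \<open>Ds\<close> along a loop, together with discs \<open>Bs\<close> in the overlaps that contain
  the division points (the entry \<open>Bs ! 0\<close> is irrelevant), determines the homotopy class.\<close>

definition disc_chain :: "(real \<Rightarrow> 'a) \<Rightarrow> 'a set list \<Rightarrow> 'a set list \<Rightarrow> bool" where
  "disc_chain f Ds Bs \<longleftrightarrow> Ds \<noteq> [] \<and>
     (\<forall>i<length Ds. f ` {real i / real (length Ds)..real (Suc i) / real (length Ds)} \<subseteq> Ds ! i) \<and>
     (\<forall>i. 0 < i \<and> i < length Ds \<longrightarrow>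
        f (real i / real (length Ds)) \<in> Bs ! i \<and> Bs ! i \<subseteq> Ds ! (i - 1) \<inter> Ds ! i)"

text \<open>The division points of \<open>f\<close> and \<open>g\<close> are joined by paths
  \<open>\<delta> i\<close> inside \<open>Bs ! i\<close>; these discs are there because an overlap
  of two discs may be disconnected. The boundary of the square over each subinterval then runs in
  the single disc \<open>Ds ! i\<close> and can be filled, and the fillings are stacked to a
  homotopy.\<close>

lemma disc_chain_homotopic:
  assumes f: "pathin X f" "f 0 = x" "f 1 = y" and g: "pathin X g" "g 0 = x" "g 1 = y"
    and Ds: "\<And>D. D \<in> set Ds \<Longrightarrow> disc X D" and Bs: "\<And>B. B \<in> set Bs \<Longrightarrow> disc X B"
    and len: "length Bs = length Ds"
    and cf: "disc_chain f Ds Bs" and cg: "disc_chain g Ds Bs"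
  shows "path_homotopic X x y f g"
proof -
  define N where "N = length Ds"
  define a where "a = (\<lambda>i. real i / real N)"
  have N: "N > 0" using cf by (simp add: disc_chain_def N_def)
  have a0: "a 0 = 0" and aN: "a N = 1" and a_less: "a i < a (Suc i)" and a01: "i \<le> N \<Longrightarrow> a i \<in> {0..1}" for i
    using N by (simp_all add: a_def divide_strict_right_mono)
  have fD: "f ` {a i..a (Suc i)} \<subseteq> Ds ! i" and gD: "g ` {a i..a (Suc i)} \<subseteq> Ds ! i" if "i < N" for i
    using cf cg that by (simp_all add: disc_chain_def N_def a_def)
  \<comment> \<open>Each joining path must lie in both neighbouring discs, as it bounds two squares.
    At the two ends it is constant, so that the homotopy fixes the end points.\<close>
  have "\<exists>\<delta>. pathin X \<delta> \<and> \<delta> 0 = f (a i) \<and> \<delta> 1 = g (a i) \<and>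
      (i < N \<longrightarrow> \<delta> ` {0..1} \<subseteq> Ds ! i) \<and> (0 < i \<longrightarrow> \<delta> ` {0..1} \<subseteq> Ds ! (i - 1)) \<and>
      (i = 0 \<longrightarrow> \<delta> = (\<lambda>_. x)) \<and> (i = N \<longrightarrow> \<delta> = (\<lambda>_. y))" if i: "i \<le> N" for i
  proof -
    consider "i = 0" | "i = N" "0 < i" | "0 < i" "i < N" using i by linarith
    then show ?thesis
    proof cases
      case 1
      have "f (a 0) \<in> Ds ! 0" using fD[of 0] N a_less[of 0] by auto
      then have "x \<in> Ds ! 0" using f(2) a0 by simp
      then show ?thesis
        using 1 N f g path_start_in_topspace[OF f(1)] by (intro exI[of _ "\<lambda>_. x"]) (auto simp: a0)
    next
      case 2
      have "f (a (Suc (N - 1))) \<in> Ds ! (N - 1)" using fD[of "N - 1"] N a_less[of "N - 1"] by auto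
      then have "y \<in> Ds ! (N - 1)" using f(3) aN N by simp
      then show ?thesis
        using 2 N f g path_finish_in_topspace[OF f(1)] by (intro exI[of _ "\<lambda>_. y"]) (auto simp: aN)
    next
      case 3
      then have B: "f (a i) \<in> Bs ! i" "g (a i) \<in> Bs ! i" "Bs ! i \<subseteq> Ds ! (i - 1) \<inter> Ds ! i"
        using cf cg unfolding disc_chain_def N_def a_def by blast+
      have "disc X (Bs ! i)" using Bs 3 len N_def by simp
      then obtain \<delta> where \<delta>: "pathin X \<delta>" "\<delta> 0 = f (a i)" "\<delta> 1 = g (a i)" "\<And>t. t \<in> {0..1} \<Longrightarrow> \<delta> t \<in> Bs ! i"
        using disc_path_connected[OF _ B(1,2)] by metis
      have "\<delta> ` {0..1} \<subseteq> Ds ! i" "\<delta> ` {0..1} \<subseteq> Ds ! (i - 1)" using \<delta>(4) B(3) by blast+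
      then show ?thesis using \<delta>(1-3) 3 by (intro exI[of _ \<delta>]) simp
    qed
  qed
  then obtain \<delta> where \<delta>: "\<And>i. i \<le> N \<Longrightarrow> pathin X (\<delta> i) \<and> \<delta> i 0 = f (a i) \<and> \<delta> i 1 = g (a i) \<and>
      (i < N \<longrightarrow> \<delta> i ` {0..1} \<subseteq> Ds ! i) \<and> (0 < i \<longrightarrow> \<delta> i ` {0..1} \<subseteq> Ds ! (i - 1)) \<and>
      (i = 0 \<longrightarrow> \<delta> i = (\<lambda>_. x)) \<and> (i = N \<longrightarrow> \<delta> i = (\<lambda>_. y))"
    by metis
  have "\<exists>H. continuous_map (top_of_set ({0..1} \<times> {0..a i})) X H \<and>
      (\<forall>t\<in>{0..a i}. H (0 :: real, t) = f t \<and> H (1, t) = g t) \<and>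
      (\<forall>u\<in>{0..1}. H (u, 0) = x \<and> H (u, a i) = \<delta> i u)" if "i \<le> N" for i
    using that
  proof (induction i)
    case 0
    have "x \<in> topspace X" using path_start_in_topspace[OF f(1)] f(2) by simp
    then show ?case using \<delta>[of 0] f g by (intro exI[of _ "\<lambda>_. x"]) (auto simp: a0)
  next
    case (Suc i)
    have i: "i < N" "i \<le> N" using Suc.prems by simp_all
    obtain H where H: "continuous_map (top_of_set ({0..1} \<times> {0..a i})) X H"
      "\<And>t. t \<in> {0..a i} \<Longrightarrow> H (0 :: real, t) = f t \<and> H (1, t) = g t"
      "\<And>u. u \<in> {0..1} \<Longrightarrow> H (u, 0) = x \<and> H (u, a i) = \<delta> i u"
      using Suc.IH[OF i(2)] by blast
    have sub: "{a i..a (Suc i)} \<subseteq> {0..1}" "0 \<le> a i" "a i \<le> a (Suc i)"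
      using a01[of i] a01[of "Suc i"] Suc.prems a_less[of i] by auto
    have sub_top: "subtopology (top_of_set {0..1}) {a i..a (Suc i)} = top_of_set {a i..a (Suc i)}"
      by (simp only: subtopology_subtopology inf.absorb2[OF sub(1)])
    have res: "continuous_map (top_of_set {a i..a (Suc i)}) X h" if "pathin X h" for h
      using continuous_map_from_subtopology that unfolding pathin_def sub_top[symmetric] by blast
    have dD: "disc X (Ds ! i)" using Ds i by (simp add: N_def)
    obtain K where K: "continuous_map (top_of_set ({0..1} \<times> {a i..a (Suc i)})) X K"
      "\<And>t. t \<in> {a i..a (Suc i)} \<Longrightarrow> K (0 :: real, t) = f t" "\<And>t. t \<in> {a i..a (Suc i)} \<Longrightarrow> K (1, t) = g t"
      "\<And>u. u \<in> {0..1} \<Longrightarrow> K (u, a i) = \<delta> i u" "\<And>u. u \<in> {0..1} \<Longrightarrow> K (u, a (Suc i)) = \<delta> (Suc i) u"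
      by (rule disc_fill_square[OF dD a_less[of i] res[OF f(1)] fD[OF i(1)] res[OF g(1)] gD[OF i(1)],
            of "\<delta> i" "\<delta> (Suc i)"])
         (use \<delta>[OF i(2)] \<delta>[OF Suc.prems] i Suc.prems in simp_all)
    define L where "L = (\<lambda>w :: real \<times> real. if snd w \<le> a i then H w else K w)"
    let ?J = "top_of_set ({0..1} \<times> {0..a (Suc i)}) :: (real \<times> real) topology"
    have "continuous_map ?J X L"
      unfolding L_def
    proof (rule continuous_map_cases_le)
      have *: "{0..1} \<times> {0..a (Suc i)} \<inter> {w \<in> topspace ?J. snd w \<le> a i} = {0..1} \<times> {0..a i}"
        "{0..1} \<times> {0..a (Suc i)} \<inter> {w \<in> topspace ?J. a i \<le> snd w} = {0..1} \<times> {a i..a (Suc i)}"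
        using sub by auto
      show "continuous_map (subtopology ?J {w \<in> topspace ?J. snd w \<le> a i}) X H"
        unfolding subtopology_subtopology * by (rule H(1))
      show "continuous_map (subtopology ?J {w \<in> topspace ?J. a i \<le> snd w}) X K"
        unfolding subtopology_subtopology * by (rule K(1))
      show "H w = K w" if "w \<in> topspace ?J" "snd w = a i" for w
      proof -
        have "w = (fst w, a i)" "fst w \<in> {0..1}" using that by auto
        then show ?thesis using H(3) K(4) by metis
      qed
    qed (auto intro!: continuous_intros)
    moreover have "\<forall>t\<in>{0..a (Suc i)}. L (0, t) = f t \<and> L (1, t) = g t"
      using H(2) K(2,3) by (auto simp: L_def)
    moreover have "\<forall>u\<in>{0..1}. L (u, 0) = x \<and> L (u, a (Suc i)) = \<delta> (Suc i) u"
      using H(3) K(5) sub a_less[of i] by (auto simp: L_def)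
    ultimately show ?case by blast
  qed
  from this[of N] obtain H where H: "continuous_map (top_of_set ({0..1} \<times> {0..1})) X H"
      "\<And>t. t \<in> {0..1} \<Longrightarrow> H (0 :: real, t) = f t \<and> H (1, t) = g t"
      "\<And>u. u \<in> {0..1} \<Longrightarrow> H (u, 0) = x \<and> H (u, 1) = y"
    using \<delta>[of N] aN by auto
  have "continuous_map (prod_topology (top_of_set {0..1}) (top_of_set {0..1})) X H"
    using H(1) by (simp add: subtopology_Times)
  then show ?thesis
    unfolding path_homotopic_def
    by (subst homotopic_with) (use H(2,3) in \<open>auto intro!: exI[of _ H]\<close>)
qed

text \<open>Every class contains a loop that follows a chain of discs from a countable base.
  Choosing such a chain for each class is injective, since a chain determines the class, and there
  are only countably many pairs of finite lists.\<close>

theorem countable_fundamental_group: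
  assumes M: "holomorphic_1form M" and sc: "second_countable (topo M)"
  shows "countable (carrier (fundamental_group (topo M) x))"
proof -
  let ?X = "topo M"
  obtain \<D> where \<D>: "countable \<D>" "\<And>D. D \<in> \<D> \<Longrightarrow> disc ?X D"
    "\<And>U x. openin ?X U \<Longrightarrow> x \<in> U \<Longrightarrow> \<exists>D\<in>\<D>. x \<in> D \<and> D \<subseteq> U"
    using countable_disc_base[OF assms] by metis
  define good where "good = (\<lambda>c P. fst P \<in> lists \<D> \<and> snd P \<in> lists \<D> \<and> length (snd P) = length (fst P) \<and>
      (\<exists>f\<in>c. disc_chain f (fst P) (snd P)))"
  have ex: "\<exists>P. good c P" if cc: "c \<in> carrier (fundamental_group ?X x)" for c
  proof -
    obtain f where f: "pathin ?X f" "f \<in> c" using fundamental_group_carrierE[OF cc] by metis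
    have "\<exists>D. D \<in> \<D> \<and> openin ?X D \<and> q \<in> D" if "q \<in> topspace ?X" for q
      using \<D>(3)[OF openin_topspace that] \<D>(2) disc_open by blast
    then obtain N :: nat where N: "N > 0"
      "\<And>i. i < N \<Longrightarrow> \<exists>D. D \<in> \<D> \<and> openin ?X D \<and> f ` {real i / real N..real (Suc i) / real N} \<subseteq> D"
      using pathin_subdivision[OF f(1), of "\<lambda>D. D \<in> \<D>"] by metis
    then obtain D where D: "\<And>i. i < N \<Longrightarrow> D i \<in> \<D> \<and> openin ?X (D i) \<and> f ` {real i / real N..real (Suc i) / real N} \<subseteq> D i"
      by metis
    \<comment> \<open>For \<open>i = 0\<close> any member of \<open>\<D>\<close> serves:
      \<open>disc_chain\<close> puts no condition on this entry, but the two lists must have equal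
      length.\<close>
    have "\<exists>B\<in>\<D>. 0 < i \<longrightarrow> f (real i / real N) \<in> B \<and> B \<subseteq> D (i - 1) \<inter> D i" if i: "i < N" for i
    proof (cases "i = 0")
      case True
      then show ?thesis using D[OF i] by blast
    next
      case False
      then obtain j where j: "i = Suc j" by (cases i) auto
      have "real j / real N \<le> real i / real N" "real i / real N \<le> real (Suc i) / real N"
        by (simp_all add: j divide_right_mono)
      then have "f (real i / real N) \<in> D j \<inter> D i"
        using D[OF i] D[of j] i by (auto simp: j)
      moreover have "openin ?X (D j \<inter> D i)" using D[OF i] D[of j] i by (simp add: j openin_Int)
      ultimately show ?thesis using \<D>(3)[of "D j \<inter> D i"] by (auto simp: j)
    qed
    then obtain B where B: "\<And>i. i < N \<Longrightarrow> B i \<in> \<D>"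
        "\<And>i. i < N \<Longrightarrow> 0 < i \<Longrightarrow> f (real i / real N) \<in> B i \<and> B i \<subseteq> D (i - 1) \<inter> D i"
      by metis
    have "disc_chain f (map D [0..<N]) (map B [0..<N])"
      unfolding disc_chain_def using N(1) D B(2) by (simp add: less_imp_diff_less)
    then have "good c (map D [0..<N], map B [0..<N])"
      using D B(1) f(2) by (auto simp: good_def)
    then show ?thesis ..
  qed
  have "inj_on (\<lambda>c. SOME P. good c P) (carrier (fundamental_group ?X x))"
  proof (rule inj_onI)
    fix c c' assume c: "c \<in> carrier (fundamental_group ?X x)" and c': "c' \<in> carrier (fundamental_group ?X x)"
      and eq: "(SOME P. good c P) = (SOME P. good c' P)"
    define P where "P = (SOME P. good c P)"
    have "good c P" "good c' P" using someI_ex[OF ex[OF c]] someI_ex[OF ex[OF c']] eq by (simp_all add: P_def)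
    then obtain f g where fg: "f \<in> c" "g \<in> c'" "disc_chain f (fst P) (snd P)" "disc_chain g (fst P) (snd P)"
        "fst P \<in> lists \<D>" "snd P \<in> lists \<D>" "length (snd P) = length (fst P)"
      unfolding good_def by blast
    note F = fundamental_group_class[OF c fg(1)] and G = fundamental_group_class[OF c' fg(2)]
    have "path_homotopic ?X x x f g"
      by (rule disc_chain_homotopic[OF F(1-3) G(1-3) _ _ fg(7) fg(3,4)]) (use fg(5,6) \<D>(2) in auto)
    then have "g \<in> c" using F(4) by blast
    then show "c = c'" using fundamental_group_class(4)[OF c] G(4) by blast
  qed
  moreover have "countable (lists \<D> \<times> lists \<D>)" using \<D>(1) by simp
  moreover have "(\<lambda>c. SOME P. good c P) ` carrier (fundamental_group ?X x) \<subseteq> lists \<D> \<times> lists \<D>"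
  proof (rule image_subsetI)
    fix c assume "c \<in> carrier (fundamental_group ?X x)"
    from someI_ex[OF ex[OF this]] show "(SOME P. good c P) \<in> lists \<D> \<times> lists \<D>"
      unfolding good_def mem_Times_iff by blast
  qed
  ultimately show ?thesis by (metis countable_image_inj_on countable_subset)
qed

section \<open>Monodromy\<close>

lemma locally_path_connected_surface:
  assumes M: "holomorphic_1form M"
  shows "locally_path_connected_space (topo M)"
  unfolding locally_path_connected_space
proof (intro allI impI, elim conjE)
  fix V x assume "openin (topo M) V" "x \<in> V"
  then obtain D where D: "disc (topo M) D" "x \<in> D" "D \<subseteq> V" using disc_neighbourhood[OF M] by metis
  have "D \<subseteq> topspace (topo M)" using disc_open[OF D(1)] openin_subset by blast
  moreover have "\<exists>g. pathin (topo M) g \<and> g \<in> {0..1} \<rightarrow> D \<and> g 0 = a \<and> g 1 = b" if "a \<in> D" "b \<in> D" for a b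
    by (rule disc_path_connected[OF D(1) that]) auto
  ultimately have "path_connectedin (topo M) D" unfolding path_connectedin by blast
  then show "\<exists>U. openin (topo M) U \<and> path_connectedin (topo M) U \<and> x \<in> U \<and> U \<subseteq> V"
    using D disc_open by blast
qed

lemma path_connected_surface:
  assumes M: "holomorphic_1form M" and c: "connected_space (topo M)"
  shows "path_connected_space (topo M)"
proof -
  have "path_component_of_set (topo M) x = connected_component_of_set (topo M) x" for x
    by (rule path_component_eq_connected_component_of[OF locally_path_connected_surface[OF M]])
  then have "path_component_of (topo M) x y \<longleftrightarrow> connected_component_of (topo M) x y" for x y
    by blast
  then show ?thesis
    using c by (simp add: path_connected_space_iff_path_component connected_space_iff_connected_component)
qed

text \<open>A lift satisfies \<open>p (\<eta> t) = g t\<close> on the unit interval only, whereas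
  the monodromy condition speaks of the function \<open>p \<circ> \<eta>\<close> as a member of a
  class.\<close>

lemma fundamental_group_class_eq_on:
  assumes c: "c \<in> carrier (fundamental_group X x)" and f: "f \<in> c" and eq: "\<And>t. t \<in> {0..1} \<Longrightarrow> g t = f t"
  shows "g \<in> c"
proof -
  note F = fundamental_group_class[OF c f]
  have "path_homotopic X x x f g" by (rule path_homotopic_eq[OF F(1-3)]) (simp add: eq)
  then show ?thesis using F(4) by blast
qed

section \<open>Covers with equal monodromy are isomorphic\<close>

lemma path_concat_eq_on:
  assumes "\<And>t. t \<in> {0..1} \<Longrightarrow> f t = f' t" "\<And>t. t \<in> {0..1} \<Longrightarrow> g t = g' t" "t \<in> {0..1}"
  shows "path_concat f g t = path_concat f' g' t"
  using assms(3) by (auto simp: path_concat_def intro!: assms(1,2))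

text \<open>The monodromy sends the label of the end of a lift to that of its start, so it is the
  end point that has to be prescribed.\<close>

lemma covering_path_lift_end:
  assumes p: "covering_map Y p X" and g: "pathin X g" and y: "y \<in> topspace Y" "p y = g 1"
  obtains \<eta> where "pathin Y \<eta>" "\<eta> 1 = y" "\<And>t. t \<in> {0..1} \<Longrightarrow> p (\<eta> t) = g t"
proof -
  obtain \<eta> where \<eta>: "pathin Y \<eta>" "\<eta> 0 = y" "\<And>t. t \<in> {0..1} \<Longrightarrow> p (\<eta> t) = g (1 - t)"
    using covering_path_lift[OF p pathin_reverse[OF g] y(1)] y(2) by auto
  have "p (\<eta> (1 - t)) = g t" if "t \<in> {0..1}" for t using \<eta>(3)[of "1 - t"] that by simp
  then show thesis using that[OF pathin_reverse[OF \<eta>(1)]] \<eta>(2) by simp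
qed

text \<open>The graph of the isomorphism sought: \<open>y\<close> and \<open>z\<close> are the ends
  of lifts of the same path from \<open>s\<close> that start at points with equal labels. The
  relation is symmetric in the two covers, so each statement about it also serves for the inverse
  map.\<close>

definition lift_transport ::
  "'b topology \<Rightarrow> ('b \<Rightarrow> 'a) \<Rightarrow> ('b \<Rightarrow> nat) \<Rightarrow> 'c topology \<Rightarrow> ('c \<Rightarrow> 'a) \<Rightarrow> ('c \<Rightarrow> nat) \<Rightarrow> 'a \<Rightarrow> 'b \<Rightarrow> 'c \<Rightarrow> bool" where
  "lift_transport Y p l Y' p' l' s y z \<longleftrightarrow>
     (\<exists>\<eta> \<eta>'. pathin Y \<eta> \<and> pathin Y' \<eta>' \<and> (\<forall>t\<in>{0..1}. p (\<eta> t) = p' (\<eta>' t)) \<and>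
        p (\<eta> 0) = s \<and> l (\<eta> 0) = l' (\<eta>' 0) \<and> \<eta> 1 = y \<and> \<eta>' 1 = z)"

lemma lift_transport_sym:
  "lift_transport Y p l Y' p' l' s y z \<Longrightarrow> lift_transport Y' p' l' Y p l s z y"
  unfolding lift_transport_def by (metis atLeastAtMost_iff order_refl zero_le_one)

lemma lift_transportD:
  assumes "lift_transport Y p l Y' p' l' s y z"
  shows "y \<in> topspace Y" "z \<in> topspace Y'" "p' z = p y"
  using assms path_finish_in_topspace unfolding lift_transport_def by (metis atLeastAtMost_iff order_refl zero_le_one)+

text \<open>A path from \<open>s\<close> to \<open>p y\<close> is lifted backwards from
  \<open>y\<close>; the label at its start selects the point of the other fiber from which to lift
  it forwards. This works for disconnected covers too.\<close>

lemma lift_transport_total: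
  assumes p: "covering_map Y p X" and p': "covering_map Y' p' X"
    and X: "path_connected_space X" and s: "s \<in> topspace X"
    and l: "bij_betw l {y \<in> topspace Y. p y = s} A" and l': "bij_betw l' {y \<in> topspace Y'. p' y = s} A"
    and y: "y \<in> topspace Y"
  shows "\<exists>z. lift_transport Y p l Y' p' l' s y z"
proof -
  have py: "p y \<in> topspace X" using covering_mapD(1)[OF p] y by (auto simp: continuous_map_def)
  then obtain g where g: "pathin X g" "g 0 = s" "g 1 = p y"
    using X s unfolding path_connected_space_def by blast
  obtain \<eta> where \<eta>: "pathin Y \<eta>" "\<eta> 1 = y" "\<And>t. t \<in> {0..1} \<Longrightarrow> p (\<eta> t) = g t"
    using covering_path_lift_end[OF p g(1) y] g(3) by metis
  have p0: "p (\<eta> 0) = s" using \<eta>(3)[of 0] g(2) by simp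
  then have "\<eta> 0 \<in> {y \<in> topspace Y. p y = s}" using path_start_in_topspace[OF \<eta>(1)] by simp
  then have "l (\<eta> 0) \<in> A" using l by (metis bij_betwE)
  then have "l (\<eta> 0) \<in> l' ` {y \<in> topspace Y'. p' y = s}" using bij_betw_imp_surj_on[OF l'] by simp
  then obtain w where w: "w \<in> topspace Y'" "p' w = s" "l' w = l (\<eta> 0)" by auto
  obtain \<eta>' where \<eta>': "pathin Y' \<eta>'" "\<eta>' 0 = w" "\<And>t. t \<in> {0..1} \<Longrightarrow> p' (\<eta>' t) = g t"
    using covering_path_lift[OF p' g(1) w(1)] w(2) g(2) by metis
  have "lift_transport Y p l Y' p' l' s y (\<eta>' 1)"
    unfolding lift_transport_def using \<eta> \<eta>' p0 w(3) by (intro exI[of _ \<eta>] exI[of _ \<eta>']) simp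
  then show ?thesis ..
qed

text \<open>Running along \<open>\<eta>1\<close> and back along \<open>\<eta>2\<close> projects to a
  loop \<open>c\<close>, and \<open>\<rho> c\<close> takes the label at the start of
  \<open>\<eta>2\<close> to that at the start of \<open>\<eta>1\<close>. In the other cover the lift
  of the same loop begins with \<open>\<eta>1'\<close>. As \<open>\<rho> c\<close> is injective,
  this lift ends where \<open>\<eta>2'\<close> starts; so its second half is the reverse of
  \<open>\<eta>2'\<close>, and \<open>z1 = z2\<close>.\<close>

lemma lift_transport_unique:
  assumes p: "covering_map Y p X" and p': "covering_map Y' p' X"
    and l': "inj_on l' {y \<in> topspace Y'. p' y = s}"
    and \<rho>: "\<And>c. c \<in> carrier (fundamental_group X s) \<Longrightarrow> inj (\<rho> c)"
    and mon: "\<And>c \<eta>. c \<in> carrier (fundamental_group X s) \<Longrightarrow> pathin Y \<eta> \<Longrightarrow> p \<circ> \<eta> \<in> c \<Longrightarrow> \<rho> c (l (\<eta> 1)) = l (\<eta> 0)"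
    and mon': "\<And>c \<eta>. c \<in> carrier (fundamental_group X s) \<Longrightarrow> pathin Y' \<eta> \<Longrightarrow> p' \<circ> \<eta> \<in> c \<Longrightarrow> \<rho> c (l' (\<eta> 1)) = (l' (\<eta> 0) :: nat)"
    and z1: "lift_transport Y p l Y' p' l' s y z1" and z2: "lift_transport Y p l Y' p' l' s y z2"
  shows "z1 = z2"
proof -
  obtain \<eta>1 \<eta>1' where 1: "pathin Y \<eta>1" "pathin Y' \<eta>1'" "\<And>t. t \<in> {0..1} \<Longrightarrow> p (\<eta>1 t) = p' (\<eta>1' t)"
      "p (\<eta>1 0) = s" "l (\<eta>1 0) = l' (\<eta>1' 0)" "\<eta>1 1 = y" "\<eta>1' 1 = z1"
    using z1 unfolding lift_transport_def by metis
  obtain \<eta>2 \<eta>2' where 2: "pathin Y \<eta>2" "pathin Y' \<eta>2'" "\<And>t. t \<in> {0..1} \<Longrightarrow> p (\<eta>2 t) = p' (\<eta>2' t)"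
      "p (\<eta>2 0) = s" "l (\<eta>2 0) = l' (\<eta>2' 0)" "\<eta>2 1 = y" "\<eta>2' 1 = z2"
    using z2 unfolding lift_transport_def by metis
  define \<eta>2r where "\<eta>2r = (\<lambda>t. \<eta>2 (1 - t))"
  have r: "pathin Y \<eta>2r" "\<eta>2r 0 = y" "\<eta>2r 1 = \<eta>2 0" using pathin_reverse[OF 2(1)] 2(6) by (simp_all add: \<eta>2r_def)
  define \<theta> where "\<theta> = path_concat \<eta>1 \<eta>2r"
  have \<theta>: "pathin Y \<theta>" "\<theta> 0 = \<eta>1 0" "\<theta> 1 = \<eta>2 0"
    unfolding \<theta>_def using pathin_path_concat[OF 1(1) r(1)] 1(6) r by simp_all
  have p\<theta>: "pathin X (p \<circ> \<theta>)" "(p \<circ> \<theta>) 0 = s" "(p \<circ> \<theta>) 1 = s"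
    using pathin_compose[OF \<theta>(1) covering_mapD(1)[OF p]] \<theta> 1(4) 2(4) by simp_all
  define c where "c = {g. path_homotopic X s s (p \<circ> \<theta>) g}"
  have c: "c \<in> carrier (fundamental_group X s)" unfolding c_def by (rule fundamental_group_carrierI[OF p\<theta>])
  have inc: "p \<circ> \<theta> \<in> c" unfolding c_def using path_homotopic_eq[OF p\<theta>] by blast
  have m: "\<rho> c (l (\<eta>2 0)) = l (\<eta>1 0)" using mon[OF c \<theta>(1) inc] \<theta> by simp
  have z1t: "z1 \<in> topspace Y'" "p' z1 = p y" using lift_transportD[OF z1] by simp_all
  have "pathin X (p \<circ> \<eta>2r)" using pathin_compose[OF r(1) covering_mapD(1)[OF p]] .
  then obtain \<zeta> where \<zeta>: "pathin Y' \<zeta>" "\<zeta> 0 = z1" "\<And>t. t \<in> {0..1} \<Longrightarrow> p' (\<zeta> t) = p (\<eta>2r t)"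
    using covering_path_lift[OF p' _ z1t(1), of "p \<circ> \<eta>2r"] z1t(2) r(2) by auto
  define \<theta>' where "\<theta>' = path_concat \<eta>1' \<zeta>"
  have \<theta>': "pathin Y' \<theta>'" "\<theta>' 0 = \<eta>1' 0" "\<theta>' 1 = \<zeta> 1"
    unfolding \<theta>'_def using pathin_path_concat[OF 1(2) \<zeta>(1)] 1(7) \<zeta>(2) by simp_all
  have "p' \<circ> \<theta>' \<in> c"
  proof (rule fundamental_group_class_eq_on[OF c inc])
    show "(p' \<circ> \<theta>') t = (p \<circ> \<theta>) t" if "t \<in> {0..1}" for t
      unfolding \<theta>'_def \<theta>_def path_concat_simps
      by (rule path_concat_eq_on) (use 1(3) \<zeta>(3) that in auto)
  qed
  from mon'[OF c \<theta>'(1) this] have "\<rho> c (l' (\<zeta> 1)) = \<rho> c (l' (\<eta>2' 0))"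
    using \<theta>' 1(5) 2(5) m by simp
  then have "l' (\<zeta> 1) = l' (\<eta>2' 0)" using \<rho>[OF c] by (simp add: inj_eq)
  moreover have "\<zeta> 1 \<in> {y \<in> topspace Y'. p' y = s}"
    using path_finish_in_topspace[OF \<zeta>(1)] \<zeta>(3)[of 1] r(3) 2(4) by simp
  moreover have "\<eta>2' 0 \<in> {y \<in> topspace Y'. p' y = s}"
    using path_start_in_topspace[OF 2(2)] 2(3)[of 0] 2(4) by simp
  \<comment> \<open>Written with \<open>1 - 1\<close> to match the reversed path
    \<open>\<eta>2' (1 - t)\<close> at \<open>t = 1\<close>, where the two lifts are known to
    agree.\<close>
  ultimately have end_eq: "\<zeta> 1 = \<eta>2' (1 - 1)" using l' by (simp add: inj_on_def)
  have "p' (\<zeta> t) = p' (\<eta>2' (1 - t))" if "t \<in> {0..1}" for t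
    using \<zeta>(3)[OF that] 2(3)[of "1 - t"] that by (simp add: \<eta>2r_def)
  from covering_path_lift_unique[OF p' \<zeta>(1) pathin_reverse[OF 2(2)] this _ end_eq, of 0]
  have "\<zeta> 0 = \<eta>2' 1" by simp
  then show ?thesis using \<zeta>(2) 2(7) by simp
qed

lemma continuous_map_local:
  assumes "\<And>x. x \<in> topspace X \<Longrightarrow> \<exists>N. openin X N \<and> x \<in> N \<and> continuous_map (subtopology X N) Y f"
  shows "continuous_map X Y f"
  unfolding continuous_map
proof (intro conjI allI impI)
  show "f ` topspace X \<subseteq> topspace Y"
  proof (rule image_subsetI)
    fix x assume x: "x \<in> topspace X"
    then obtain N where "x \<in> N" "continuous_map (subtopology X N) Y f" using assms by blast
    then show "f x \<in> topspace Y" using x by (auto simp: continuous_map_def)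
  qed
  fix U assume U: "openin Y U"
  show "openin X {x \<in> topspace X. f x \<in> U}"
  proof (subst openin_subopen, intro ballI)
    fix x assume x: "x \<in> {x \<in> topspace X. f x \<in> U}"
    then obtain N where N: "openin X N" "x \<in> N" "continuous_map (subtopology X N) Y f" using assms by blast
    have "openin (subtopology X N) {y \<in> topspace (subtopology X N). f y \<in> U}"
      using N(3) U by (simp add: continuous_map_def)
    then have "openin X {y \<in> topspace (subtopology X N). f y \<in> U}" using N(1) openin_trans_full by blast
    then show "\<exists>T. openin X T \<and> x \<in> T \<and> T \<subseteq> {x \<in> topspace X. f x \<in> U}"
      using x N(2) by (intro exI[of _ "{y \<in> topspace (subtopology X N). f y \<in> U}"]) auto
  qed
qed

text \<open>Near \<open>y\<close> the map is \<open>s2 \<circ> p\<close> with \<open>s2\<close> the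
  local section through \<open>k y\<close>: a path in \<open>W\<close> from \<open>p y\<close> to
  \<open>p v\<close> prolongs the lifts ending at \<open>y\<close> and \<open>k y\<close> by its
  images under the two sections, and uniqueness identifies the end with \<open>k v\<close>.\<close>

lemma lift_transport_continuous:
  assumes p: "covering_map Y p X" and p': "covering_map Y' p' X" and X: "locally_path_connected_space X"
    and k: "\<And>y. y \<in> topspace Y \<Longrightarrow> lift_transport Y p l Y' p' l' s y (k y)"
    and unique: "\<And>y z1 z2. lift_transport Y p l Y' p' l' s y z1 \<Longrightarrow> lift_transport Y p l Y' p' l' s y z2 \<Longrightarrow> z1 = z2"
  shows "continuous_map Y Y' k"
proof (rule continuous_map_local)
  fix y assume y: "y \<in> topspace Y"
  have contp: "continuous_map Y X p" by (rule covering_mapD(1)[OF p])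
  have py: "p y \<in> topspace X" using contp y by (auto simp: continuous_map_def)
  have ky: "k y \<in> topspace Y'" "p' (k y) = p y" using lift_transportD[OF k[OF y]] by simp_all
  obtain U1 \<V>1 where U1: "evenly_covered Y p X U1 \<V>1" "openin X U1" "p y \<in> U1" using covering_mapD(3)[OF p py] by blast
  obtain U2 \<V>2 where U2: "evenly_covered Y' p' X U2 \<V>2" "openin X U2" "p y \<in> U2" using covering_mapD(3)[OF p' py] by blast
  obtain V1 s1 where s1: "openin Y V1" "y \<in> V1" "continuous_map (subtopology X U1) Y s1"
      "\<And>x. x \<in> U1 \<Longrightarrow> s1 x \<in> V1 \<and> p (s1 x) = x" "\<And>v. v \<in> V1 \<Longrightarrow> s1 (p v) = v"
    using evenly_covered_sheet[OF U1(1,2) y U1(3)] by metis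
  obtain V2 s2 where s2: "k y \<in> V2" "continuous_map (subtopology X U2) Y' s2"
      "\<And>x. x \<in> U2 \<Longrightarrow> s2 x \<in> V2 \<and> p' (s2 x) = x" "\<And>v. v \<in> V2 \<Longrightarrow> s2 (p' v) = v"
    using evenly_covered_sheet[OF U2(1,2) ky(1)] U2(3) ky(2) by metis
  have "openin X (U1 \<inter> U2)" "p y \<in> U1 \<inter> U2" using U1 U2 by auto
  then obtain W where W: "openin X W" "path_connectedin X W" "p y \<in> W" "W \<subseteq> U1 \<inter> U2"
    using X unfolding locally_path_connected_space by metis
  define N where "N = V1 \<inter> {v \<in> topspace Y. p v \<in> W}"
  have N: "openin Y N" "y \<in> N" unfolding N_def
    using s1(1,2) W(1,3) contp y by (auto simp: continuous_map_def intro!: openin_Int)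
  have sub: "continuous_map (subtopology X W) Y s1" "continuous_map (subtopology X W) Y' s2"
    using continuous_map_from_subtopology_mono[OF s1(3)] continuous_map_from_subtopology_mono[OF s2(2)] W(4) by auto
  have k_eq: "k v = s2 (p v)" if v: "v \<in> N" for v
  proof -
    have vY: "v \<in> topspace Y" "v \<in> V1" "p v \<in> W" using v by (auto simp: N_def)
    obtain \<omega> where \<omega>: "pathin X \<omega>" "\<omega> \<in> {0..1} \<rightarrow> W" "\<omega> 0 = p y" "\<omega> 1 = p v"
      using W(2,3) vY(3) unfolding path_connectedin by blast
    have \<omega>W: "pathin (subtopology X W) \<omega>" using \<omega>(1,2) by (auto simp: pathin_subtopology)
    have \<omega>U: "\<omega> t \<in> U1 \<and> \<omega> t \<in> U2" if "t \<in> {0..1}" for t using \<omega>(2) W(4) that by blast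
    obtain \<eta> \<eta>' where \<eta>: "pathin Y \<eta>" "pathin Y' \<eta>'" "\<And>t. t \<in> {0..1} \<Longrightarrow> p (\<eta> t) = p' (\<eta>' t)"
      "p (\<eta> 0) = s" "l (\<eta> 0) = l' (\<eta>' 0)" "\<eta> 1 = y" "\<eta>' 1 = k y"
      using k[OF y] unfolding lift_transport_def by metis
    define \<theta> where "\<theta> = path_concat \<eta> (s1 \<circ> \<omega>)"
    define \<theta>' where "\<theta>' = path_concat \<eta>' (s2 \<circ> \<omega>)"
    have start: "s1 (p y) = y" "s2 (p y) = k y" "s1 (p v) = v"
      using s1(2,5) s2(1,4) vY(2) ky(2) by (simp, metis, simp)
    have "pathin Y \<theta>" unfolding \<theta>_def
      using pathin_path_concat[OF \<eta>(1) pathin_compose[OF \<omega>W sub(1)]] \<eta>(6) \<omega>(3) start(1) by simp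
    moreover have "pathin Y' \<theta>'" unfolding \<theta>'_def
      using pathin_path_concat[OF \<eta>(2) pathin_compose[OF \<omega>W sub(2)]] \<eta>(7) \<omega>(3) start(2) by simp
    moreover have "p (\<theta> t) = p' (\<theta>' t)" if "t \<in> {0..1}" for t
    proof -
      have "path_concat (p \<circ> \<eta>) (p \<circ> (s1 \<circ> \<omega>)) t = path_concat (p' \<circ> \<eta>') (p' \<circ> (s2 \<circ> \<omega>)) t"
        by (rule path_concat_eq_on[OF _ _ that]) (use \<eta>(3) \<omega>U s1(4) s2(3) in auto)
      then have "(p \<circ> \<theta>) t = (p' \<circ> \<theta>') t" unfolding \<theta>_def \<theta>'_def path_concat_simps .
      then show ?thesis by simp
    qed
    ultimately have "lift_transport Y p l Y' p' l' s v (s2 (p v))"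
      unfolding lift_transport_def using \<eta>(4,5) \<omega>(4) start(3)
      by (intro exI[of _ \<theta>] exI[of _ \<theta>']) (simp add: \<theta>_def \<theta>'_def)
    then show ?thesis using unique k[OF vY(1)] by blast
  qed
  have "continuous_map (subtopology Y N) (subtopology X W) p"
    using continuous_map_from_subtopology[OF contp] by (auto simp: continuous_map_in_subtopology N_def)
  from continuous_map_compose[OF this sub(2)]
  have "continuous_map (subtopology Y N) Y' (s2 \<circ> p)" .
  then have "continuous_map (subtopology Y N) Y' k"
    by (rule continuous_map_eq) (simp add: k_eq)
  then show "\<exists>N. openin Y N \<and> y \<in> N \<and> continuous_map (subtopology Y N) Y' k" using N by blast
qed

text \<open>The maps \<open>k\<close> and \<open>k'\<close> are chosen from the relation and its
  converse; uniqueness in both directions makes them inverse to each other.\<close>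

proposition covers_same_monodromy_homeomorphic:
  assumes p: "covering_map Y p X" and p': "covering_map Y' p' X"
    and X: "path_connected_space X" "locally_path_connected_space X" and s: "s \<in> topspace X"
    and l: "bij_betw l {y \<in> topspace Y. p y = s} A" and l': "bij_betw l' {y \<in> topspace Y'. p' y = s} A"
    and \<rho>: "\<And>c. c \<in> carrier (fundamental_group X s) \<Longrightarrow> inj (\<rho> c)"
    and mon: "\<And>c \<eta>. c \<in> carrier (fundamental_group X s) \<Longrightarrow> pathin Y \<eta> \<Longrightarrow> p \<circ> \<eta> \<in> c \<Longrightarrow> \<rho> c (l (\<eta> 1)) = l (\<eta> 0)"
    and mon': "\<And>c \<eta>. c \<in> carrier (fundamental_group X s) \<Longrightarrow> pathin Y' \<eta> \<Longrightarrow> p' \<circ> \<eta> \<in> c \<Longrightarrow> \<rho> c (l' (\<eta> 1)) = (l' (\<eta> 0) :: nat)"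
  obtains k where "homeomorphic_map Y Y' k" "\<And>y. y \<in> topspace Y \<Longrightarrow> p' (k y) = p y"
proof -
  let ?R = "lift_transport Y p l Y' p' l' s" and ?R' = "lift_transport Y' p' l' Y p l s"
  define k where "k = (\<lambda>y. SOME z. ?R y z)"
  define k' where "k' = (\<lambda>z. SOME y. ?R' z y)"
  have k: "?R y (k y)" if "y \<in> topspace Y" for y
    unfolding k_def by (rule someI_ex[OF lift_transport_total[OF p p' X(1) s l l' that]])
  have k': "?R' z (k' z)" if "z \<in> topspace Y'" for z
    unfolding k'_def by (rule someI_ex[OF lift_transport_total[OF p' p X(1) s l' l that]])
  have u: "z1 = z2" if "?R y z1" "?R y z2" for y z1 z2
    by (rule lift_transport_unique[OF p p' bij_betw_imp_inj_on[OF l'] \<rho> mon mon' that])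
  have u': "y1 = y2" if "?R' z y1" "?R' z y2" for z y1 y2
    by (rule lift_transport_unique[OF p' p bij_betw_imp_inj_on[OF l] \<rho> mon' mon that])
  have "continuous_map Y Y' k" by (rule lift_transport_continuous[OF p p' X(2) k u])
  moreover have "continuous_map Y' Y k'" by (rule lift_transport_continuous[OF p' p X(2) k' u'])
  moreover have "k' (k y) = y" if "y \<in> topspace Y" for y
    by (rule u'[OF k'[OF lift_transportD(2)[OF k[OF that]]] lift_transport_sym[OF k[OF that]]])
  moreover have "k (k' z) = z" if "z \<in> topspace Y'" for z
    by (rule u[OF k[OF lift_transportD(2)[OF k'[OF that]]] lift_transport_sym[OF k'[OF that]]])
  ultimately have "homeomorphic_maps Y Y' k k'" unfolding homeomorphic_maps_def by blast
  then have "homeomorphic_map Y Y' k" by (rule homeomorphic_maps_imp_map)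
  then show thesis using that lift_transportD(3)[OF k] by blast
qed

text \<open>For a function known only through its effect on the ends of lifts, multiplicativity is
  recovered by lifting a concatenation: first \<open>g\<close> so as to end at \<open>y\<close>,
  then \<open>f\<close> so as to end where that lift starts. This order agrees with composition of
  permutations from right to left.\<close>

lemma monodromy_hom:
  assumes p: "covering_map Y p X" and l: "bij_betw l {y \<in> topspace Y. p y = s} {1..d}"
    and \<rho>: "\<And>c. c \<in> carrier (fundamental_group X s) \<Longrightarrow> \<rho> c \<in> carrier (sym_group d)"
    and mon: "\<And>c \<eta>. c \<in> carrier (fundamental_group X s) \<Longrightarrow> pathin Y \<eta> \<Longrightarrow> p \<circ> \<eta> \<in> c \<Longrightarrow> \<rho> c (l (\<eta> 1)) = l (\<eta> 0)"
  shows "\<rho> \<in> hom (fundamental_group X s) (sym_group d)"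
proof (rule homI)
  fix a b assume a: "a \<in> carrier (fundamental_group X s)" and b: "b \<in> carrier (fundamental_group X s)"
  obtain f where f: "f \<in> a" using fundamental_group_carrierE[OF a] by metis
  obtain g where g: "g \<in> b" using fundamental_group_carrierE[OF b] by metis
  note F = fundamental_group_class[OF a f] and G = fundamental_group_class[OF b g]
  note ab = fundamental_group_mult[OF a f b g]
  let ?ab = "a \<otimes>\<^bsub>fundamental_group X s\<^esub> b"
  have perm: "\<rho> c permutes {1..d}" if "c \<in> carrier (fundamental_group X s)" for c
    using \<rho>[OF that] by (simp add: sym_group_carrier)
  have "\<rho> ?ab i = \<rho> a (\<rho> b i)" for i
  proof (cases "i \<in> {1..d}")
    case True
    then have "i \<in> l ` {y \<in> topspace Y. p y = s}" using bij_betw_imp_surj_on[OF l] by simp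
    then obtain y where y: "y \<in> topspace Y" "p y = s" "i = l y" by auto
    obtain \<eta>' where \<eta>': "pathin Y \<eta>'" "\<eta>' 1 = y" "\<And>t. t \<in> {0..1} \<Longrightarrow> p (\<eta>' t) = g t"
      using covering_path_lift_end[OF p G(1) y(1)] y(2) G(3) by metis
    have "\<eta>' 0 \<in> topspace Y" "p (\<eta>' 0) = f 1"
      using path_start_in_topspace[OF \<eta>'(1)] \<eta>'(3)[of 0] G(2) F(3) by simp_all
    then obtain \<eta> where \<eta>: "pathin Y \<eta>" "\<eta> 1 = \<eta>' 0" "\<And>t. t \<in> {0..1} \<Longrightarrow> p (\<eta> t) = f t"
      using covering_path_lift_end[OF p F(1)] by metis
    have 1: "\<rho> b (l y) = l (\<eta>' 0)"
      using mon[OF b \<eta>'(1) fundamental_group_class_eq_on[OF b g]] \<eta>'(2,3) by simp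
    have 2: "\<rho> a (l (\<eta>' 0)) = l (\<eta> 0)"
      using mon[OF a \<eta>(1) fundamental_group_class_eq_on[OF a f]] \<eta>(2,3) by simp
    have "(p \<circ> path_concat \<eta> \<eta>') t = path_concat f g t" if "t \<in> {0..1}" for t
      unfolding path_concat_simps by (rule path_concat_eq_on[OF _ _ that]) (use \<eta>(3) \<eta>'(3) in auto)
    then have "p \<circ> path_concat \<eta> \<eta>' \<in> ?ab" by (rule fundamental_group_class_eq_on[OF ab(3,2)])
    from mon[OF ab(3) pathin_path_concat[OF \<eta>(1) \<eta>'(1) \<eta>(2)] this]
    have "\<rho> ?ab (l y) = l (\<eta> 0)" using \<eta>'(2) by simp
    then show ?thesis using 1 2 y(3) by simp
  next
    case False
    then show ?thesis using perm[OF a] perm[OF b] perm[OF ab(3)] by (simp add: permutes_def)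
  qed
  then show "\<rho> ?ab = \<rho> a \<otimes>\<^bsub>sym_group d\<^esub> \<rho> b" by (simp add: sym_group_mult fun_eq_iff)
qed (rule \<rho>)

text \<open>A homeomorphism \<open>f\<close> of the base turns the cover \<open>p\<close> into \<open>f \<circ> p\<close>.  Its monodromy is obtained by
  moving the base point along a path \<open>\<delta>\<close> from \<open>s\<close> to the preimage of \<open>s\<close>.\<close>

proposition monodromy_transport:
  assumes p: "covering_map Y p X" and Y': "homeomorphic_maps Y Y' k k'" and f: "homeomorphic_maps X X f g"
    and comm: "\<And>y. y \<in> topspace Y \<Longrightarrow> p' (k y) = f (p y)"
    and p': "covering_map Y' p' X"
    and X: "path_connected_space X" and s: "s \<in> topspace X"
    and l: "bij_betw l {y \<in> topspace Y. p y = s} A"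
    and mon: "\<And>c \<eta>. c \<in> carrier (fundamental_group X s) \<Longrightarrow> pathin Y \<eta> \<Longrightarrow> p \<circ> \<eta> \<in> c \<Longrightarrow> \<rho> c (l (\<eta> 1)) = l (\<eta> 0)"
  obtains l' \<rho>' where "bij_betw l' {y \<in> topspace Y'. p' y = s} A"
    "\<rho>' ` carrier (fundamental_group X s) \<subseteq> \<rho> ` carrier (fundamental_group X s)"
    "\<rho>' \<in> extensional (carrier (fundamental_group X s))"
    "\<And>c \<eta>. c \<in> carrier (fundamental_group X s) \<Longrightarrow> pathin Y' \<eta> \<Longrightarrow> p' \<circ> \<eta> \<in> c \<Longrightarrow> \<rho>' c (l' (\<eta> 1)) = (l' (\<eta> 0) :: nat)"
proof -
  let ?\<pi> = "carrier (fundamental_group X s)"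
  have contk': "continuous_map Y' Y k'" and kk': "\<And>z. z \<in> topspace Y' \<Longrightarrow> k (k' z) = z"
    and k'k: "\<And>y. y \<in> topspace Y \<Longrightarrow> k' (k y) = y" and contk: "continuous_map Y Y' k"
    using Y' by (auto simp: homeomorphic_maps_def)
  have contg: "continuous_map X X g" and gf: "\<And>x. x \<in> topspace X \<Longrightarrow> g (f x) = x"
    and fg: "\<And>x. x \<in> topspace X \<Longrightarrow> f (g x) = x"
    using f by (auto simp: homeomorphic_maps_def)
  have k't: "k' z \<in> topspace Y" if "z \<in> topspace Y'" for z
    using contk' that by (auto simp: continuous_map_def)
  have pt: "p y \<in> topspace X" if "y \<in> topspace Y" for y
    using covering_mapD(1)[OF p] that by (auto simp: continuous_map_def)
  have pk': "p (k' z) = g (p' z)" if z: "z \<in> topspace Y'" for z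
    using comm[OF k't[OF z]] kk'[OF z] gf[OF pt[OF k't[OF z]]] by simp
  have gs: "g s \<in> topspace X" using contg s by (auto simp: continuous_map_def)
  obtain \<delta> where \<delta>: "pathin X \<delta>" "\<delta> 0 = s" "\<delta> 1 = g s"
    using X s gs unfolding path_connected_space_def by blast
  define \<delta>r where "\<delta>r = (\<lambda>t. \<delta> (1 - t))"
  have \<delta>r: "pathin X \<delta>r" "\<delta>r 0 = g s" "\<delta>r 1 = s" using pathin_reverse[OF \<delta>(1)] \<delta>(2,3) by (simp_all add: \<delta>r_def)
  \<comment> \<open>The lift of \<open>\<delta>\<close> that ends at \<open>y\<close>. Its starting
    point moves the fiber over \<open>g s\<close> bijectively to the fiber over
    \<open>s\<close>.\<close>
  define \<Lambda> where "\<Lambda> = (\<lambda>y. SOME \<eta>. pathin Y \<eta> \<and> \<eta> 1 = y \<and> (\<forall>t\<in>{0..1}. p (\<eta> t) = \<delta> t))"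
  have \<Lambda>: "pathin Y (\<Lambda> y)" "\<Lambda> y 1 = y" "\<And>t. t \<in> {0..1} \<Longrightarrow> p (\<Lambda> y t) = \<delta> t" if y: "y \<in> topspace Y" "p y = g s" for y
  proof -
    have "\<exists>\<eta>. pathin Y \<eta> \<and> \<eta> 1 = y \<and> (\<forall>t\<in>{0..1}. p (\<eta> t) = \<delta> t)"
      using covering_path_lift_end[OF p \<delta>(1) y(1)] y(2) \<delta>(3) by metis
    from someI_ex[OF this]
    show "pathin Y (\<Lambda> y)" "\<Lambda> y 1 = y" "\<And>t. t \<in> {0..1} \<Longrightarrow> p (\<Lambda> y t) = \<delta> t" unfolding \<Lambda>_def by blast+
  qed
  have \<Lambda>0: "\<Lambda> y 0 \<in> {y \<in> topspace Y. p y = s}" if y: "y \<in> topspace Y" "p y = g s" for y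
    using path_start_in_topspace[OF \<Lambda>(1)[OF y]] \<Lambda>(3)[OF y, of 0] \<delta>(2) by simp
  have b1: "bij_betw (\<lambda>y. \<Lambda> y 0) {y \<in> topspace Y. p y = g s} {y \<in> topspace Y. p y = s}"
    unfolding bij_betw_def
  proof
    show "inj_on (\<lambda>y. \<Lambda> y 0) {y \<in> topspace Y. p y = g s}"
    proof (rule inj_onI)
      fix y z assume y: "y \<in> {y \<in> topspace Y. p y = g s}" and z: "z \<in> {y \<in> topspace Y. p y = g s}"
        and eq: "\<Lambda> y 0 = \<Lambda> z 0"
      have "\<Lambda> y 1 = \<Lambda> z 1"
        using covering_path_lift_unique[OF p, of "\<Lambda> y" "\<Lambda> z" 0 1] y z \<Lambda> eq by simp
      then show "y = z" using y z \<Lambda>(2) by simp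
    qed
    show "(\<lambda>y. \<Lambda> y 0) ` {y \<in> topspace Y. p y = g s} = {y \<in> topspace Y. p y = s}"
    proof
      show "(\<lambda>y. \<Lambda> y 0) ` {y \<in> topspace Y. p y = g s} \<subseteq> {y \<in> topspace Y. p y = s}" using \<Lambda>0 by blast
      show "{y \<in> topspace Y. p y = s} \<subseteq> (\<lambda>y. \<Lambda> y 0) ` {y \<in> topspace Y. p y = g s}"
      proof
        fix w assume w: "w \<in> {y \<in> topspace Y. p y = s}"
        then obtain \<eta> where \<eta>: "pathin Y \<eta>" "\<eta> 0 = w" "\<And>t. t \<in> {0..1} \<Longrightarrow> p (\<eta> t) = \<delta> t"
          using covering_path_lift[OF p \<delta>(1), of w] \<delta>(2) by auto
        have y: "\<eta> 1 \<in> topspace Y" "p (\<eta> 1) = g s" using path_finish_in_topspace[OF \<eta>(1)] \<eta>(3)[of 1] \<delta>(3) by simp_all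
        have "\<Lambda> (\<eta> 1) 0 = \<eta> 0"
          using covering_path_lift_unique[OF p \<Lambda>(1)[OF y] \<eta>(1), of 1 0] \<Lambda>(2,3)[OF y] \<eta>(3) by simp
        then show "w \<in> (\<lambda>y. \<Lambda> y 0) ` {y \<in> topspace Y. p y = g s}" using \<eta>(2) y by (metis (mono_tags, lifting) imageI mem_Collect_eq)
      qed
    qed
  qed
  have p's_iff: "p (k' z) = g s \<longleftrightarrow> p' z = s" if z: "z \<in> topspace Y'" for z
  proof -
    have "p' z \<in> topspace X" using covering_mapD(1)[OF p'] z by (auto simp: continuous_map_def)
    then show ?thesis using pk'[OF z] fg s by metis
  qed
  have b2: "bij_betw k' {z \<in> topspace Y'. p' z = s} {y \<in> topspace Y. p y = g s}"
  proof (rule bij_betw_byWitness[where f' = k])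
    show "k' ` {z \<in> topspace Y'. p' z = s} \<subseteq> {y \<in> topspace Y. p y = g s}" using k't p's_iff by auto
    show "k ` {y \<in> topspace Y. p y = g s} \<subseteq> {z \<in> topspace Y'. p' z = s}"
      using contk comm fg[OF s] by (auto simp: continuous_map_def)
  qed (use kk' k'k in auto)
  \<comment> \<open>A point over \<open>s\<close> in the new cover goes back under \<open>k'\<close>
    to the fiber over \<open>g s\<close>, then along the lift of \<open>\<delta>\<close> to the
    fiber over \<open>s\<close>, where it has an old label.\<close>
  define l' where "l' = (\<lambda>z. l (\<Lambda> (k' z) 0))"
  have "bij_betw (l \<circ> ((\<lambda>y. \<Lambda> y 0) \<circ> k')) {z \<in> topspace Y'. p' z = s} A"
    by (intro bij_betw_trans[OF bij_betw_trans[OF b2 b1] l])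
  then have bl': "bij_betw l' {z \<in> topspace Y'. p' z = s} A" by (simp add: l'_def o_def)
  \<comment> \<open>The loop \<open>g \<circ> \<gamma>\<close> is based at \<open>g s\<close>;
    running along \<open>\<delta>\<close> before it and back after it makes it a loop at
    \<open>s\<close>.\<close>
  define T where "T = (\<lambda>\<gamma>. path_concat \<delta> (path_concat (g \<circ> \<gamma>) \<delta>r))"
  have T: "path_homotopic X s s (T \<gamma>) (T \<gamma>')" if "path_homotopic X s s \<gamma> \<gamma>'" for \<gamma> \<gamma>'
    unfolding T_def
    by (intro path_homotopic_concat[of X s "g s"] path_homotopic_concat[of X "g s" "g s"] path_homotopic_compose[OF that contg]
          path_homotopic_eq) (use \<delta> \<delta>r in simp_all)
  \<comment> \<open>The operation on classes induced by \<open>T\<close>. The arbitrary choice of a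
    representative is harmless, since \<open>T\<close> respects homotopy.\<close>
  define K where "K = (\<lambda>c. {h. path_homotopic X s s (T (SOME \<gamma>. \<gamma> \<in> c)) h})"
  have K: "K c \<in> ?\<pi>" "T \<gamma> \<in> K c" if c: "c \<in> ?\<pi>" and \<gamma>: "\<gamma> \<in> c" for c \<gamma>
  proof -
    define \<gamma>0 where "\<gamma>0 = (SOME \<gamma>. \<gamma> \<in> c)"
    have \<gamma>0: "\<gamma>0 \<in> c" unfolding \<gamma>0_def by (rule someI[of "\<lambda>\<gamma>. \<gamma> \<in> c", OF \<gamma>])
    have h: "path_homotopic X s s \<gamma>0 \<gamma>" using fundamental_group_class(4)[OF c \<gamma>0] \<gamma> by blast
    show "K c \<in> ?\<pi>" unfolding K_def \<gamma>0_def[symmetric]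
      by (rule fundamental_group_carrierI) (use path_homotopicD[OF T[OF h]] in simp_all)
    show "T \<gamma> \<in> K c" unfolding K_def \<gamma>0_def[symmetric] using T[OF h] by simp
  qed
  \<comment> \<open>Every value of \<open>\<rho>'\<close> is a value of \<open>\<rho>\<close>; this
    keeps the monodromy in the given subgroup.\<close>
  define \<rho>' where "\<rho>' = restrict (\<lambda>c. \<rho> (K c)) ?\<pi>"
  have Kc: "K c \<in> ?\<pi>" if "c \<in> ?\<pi>" for c
    using fundamental_group_carrierE[OF that] K(1)[OF that] by metis
  have mon': "\<rho>' c (l' (\<eta> 1)) = l' (\<eta> 0)" if c: "c \<in> ?\<pi>" and \<eta>: "pathin Y' \<eta>" "p' \<circ> \<eta> \<in> c" for c \<eta>
  proof -
    note L = fundamental_group_class[OF c \<eta>(2)]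
    have \<eta>t: "\<eta> t \<in> topspace Y'" if "t \<in> {0..1}" for t using path_image_subset_topspace[OF \<eta>(1)] that by blast
    have pe: "p (k' (\<eta> t)) = g (p' (\<eta> t))" if "t \<in> {0..1}" for t using pk'[OF \<eta>t[OF that]] .
    have y0: "k' (\<eta> 0) \<in> topspace Y" "p (k' (\<eta> 0)) = g s" and y1: "k' (\<eta> 1) \<in> topspace Y" "p (k' (\<eta> 1)) = g s"
      using k't \<eta>t pe L(2,3) by simp_all
    define \<Lambda>r where "\<Lambda>r = (\<lambda>t. \<Lambda> (k' (\<eta> 1)) (1 - t))"
    have \<Lambda>r: "pathin Y \<Lambda>r" "\<Lambda>r 0 = k' (\<eta> 1)" "\<Lambda>r 1 = \<Lambda> (k' (\<eta> 1)) 0"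
      using pathin_reverse[OF \<Lambda>(1)[OF y1]] \<Lambda>(2)[OF y1] by (simp_all add: \<Lambda>r_def)
    \<comment> \<open>A lift through \<open>p\<close> of the loop
      \<open>T (p' \<circ> \<eta>)\<close>, whose end points have as old labels the new labels of
      the end points of \<open>\<eta>\<close>.\<close>
    define \<Theta> where "\<Theta> = path_concat (\<Lambda> (k' (\<eta> 0))) (path_concat (k' \<circ> \<eta>) \<Lambda>r)"
    have "pathin Y (path_concat (k' \<circ> \<eta>) \<Lambda>r)"
      using pathin_path_concat[OF pathin_compose[OF \<eta>(1) contk'] \<Lambda>r(1)] \<Lambda>r(2) by simp
    from pathin_path_concat[OF \<Lambda>(1)[OF y0] this] have "pathin Y \<Theta>"
      unfolding \<Theta>_def by (simp add: \<Lambda>(2)[OF y0])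
    moreover have "\<Theta> 0 = \<Lambda> (k' (\<eta> 0)) 0" "\<Theta> 1 = \<Lambda> (k' (\<eta> 1)) 0"
      by (simp_all add: \<Theta>_def \<Lambda>r(3))
    ultimately have \<Theta>: "pathin Y \<Theta>" "\<Theta> 0 = \<Lambda> (k' (\<eta> 0)) 0" "\<Theta> 1 = \<Lambda> (k' (\<eta> 1)) 0"
      by blast+
    have "(p \<circ> \<Theta>) t = T (p' \<circ> \<eta>) t" if t: "t \<in> {0..1}" for t
      unfolding \<Theta>_def T_def path_concat_simps
      by (intro path_concat_eq_on t)
         (use \<Lambda>(3)[OF y0] \<Lambda>(3)[OF y1] pe in \<open>simp_all add: \<Lambda>r_def \<delta>r_def\<close>)
    then have "p \<circ> \<Theta> \<in> K c" by (rule fundamental_group_class_eq_on[OF K[OF c \<eta>(2)]])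
    from mon[OF Kc[OF c] \<Theta>(1) this] show ?thesis
      using \<Theta>(2,3) c by (simp add: \<rho>'_def l'_def)
  qed
  have "\<rho>' ` ?\<pi> \<subseteq> \<rho> ` ?\<pi>" using Kc by (auto simp: \<rho>'_def)
  moreover have "\<rho>' \<in> extensional ?\<pi>" by (simp add: \<rho>'_def)
  ultimately show thesis using that bl' mon' by blast
qed

section \<open>Pullbacks of forms under covering maps\<close>

text \<open>Images under \<open>f\<close> of evenly covered sets are evenly covered, the sheets
  being the images under \<open>k\<close> of the old ones.\<close>

lemma covering_map_transport:
  assumes p: "covering_map Y p X" and k: "homeomorphic_maps Y Y' k k'" and f: "homeomorphic_map X X' f"
  shows "covering_map Y' (f \<circ> p \<circ> k') X'"
proof -
  have hk: "homeomorphic_map Y Y' k" and hk': "homeomorphic_map Y' Y k'"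
    and k'k: "\<And>y. y \<in> topspace Y \<Longrightarrow> k' (k y) = y" and kk': "\<And>z. z \<in> topspace Y' \<Longrightarrow> k (k' z) = z"
    using k by (auto simp: homeomorphic_maps_map)
  have k't: "k' z \<in> topspace Y" if "z \<in> topspace Y'" for z
    using homeomorphic_imp_surjective_map[OF hk'] that by blast
  have pt: "p y \<in> topspace X" if "y \<in> topspace Y" for y
    using covering_mapD(2)[OF p] that by blast
  have injf: "inj_on f (topspace X)" by (rule homeomorphic_imp_injective_map[OF f])
  show ?thesis
    unfolding covering_map_def
  proof (intro conjI ballI)
    show "continuous_map Y' X' (f \<circ> p \<circ> k')"
      by (rule continuous_map_compose[OF homeomorphic_imp_continuous_map[OF hk']
            continuous_map_compose[OF covering_mapD(1)[OF p] homeomorphic_imp_continuous_map[OF f]]])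
    show "(f \<circ> p \<circ> k') ` topspace Y' = topspace X'"
      using homeomorphic_imp_surjective_map[OF f] homeomorphic_imp_surjective_map[OF hk'] covering_mapD(2)[OF p]
      by (metis image_comp)
    fix x' assume "x' \<in> topspace X'"
    then obtain x where x: "x \<in> topspace X" "x' = f x" using homeomorphic_imp_surjective_map[OF f] by blast
    obtain U \<V> where e: "evenly_covered Y p X U \<V>" and U: "openin X U" "x \<in> U" using covering_mapD(3)[OF p x(1)] by blast
    have UX: "U \<subseteq> topspace X" using U openin_subset by blast
    have e1: "\<Union>\<V> = {y \<in> topspace Y. p y \<in> U}" and e2: "\<And>V. V \<in> \<V> \<Longrightarrow> openin Y V"
      and e3: "pairwise disjnt \<V>" and e4: "\<And>V. V \<in> \<V> \<Longrightarrow> homeomorphic_map (subtopology Y V) (subtopology X U) p"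
      using e by (auto simp: evenly_covered_def)
    have VY: "V \<subseteq> topspace Y" if "V \<in> \<V>" for V using e2[OF that] openin_subset by blast
    define \<V>' where "\<V>' = (\<lambda>V. k ` V) ` \<V>"
    show "\<exists>U'. openin X' U' \<and> x' \<in> U' \<and> (\<exists>\<V>'. \<Union>\<V>' = {z \<in> topspace Y'. (f \<circ> p \<circ> k') z \<in> U'} \<and>
        (\<forall>V\<in>\<V>'. openin Y' V) \<and> pairwise disjnt \<V>' \<and>
        (\<forall>V\<in>\<V>'. homeomorphic_map (subtopology Y' V) (subtopology X' U') (f \<circ> p \<circ> k')))"
    proof (intro exI[of _ "f ` U"] exI[of _ \<V>'] conjI ballI)
      show "openin X' (f ` U)" using homeomorphic_imp_open_map[OF f] U(1) by (simp add: open_map_def)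
      show "x' \<in> f ` U" using x U by simp
      show "\<Union>\<V>' = {z \<in> topspace Y'. (f \<circ> p \<circ> k') z \<in> f ` U}"
      proof
        show "\<Union>\<V>' \<subseteq> {z \<in> topspace Y'. (f \<circ> p \<circ> k') z \<in> f ` U}"
        proof
          fix z assume "z \<in> \<Union>\<V>'"
          then obtain V y where V: "V \<in> \<V>" "y \<in> V" "z = k y" by (auto simp: \<V>'_def)
          then have "y \<in> topspace Y" "p y \<in> U" using e1 by blast+
          then show "z \<in> {z \<in> topspace Y'. (f \<circ> p \<circ> k') z \<in> f ` U}"
            using V(3) k'k homeomorphic_imp_surjective_map[OF hk] by auto
        qed
        show "{z \<in> topspace Y'. (f \<circ> p \<circ> k') z \<in> f ` U} \<subseteq> \<Union>\<V>'"
        proof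
          fix z assume z: "z \<in> {z \<in> topspace Y'. (f \<circ> p \<circ> k') z \<in> f ` U}"
          then obtain u where "u \<in> U" "f (p (k' z)) = f u" by auto
          moreover have "p (k' z) \<in> topspace X" using pt k't z by simp
          ultimately have "p (k' z) \<in> U" using inj_onD[OF injf] subsetD[OF UX] by metis
          then have "k' z \<in> \<Union>\<V>" unfolding e1 using k't z by simp
          then obtain V where "V \<in> \<V>" "k' z \<in> V" by blast
          then have "k (k' z) \<in> \<Union>\<V>'" unfolding \<V>'_def by blast
          then show "z \<in> \<Union>\<V>'" using kk' z by simp
        qed
      qed
      show "pairwise disjnt \<V>'"
        unfolding pairwise_def
      proof (intro ballI impI)
        fix A B assume "A \<in> \<V>'" "B \<in> \<V>'" "A \<noteq> B"
        then obtain V W where VW: "V \<in> \<V>" "W \<in> \<V>" "A = k ` V" "B = k ` W" "V \<noteq> W" by (auto simp: \<V>'_def)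
        then have "V \<inter> W = {}" using e3 by (auto simp: pairwise_def disjnt_def)
        then have "k ` V \<inter> k ` W = {}"
          using inj_on_image_Int[OF homeomorphic_imp_injective_map[OF hk] VY[OF VW(1)] VY[OF VW(2)]] by simp
        then show "disjnt A B" using VW by (simp add: disjnt_def)
      qed
      fix V' assume "V' \<in> \<V>'"
      then obtain V where V: "V \<in> \<V>" "V' = k ` V" by (auto simp: \<V>'_def)
      show "openin Y' V'" using homeomorphic_imp_open_map[OF hk] e2[OF V(1)] V(2) by (simp add: open_map_def)
      have k'V: "k' ` k ` V = V" using VY[OF V(1)] k'k by (force simp: image_image)
      have kVY: "k ` V \<subseteq> topspace Y'" using VY[OF V(1)] homeomorphic_imp_surjective_map[OF hk] by blast
      have "homeomorphic_map (subtopology Y' V') (subtopology Y V) k'"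
        by (rule homeomorphic_map_subtopologies[OF hk']) (simp add: V(2) k'V inf.absorb2[OF kVY] inf.absorb2[OF VY[OF V(1)]])
      moreover have "homeomorphic_map (subtopology X U) (subtopology X' (f ` U)) f"
        using homeomorphic_imp_surjective_map[OF f] UX
        by (intro homeomorphic_map_subtopologies[OF f]) blast
      ultimately show "homeomorphic_map (subtopology Y' V') (subtopology X' (f ` U)) (f \<circ> p \<circ> k')"
        by (rule homeomorphic_map_compose[OF _ homeomorphic_map_compose[OF e4[OF V(1)]]])
    qed
  qed
qed

lemma covering_map_local_homeomorphism:
  assumes p: "covering_map Y p X" and N: "openin Y N" "y \<in> N"
  obtains W where "openin Y W" "y \<in> W" "W \<subseteq> N" "openin X (p ` W)"
    "homeomorphic_map (subtopology Y W) (subtopology X (p ` W)) p"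
proof -
  have y: "y \<in> topspace Y" using N openin_subset by blast
  then have "p y \<in> topspace X" using covering_mapD(2)[OF p] by blast
  then obtain U \<V> where e: "evenly_covered Y p X U \<V>" and U: "openin X U" "p y \<in> U" using covering_mapD(3)[OF p] by blast
  then obtain V where V: "V \<in> \<V>" "y \<in> V" using y unfolding evenly_covered_def by blast
  have oV: "openin Y V" and h: "homeomorphic_map (subtopology Y V) (subtopology X U) p"
    using e V unfolding evenly_covered_def by blast+
  have t: "topspace (subtopology Y V) = V" "topspace (subtopology X U) = U"
    using oV U openin_subset by fastforce+
  define W where "W = V \<inter> N"
  have W: "openin Y W" "y \<in> W" "W \<subseteq> N" "W \<subseteq> V" using oV N V(2) by (auto simp: W_def)
  have pWU: "p ` W \<subseteq> U" using homeomorphic_imp_surjective_map[OF h] t W(4) by blast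
  have "openin (subtopology Y V) W" using W(1,4) by (metis openin_subtopology_Int2 inf.absorb2)
  then have "openin (subtopology X U) (p ` W)" using homeomorphic_imp_open_map[OF h] by (simp add: open_map_def)
  then have oW: "openin X (p ` W)" using U(1) openin_trans_full by blast
  have "homeomorphic_map (subtopology (subtopology Y V) W) (subtopology (subtopology X U) (p ` W)) p"
    by (rule homeomorphic_map_subtopologies[OF h]) (simp only: t inf.absorb2[OF W(4)] inf.absorb2[OF pWU])
  then have "homeomorphic_map (subtopology Y W) (subtopology X (p ` W)) p"
    by (simp add: subtopology_subtopology inf.absorb2[OF W(4)] inf.absorb2[OF pWU])
  then show thesis using that W(1-3) oW by blast
qed

text \<open>A pair \<open>(W, \<psi>)\<close> does not record the chart of \<open>S\<close> that it
  comes from, so its coefficient is taken from one suitable chart fixed by choice; the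
  transformation rule of \<open>S\<close> makes any such choice consistent.\<close>

definition pullback_form :: "'a surface_form \<Rightarrow> 'b topology \<Rightarrow> ('b \<Rightarrow> 'a) \<Rightarrow> 'b surface_form" where
  "pullback_form S Y p =
     \<lparr>topo = Y,
      atlas = {(W, \<phi> \<circ> p) | W U \<phi>. (U, \<phi>) \<in> atlas S \<and> openin Y W \<and> p ` W \<subseteq> U \<and> openin (topo S) (p ` W) \<and>
        homeomorphic_map (subtopology Y W) (subtopology (topo S) (p ` W)) p},
      form = (\<lambda>(W, \<psi>). form S (SOME c. c \<in> atlas S \<and> p ` W \<subseteq> fst c \<and> \<psi> = snd c \<circ> p))\<rparr>"

lemma topo_pullback_form [simp]: "topo (pullback_form S Y p) = Y"
  by (simp add: pullback_form_def)

text \<open>The chart \<open>(U, \<phi>)\<close> obtained is the one selected by the choice in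
  \<open>form\<close>, not necessarily the one that put \<open>(W, \<psi>)\<close> into the
  atlas.\<close>

lemma pullback_chartE:
  assumes "(W, \<psi>) \<in> atlas (pullback_form S Y p)"
  obtains U \<phi> where "(U, \<phi>) \<in> atlas S" "openin Y W" "p ` W \<subseteq> U" "openin (topo S) (p ` W)"
    "homeomorphic_map (subtopology Y W) (subtopology (topo S) (p ` W)) p" "inj_on p W"
    "\<psi> = \<phi> \<circ> p" "form (pullback_form S Y p) (W, \<psi>) = form S (U, \<phi>)"
proof -
  obtain U0 \<phi>0 where 0: "(U0, \<phi>0) \<in> atlas S" "openin Y W" "p ` W \<subseteq> U0" "openin (topo S) (p ` W)"
    "homeomorphic_map (subtopology Y W) (subtopology (topo S) (p ` W)) p" "\<psi> = \<phi>0 \<circ> p"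
    using assms unfolding pullback_form_def by auto
  define P where "P = (\<lambda>c. c \<in> atlas S \<and> p ` W \<subseteq> fst c \<and> \<psi> = snd c \<circ> p)"
  define c where "c = (SOME c. P c)"
  have "P (U0, \<phi>0)" using 0 by (simp add: P_def)
  then have "P c" unfolding c_def by (rule someI[of P])
  moreover have "form (pullback_form S Y p) (W, \<psi>) = form S c"
    by (simp add: pullback_form_def c_def P_def)
  moreover have "inj_on p W"
    using homeomorphic_imp_injective_map[OF 0(5)] 0(2) openin_subset by (fastforce simp: inf.absorb2)
  moreover obtain U \<phi> where "c = (U, \<phi>)" by (cases c)
  ultimately show thesis using that[of U \<phi>] 0(2,4,5) by (simp add: P_def)
qed

lemma pullback_chart_inv:
  assumes S: "holomorphic_1form S" and U: "(U, \<phi>) \<in> atlas S" and W: "p ` W \<subseteq> U" "inj_on p W" and y: "y \<in> W"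
  shows "inv_into W (\<phi> \<circ> p) (\<phi> (p y)) = y" "inv_into U \<phi> (\<phi> (p y)) = p y" "inj_on (\<phi> \<circ> p) W"
proof -
  have inj: "inj_on \<phi> U" by (rule chart_onD(3)[OF holomorphic_1formD(1)[OF S U]])
  then show i: "inj_on (\<phi> \<circ> p) W" using comp_inj_on[OF W(2)] inj_on_subset W(1) by blast
  show "inv_into W (\<phi> \<circ> p) (\<phi> (p y)) = y" using inv_into_f_f[OF i y] by simp
  show "inv_into U \<phi> (\<phi> (p y)) = p y" using inv_into_f_f[OF inj] W(1) y by blast
qed

text \<open>In the coordinate \<open>\<psi> = \<phi> \<circ> p\<close> the projection becomes a
  transition map of \<open>S\<close>, so both claims are those of the atlas of
  \<open>S\<close>.\<close>

lemma pullback_coordinates: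
  assumes S: "holomorphic_1form S" and U1: "(U1, \<phi>1) \<in> atlas S" and W: "(W, \<psi>) \<in> atlas (pullback_form S Y p)"
  shows "(\<phi>1 \<circ> p \<circ> inv_into W \<psi>) holomorphic_on \<psi> ` {y \<in> W. p y \<in> U1}"
    "\<And>y. y \<in> W \<Longrightarrow> p y \<in> U1 \<Longrightarrow> form (pullback_form S Y p) (W, \<psi>) (\<psi> y) =
       form S (U1, \<phi>1) (\<phi>1 (p y)) * deriv (\<phi>1 \<circ> p \<circ> inv_into W \<psi>) (\<psi> y)"
proof -
  obtain U \<phi> where U: "(U, \<phi>) \<in> atlas S" "openin Y W" "p ` W \<subseteq> U" "openin (topo S) (p ` W)"
    "inj_on p W" "\<psi> = \<phi> \<circ> p" "form (pullback_form S Y p) (W, \<psi>) = form S (U, \<phi>)"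
    using pullback_chartE[OF W] by metis
  define T where "T = \<psi> ` {y \<in> W. p y \<in> U1}"
  have T_eq: "T = \<phi> ` (p ` W \<inter> U1)" by (auto simp: T_def U(6))
  have "openin (topo S) (p ` W \<inter> U1)"
    using U(4) chart_onD(1)[OF holomorphic_1formD(1)[OF S U1]] by blast
  then have oT: "open T"
    unfolding T_eq using chart_image_open[OF holomorphic_1formD(1)[OF S U(1)]] U(3) by blast
  have eq: "(\<phi>1 \<circ> p \<circ> inv_into W \<psi>) z = (\<phi>1 \<circ> inv_into U \<phi>) z" if zT: "z \<in> T" for z
  proof -
    obtain y where "y \<in> W" "z = \<phi> (p y)" using zT by (auto simp: T_def U(6))
    then show ?thesis using pullback_chart_inv[OF S U(1,3,5)] by (simp add: U(6))
  qed
  have h: "(\<phi>1 \<circ> inv_into U \<phi>) holomorphic_on T"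
    by (rule holomorphic_on_subset[OF holomorphic_1formD(4)[OF S U1 U(1)]]) (use U(3) in \<open>auto simp: T_eq\<close>)
  then have h': "(\<phi>1 \<circ> p \<circ> inv_into W \<psi>) holomorphic_on T"
    by (rule holomorphic_transform) (rule eq[symmetric])
  then show "(\<phi>1 \<circ> p \<circ> inv_into W \<psi>) holomorphic_on \<psi> ` {y \<in> W. p y \<in> U1}" by (simp only: T_def)
  fix y assume y: "y \<in> W" "p y \<in> U1"
  then have "\<psi> y \<in> T" by (auto simp: T_def)
  then have "deriv (\<phi>1 \<circ> p \<circ> inv_into W \<psi>) (\<psi> y) = deriv (\<phi>1 \<circ> inv_into U \<phi>) (\<psi> y)"
    using complex_derivative_transform_within_open[OF h' h oT] eq by blast
  moreover have "p y \<in> U" using y U(3) by blast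
  ultimately show "form (pullback_form S Y p) (W, \<psi>) (\<psi> y) =
       form S (U1, \<phi>1) (\<phi>1 (p y)) * deriv (\<phi>1 \<circ> p \<circ> inv_into W \<psi>) (\<psi> y)"
    using holomorphic_1formD(5)[OF S U1 U(1) y(2)] by (simp add: U(6) U(7)[unfolded U(6)])
qed

text \<open>A transition map between two charts upstairs is \<open>p\<close> read in the one chart
  and in the chart of \<open>S\<close> underlying the other, so it is already governed by
  \<open>pullback_coordinates\<close>.\<close>

lemma holomorphic_pullback_form:
  assumes S: "holomorphic_1form S" and p: "covering_map Y p (topo S)"
  shows "holomorphic_1form (pullback_form S Y p)"
proof -
  let ?P = "pullback_form S Y p"
  have chart: "chart_on Y (W, \<psi>)" and hol: "form ?P (W, \<psi>) holomorphic_on \<psi> ` W"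
    if "(W, \<psi>) \<in> atlas ?P" for W \<psi>
  proof -
    obtain U \<phi> where U: "(U, \<phi>) \<in> atlas S" "openin Y W" "p ` W \<subseteq> U" "openin (topo S) (p ` W)"
      "homeomorphic_map (subtopology Y W) (subtopology (topo S) (p ` W)) p"
      "\<psi> = \<phi> \<circ> p" "form ?P (W, \<psi>) = form S (U, \<phi>)"
      using pullback_chartE[OF \<open>(W, \<psi>) \<in> atlas ?P\<close>] by metis
    have c: "chart_on (topo S) (p ` W, \<phi>)"
      by (rule chart_on_restrict[OF holomorphic_1formD(1)[OF S U(1)] U(4,3)])
    have im: "\<psi> ` W = \<phi> ` p ` W" by (simp add: U(6) image_comp)
    have "homeomorphic_map (subtopology Y W) (top_of_set (\<psi> ` W)) \<psi>"
      using homeomorphic_map_compose[OF U(5) chart_onD(4)[OF c]] by (simp only: im[symmetric] U(6)[symmetric])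
    then show "chart_on Y (W, \<psi>)" using U(2) chart_onD(2)[OF c] by (simp add: chart_on_def im)
    show "form ?P (W, \<psi>) holomorphic_on \<psi> ` W"
      unfolding U(7) im by (rule holomorphic_on_subset[OF holomorphic_1formD(3)[OF S U(1)] image_mono[OF U(3)]])
  qed
  have trans: "(\<psi>1 \<circ> inv_into W2 \<psi>2) holomorphic_on \<psi>2 ` (W1 \<inter> W2) \<and>
      (\<forall>q\<in>W1 \<inter> W2. form ?P (W2, \<psi>2) (\<psi>2 q) = form ?P (W1, \<psi>1) (\<psi>1 q) * deriv (\<psi>1 \<circ> inv_into W2 \<psi>2) (\<psi>2 q))"
    if W1: "(W1, \<psi>1) \<in> atlas ?P" and W2: "(W2, \<psi>2) \<in> atlas ?P" for W1 \<psi>1 W2 \<psi>2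
  proof -
    obtain U \<phi> where U: "(U, \<phi>) \<in> atlas S" "p ` W1 \<subseteq> U" "\<psi>1 = \<phi> \<circ> p" "form ?P (W1, \<psi>1) = form S (U, \<phi>)"
      using pullback_chartE[OF W1] by metis
    have "\<psi>2 ` (W1 \<inter> W2) \<subseteq> \<psi>2 ` {y \<in> W2. p y \<in> U}" using U(2) by blast
    from holomorphic_on_subset[OF pullback_coordinates(1)[OF S U(1) W2] this] pullback_coordinates(2)[OF S U(1) W2]
    show ?thesis using U(2) by (auto simp: U(3) U(4)[unfolded U(3)])
  qed
  have "topspace Y \<subseteq> (\<Union>(W, \<psi>)\<in>atlas ?P. W)"
  proof
    fix y assume y: "y \<in> topspace Y"
    then have "p y \<in> topspace (topo S)" using covering_mapD(2)[OF p] by blast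
    then obtain U \<phi> where U: "(U, \<phi>) \<in> atlas S" "p y \<in> U" using atlas_chart_at[OF S] by metis
    have "openin Y {v \<in> topspace Y. p v \<in> U}"
      using covering_mapD(1)[OF p] chart_onD(1)[OF holomorphic_1formD(1)[OF S U(1)]] by (simp add: continuous_map_def)
    then obtain W where W: "openin Y W" "y \<in> W" "W \<subseteq> {v \<in> topspace Y. p v \<in> U}" "openin (topo S) (p ` W)"
      "homeomorphic_map (subtopology Y W) (subtopology (topo S) (p ` W)) p"
      using covering_map_local_homeomorphism[OF p, of "{v \<in> topspace Y. p v \<in> U}" y] y U(2) by auto
    then have "(W, \<phi> \<circ> p) \<in> atlas ?P" unfolding pullback_form_def using U(1) by auto
    then show "y \<in> (\<Union>(W, \<psi>)\<in>atlas ?P. W)" using W(2) by blast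
  qed
  moreover have "W \<subseteq> topspace Y" if "(W, \<psi>) \<in> atlas ?P" for W \<psi>
    by (rule openin_subset[OF chart_onD(1)[OF chart[OF that]]])
  then have "(\<Union>(W, \<psi>)\<in>atlas ?P. W) \<subseteq> topspace Y" by auto
  ultimately have top: "topspace Y = (\<Union>(W, \<psi>)\<in>atlas ?P. W)" by blast
  show ?thesis
    unfolding holomorphic_1form_def topo_pullback_form
  proof (intro conjI top)
    show "\<forall>c\<in>atlas ?P. chart_on Y c" by (clarify, rule chart)
    show "\<forall>(U, \<phi>)\<in>atlas ?P. form ?P (U, \<phi>) holomorphic_on \<phi> ` U" by (clarify, rule hol)
    show "\<forall>(U, \<phi>)\<in>atlas ?P. \<forall>(V, \<psi>)\<in>atlas ?P.
        (\<phi> \<circ> inv_into V \<psi>) holomorphic_on \<psi> ` (U \<inter> V) \<and>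
        (\<forall>q\<in>U \<inter> V. form ?P (V, \<psi>) (\<psi> q) = form ?P (U, \<phi>) (\<phi> q) * deriv (\<phi> \<circ> inv_into V \<psi>) (\<psi> q))"
      by (clarify, rule trans)
  qed
qed

lemma is_cover_pullback_form:
  assumes S: "holomorphic_1form S" and p: "covering_map Y p (topo S)"
    and "\<And>x. x \<in> topspace (topo S) \<Longrightarrow> finite {y \<in> topspace Y. p y = x} \<and> card {y \<in> topspace Y. p y = x} = d"
  shows "is_cover d S (pullback_form S Y p) p"
proof -
  have "(\<phi> \<circ> p \<circ> inv_into V \<psi>) holomorphic_on \<psi> ` {y \<in> V. p y \<in> U} \<and>
        (\<forall>y\<in>V. p y \<in> U \<longrightarrow> form (pullback_form S Y p) (V, \<psi>) (\<psi> y) =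
           form S (U, \<phi>) (\<phi> (p y)) * deriv (\<phi> \<circ> p \<circ> inv_into V \<psi>) (\<psi> y))"
    if "(U, \<phi>) \<in> atlas S" "(V, \<psi>) \<in> atlas (pullback_form S Y p)" for U \<phi> V \<psi>
    using pullback_coordinates[OF S that] by blast
  then have "\<forall>(U, \<phi>)\<in>atlas S. \<forall>(V, \<psi>)\<in>atlas (pullback_form S Y p).
      (\<phi> \<circ> p \<circ> inv_into V \<psi>) holomorphic_on \<psi> ` {y \<in> V. p y \<in> U} \<and>
      (\<forall>y\<in>V. p y \<in> U \<longrightarrow> form (pullback_form S Y p) (V, \<psi>) (\<psi> y) =
         form S (U, \<phi>) (\<phi> (p y)) * deriv (\<phi> \<circ> p \<circ> inv_into V \<psi>) (\<psi> y))"
    by clarify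
  moreover have "\<forall>x\<in>topspace (topo S). finite {y \<in> topspace Y. p y = x} \<and> card {y \<in> topspace Y. p y = x} = d"
    by (intro ballI assms(3))
  ultimately show ?thesis
    unfolding is_cover_def topo_pullback_form
    by (intro conjI holomorphic_pullback_form[OF S p] p)
qed

section \<open>Covers of translation surfaces\<close>

lemma is_coverD:
  assumes "is_cover d S M p"
  shows "holomorphic_1form M" "covering_map (topo M) p (topo S)"
    "x \<in> topspace (topo S) \<Longrightarrow> finite {y \<in> topspace (topo M). p y = x} \<and> card {y \<in> topspace (topo M). p y = x} = d"
  using assms unfolding is_cover_def by blast+

lemma is_cover_form_map:
  assumes S: "holomorphic_1form S" and c: "is_cover d S M p"
  shows "form_map S M p"
proof -
  have p: "covering_map (topo M) p (topo S)" by (rule is_coverD(2)[OF c])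
  have "\<exists>W. openin (topo M) W \<and> y \<in> W \<and> inj_on p W" if y: "y \<in> topspace (topo M)" for y
  proof -
    obtain W where W: "openin (topo M) W" "y \<in> W"
        "homeomorphic_map (subtopology (topo M) W) (subtopology (topo S) (p ` W)) p"
      using covering_map_local_homeomorphism[OF p openin_topspace y] by metis
    have "inj_on p W"
      using homeomorphic_imp_injective_map[OF W(3)] W(1) openin_subset by (fastforce simp: inf.absorb2)
    then show ?thesis using W by blast
  qed
  then show ?thesis
    unfolding form_map_def
    by (intro conjI S is_coverD(1)[OF c] covering_mapD(1)[OF p]
          c[unfolded is_cover_def, THEN conjunct2, THEN conjunct2, THEN conjunct2] ballI)
qed

lemma is_monodromyD:
  assumes "is_monodromy d S s M p l \<rho>"
  shows "bij_betw l {y \<in> topspace (topo M). p y = s} {1..d}"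
    "\<rho> \<in> hom (fundamental_group (topo S) s) (sym_group d)"
    "\<And>c \<eta>. c \<in> carrier (fundamental_group (topo S) s) \<Longrightarrow> pathin (topo M) \<eta> \<Longrightarrow> p \<circ> \<eta> \<in> c \<Longrightarrow> \<rho> c (l (\<eta> 1)) = l (\<eta> 0)"
    "c \<in> carrier (fundamental_group (topo S) s) \<Longrightarrow> \<rho> c permutes {1..d}"
  using assms unfolding is_monodromy_def by (auto simp: hom_def sym_group_carrier Pi_iff)

text \<open>The homeomorphism lies over the identity of \<open>S\<close>; deforming by
  \<open>mat 1\<close> merely brings this into the form of
  \<open>translation_iso_lift\<close>.\<close>

theorem same_monodromy_translation_equivalent:
  assumes S: "holomorphic_1form S" "connected_space (topo S)" and s: "s \<in> topspace (topo S)"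
    and M: "is_cover d S M p" "is_monodromy d S s M p l \<rho>"
    and M': "is_cover d S M' p'" "is_monodromy d S s M' p' l' \<rho>"
  shows "translation_equivalent (tstruct_of M) (tstruct_of M')"
proof -
  note m = is_monodromyD[OF M(2)] and m' = is_monodromyD[OF M'(2)]
  have inj: "inj (\<rho> c)" if "c \<in> carrier (fundamental_group (topo S) s)" for c
    using permutes_inj[OF m(4)[OF that]] .
  obtain k where k: "homeomorphic_map (topo M) (topo M') k" "\<And>y. y \<in> topspace (topo M) \<Longrightarrow> p' (k y) = p y"
    by (rule covers_same_monodromy_homeomorphic[where \<rho> = \<rho>,
          OF is_coverD(2)[OF M(1)] is_coverD(2)[OF M'(1)] path_connected_surface[OF S]
            locally_path_connected_surface[OF S(1)] s m(1) m'(1)])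
       (assumption | rule inj m(3) m'(3) that | blast)+
  have "translation_iso (deform (mat 1) (tstruct_of M)) (tstruct_of M') k"
    by (rule translation_iso_lift[where f = id,
          OF is_cover_form_map[OF S(1) M(1)] is_cover_form_map[OF S(1) M'(1)] k(1)])
       (simp_all only: deform_1 translation_iso_id[OF S(1)] k(2) id_apply)
  then show ?thesis using translation_equivalent_iff_iso by (metis deform_1)
qed

text \<open>The labels of the fibers embed the total space into \<open>'a \<times> nat\<close>.\<close>

theorem deformed_cover_equivalent_cover:
  fixes S :: "'a surface_form" and M :: "'b surface_form"
  assumes S: "holomorphic_1form S" "connected_space (topo S)" and s: "s \<in> topspace (topo S)"
    and M: "is_cover d S M p" "is_monodromy d S s M p l \<rho>"
    and f: "translation_iso (deform A (tstruct_of S)) (tstruct_of S) f"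
  obtains M' :: "('a \<times> nat) surface_form" and p' l' \<rho>'
  where "is_cover d S M' p'" "is_monodromy d S s M' p' l' \<rho>'"
    "\<rho>' ` carrier (fundamental_group (topo S) s) \<subseteq> \<rho> ` carrier (fundamental_group (topo S) s)"
    "\<rho>' \<in> extensional (carrier (fundamental_group (topo S) s))"
    "translation_equivalent (deform A (tstruct_of M)) (tstruct_of M')"
proof -
  let ?X = "topo S" and ?Y = "topo M"
  let ?F = "\<lambda>x. {y \<in> topspace ?Y. p y = x}"
  have p: "covering_map ?Y p ?X" by (rule is_coverD(2)[OF M(1)])
  have "\<exists>b. bij_betw b (?F x) {1..d}" if "x \<in> topspace ?X" for x
    using is_coverD(3)[OF M(1) that] finite_same_card_bij[of "?F x" "{1..d}"] by simp
  then obtain b where b: "\<And>x. x \<in> topspace ?X \<Longrightarrow> bij_betw (b x) (?F x) {1..d}" by metis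
  \<comment> \<open>The numbering \<open>b x\<close> of the fiber over \<open>x\<close> is arbitrary
    and need not vary continuously; it only makes \<open>e\<close> injective.\<close>
  define e :: "'b \<Rightarrow> 'a \<times> nat" where "e = (\<lambda>y. (p y, b (p y) y))"
  have "inj_on e (topspace ?Y)"
  proof (rule inj_onI)
    fix y z assume y: "y \<in> topspace ?Y" and z: "z \<in> topspace ?Y" and eq: "e y = e z"
    have "p y \<in> topspace ?X" using covering_mapD(2)[OF p] y by blast
    then have "inj_on (b (p y)) (?F (p y))" using b bij_betw_imp_inj_on by blast
    moreover have pq: "p y = p z \<and> b (p y) y = b (p z) z" using eq unfolding e_def prod.inject .
    note pp = pq[THEN conjunct1]
    have "b (p y) y = b (p y) z" using pq[THEN conjunct2] unfolding pp[symmetric] .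
    ultimately show "y = z" using y z pp inj_onD[of "b (p y)" "?F (p y)" y z] by simp
  qed
  define k' where "k' = inv_into (topspace ?Y) e"
  have k'e: "k' (e y) = y" if "y \<in> topspace ?Y" for y
    unfolding k'_def by (rule inv_into_f_f[OF \<open>inj_on e (topspace ?Y)\<close> that])
  \<comment> \<open>The topology of \<open>M\<close> carried over to the image of \<open>e\<close>,
    so that \<open>e\<close> becomes a homeomorphism.\<close>
  define Y' where "Y' = pullback_topology (e ` topspace ?Y) k' ?Y"
  have tY': "topspace Y' = e ` topspace ?Y" unfolding Y'_def topspace_pullback_topology using k'e by auto
  have k: "homeomorphic_maps ?Y Y' e k'"
    unfolding homeomorphic_maps_def
  proof (intro conjI ballI)
    show "continuous_map ?Y Y' e"
      unfolding continuous_map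
    proof (intro conjI allI impI)
      fix U assume "openin Y' U"
      then obtain V where V: "openin ?Y V" "U = k' -` V \<inter> e ` topspace ?Y"
        by (auto simp: Y'_def openin_pullback_topology)
      have "e y \<in> U \<longleftrightarrow> y \<in> V" if "y \<in> topspace ?Y" for y
        using that k'e[OF that] unfolding V(2) by simp
      then have "{y \<in> topspace ?Y. e y \<in> U} = V" using openin_subset[OF V(1)] by blast
      then show "openin ?Y {y \<in> topspace ?Y. e y \<in> U}" using V(1) by simp
    qed (simp add: tY')
    show "continuous_map Y' ?Y k'"
      unfolding continuous_map
    proof (intro conjI allI impI)
      show "k' ` topspace Y' \<subseteq> topspace ?Y" using tY' k'e by auto
      fix U assume "openin ?Y U"
      moreover have "{z \<in> topspace Y'. k' z \<in> U} = k' -` U \<inter> e ` topspace ?Y" by (auto simp: tY')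
      ultimately show "openin Y' {z \<in> topspace Y'. k' z \<in> U}" by (auto simp: Y'_def openin_pullback_topology)
    qed
  qed (use k'e tY' in auto)
  have homf: "homeomorphic_map ?X ?X f" using translation_isoD(1)[OF f] by simp
  then obtain g where g: "homeomorphic_maps ?X ?X f g" using homeomorphic_map_maps by blast
  \<comment> \<open>Inserting \<open>f\<close> makes \<open>p'\<close> a projection to the
    undeformed \<open>S\<close>; the pullback of its form along \<open>p'\<close> supplies the new
    complex structure.\<close>
  define p' where "p' = f \<circ> p \<circ> k'"
  have p': "covering_map Y' p' ?X" unfolding p'_def by (rule covering_map_transport[OF p k homf])
  have comm: "p' (e y) = f (p y)" if "y \<in> topspace ?Y" for y using k'e[OF that] by (simp add: p'_def)
  have "finite {z \<in> topspace Y'. p' z = x} \<and> card {z \<in> topspace Y'. p' z = x} = d" if x: "x \<in> topspace ?X" for x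
  proof -
    have gx: "g x \<in> topspace ?X" using g x by (auto simp: homeomorphic_maps_def continuous_map_def)
    have iff: "f (p y) = x \<longleftrightarrow> p y = g x" if "y \<in> topspace ?Y" for y
    proof -
      have "p y \<in> topspace ?X" using covering_mapD(2)[OF p] that by blast
      then show ?thesis using g x by (auto simp: homeomorphic_maps_def)
    qed
    have "{z \<in> topspace Y'. p' z = x} = e ` {y \<in> topspace ?Y. p' (e y) = x}" unfolding tY' by blast
    also have "{y \<in> topspace ?Y. p' (e y) = x} = ?F (g x)" by (rule Collect_cong) (metis comm iff)
    finally have "{z \<in> topspace Y'. p' z = x} = e ` ?F (g x)" .
    moreover have "inj_on e (?F (g x))" by (rule inj_on_subset[OF \<open>inj_on e (topspace ?Y)\<close>]) blast
    ultimately show ?thesis using is_coverD(3)[OF M(1) gx] by (simp add: card_image)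
  qed
  then have cov: "is_cover d S (pullback_form S Y' p') p'" by (rule is_cover_pullback_form[OF S(1) p'])
  note m = is_monodromyD[OF M(2)]
  obtain l' \<rho>' where l': "bij_betw l' {z \<in> topspace Y'. p' z = s} {1..d}"
      and \<rho>': "\<rho>' ` carrier (fundamental_group ?X s) \<subseteq> \<rho> ` carrier (fundamental_group ?X s)"
      "\<rho>' \<in> extensional (carrier (fundamental_group ?X s))"
      "\<And>c \<eta>. c \<in> carrier (fundamental_group ?X s) \<Longrightarrow> pathin Y' \<eta> \<Longrightarrow> p' \<circ> \<eta> \<in> c \<Longrightarrow> \<rho>' c (l' (\<eta> 1)) = l' (\<eta> 0)"
  proof (rule monodromy_transport[where \<rho> = \<rho>, OF p k g _ p' path_connected_surface[OF S] s m(1)])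
    show "p' (e y) = f (p y)" if "y \<in> topspace ?Y" for y by (rule comm[OF that])
    show "\<rho> c (l (\<eta> 1)) = l (\<eta> 0)"
      if "c \<in> carrier (fundamental_group ?X s)" "pathin ?Y \<eta>" "p \<circ> \<eta> \<in> c" for c \<eta>
      by (rule m(3)[OF that])
  qed (rule that)
  have \<rho>'_sym: "\<rho>' c \<in> carrier (sym_group d)" if "c \<in> carrier (fundamental_group ?X s)" for c
  proof -
    have "\<rho>' c \<in> \<rho> ` carrier (fundamental_group ?X s)" using \<rho>'(1) that by blast
    then show ?thesis using m(4) by (auto simp only: sym_group_carrier)
  qed
  have "\<rho>' \<in> hom (fundamental_group ?X s) (sym_group d)"
    by (rule monodromy_hom[OF p' l']) (erule \<rho>'_sym, rule \<rho>'(3))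
  then have "is_monodromy d S s (pullback_form S Y' p') p' l' \<rho>'"
    unfolding is_monodromy_def topo_pullback_form using l' by (intro conjI ballI allI impI; (elim conjE)?) (assumption | rule \<rho>'(3))+
  moreover have "translation_iso (deform A (tstruct_of M)) (tstruct_of (pullback_form S Y' p')) e"
    by (rule translation_iso_lift[OF is_cover_form_map[OF S(1) M(1)] is_cover_form_map[OF S(1) cov] _ f comm])
       (use homeomorphic_maps_imp_map[OF k] in simp_all)
  then have "translation_equivalent (deform A (tstruct_of M)) (tstruct_of (pullback_form S Y' p'))"
    using translation_equivalent_iff_iso by blast
  ultimately show thesis using that[OF cov] \<rho>'(1,2) by blast
qed

section \<open>The spaces of deformations\<close>

lemma topspace_quotient_topology: "topspace (quotient_topology X f) = f ` topspace X"
proof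
  have "openin (quotient_topology X f) (f ` topspace X)"
    unfolding openin_quotient_topology by (auto intro!: back_subst[of "openin X", OF openin_topspace])
  then show "f ` topspace X \<subseteq> topspace (quotient_topology X f)" by (rule openin_subset)
  show "topspace (quotient_topology X f) \<subseteq> f ` topspace X"
    using openin_topspace[of "quotient_topology X f"] unfolding openin_quotient_topology by blast
qed

lemma continuous_map_quotient_topology: "continuous_map X (quotient_topology X f) f"
  unfolding continuous_map topspace_quotient_topology openin_quotient_topology by blast

section \<open>The matrix group and the projection to the orbit\<close>

lemma SL_pm_mult: "A \<in> SL_pm \<Longrightarrow> B \<in> SL_pm \<Longrightarrow> A ** B \<in> SL_pm"
  by (auto simp: SL_pm_def det_mul)

lemma SL_pm_inverse:
  assumes "A \<in> SL_pm"
  shows "A ** matrix_inv A = mat 1" "matrix_inv A ** A = mat 1" "matrix_inv A \<in> SL_pm"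
proof -
  have "invertible A" using assms by (auto simp: invertible_det_nz SL_pm_def)
  then have "A ** matrix_inv A = mat 1 \<and> matrix_inv A ** A = mat 1"
    unfolding matrix_inv_def invertible_def by (rule someI_ex)
  then show 1: "A ** matrix_inv A = mat 1" and "matrix_inv A ** A = mat 1" by blast+
  have "det A * det (matrix_inv A) = 1" using 1 by (metis det_I det_mul)
  then show "matrix_inv A \<in> SL_pm" using assms by (auto simp: SL_pm_def)
qed

lemma continuous_on_matrix_mult_right: "continuous_on X (\<lambda>A :: real^2^2. A ** B)"
  unfolding matrix_matrix_mult_def by (intro continuous_intros)

lemma translation_equivalent_refl:
  "holomorphic_1form M \<Longrightarrow> translation_equivalent (deform A (tstruct_of M)) (deform A (tstruct_of M))"
  using translation_iso_deform[OF translation_iso_id] by (auto simp: translation_equivalent_iff_iso)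

lemma tclass_eq:
  fixes T :: "'c tstruct set"
  assumes "translation_equivalent F F'" "charted F" "charted F'"
  shows "tclass T F = tclass T F'"
proof -
  have "translation_equivalent F X \<longleftrightarrow> translation_equivalent F' X" for X :: "'c tstruct"
    using translation_equivalent_trans[OF assms(1) _ assms(2,3), of X]
      translation_equivalent_trans[OF translation_equivalent_sym[OF assms] _ assms(3,2), of X] by blast
  then show ?thesis by (simp add: tclass_def)
qed

text \<open>As the fibres of \<open>SL_pm\<close> over the orbit are cosets of the Veech group, the projection is open;
  hence convergent sequences in the orbit space lift.\<close>

lemma orbit_space_open_projection:
  assumes S: "holomorphic_1form S" and U: "openin (top_of_set SL_pm) U"
  shows "openin (orbit_space S) ((\<lambda>A. tclass (orbit S) (deform A (tstruct_of S))) ` U)"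
proof -
  let ?T = "tstruct_of S"
  define \<pi> where "\<pi> = (\<lambda>A. tclass (orbit S) (deform A ?T))"
  have ch: "charted (deform A ?T)" for A using charted_deform charted_tstruct_of[OF S] by blast
  have \<pi>I: "\<pi> A = \<pi> B" if "translation_equivalent (deform A ?T) (deform B ?T)" for A B
    unfolding \<pi>_def by (rule tclass_eq[OF that ch ch])
  have \<pi>D: "translation_equivalent (deform A ?T) (deform B ?T)" if "\<pi> A = \<pi> B" "B \<in> SL_pm" for A B
  proof -
    have "deform B ?T \<in> \<pi> B"
      using that(2) translation_equivalent_refl[OF S] by (auto simp: \<pi>_def tclass_def orbit_def)
    then show ?thesis using that(1) by (auto simp: \<pi>_def tclass_def)
  qed
  have USL: "U \<subseteq> SL_pm" using U openin_subset by fastforce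
  have "openin (top_of_set SL_pm) {A \<in> SL_pm. \<pi> A \<in> \<pi> ` U}"
  proof (subst openin_subopen, intro ballI)
    fix A assume "A \<in> {A \<in> SL_pm. \<pi> A \<in> \<pi> ` U}"
    then obtain B where A: "A \<in> SL_pm" and B: "B \<in> U" "\<pi> A = \<pi> B" by auto
    have BSL: "B \<in> SL_pm" using B USL by blast
    have eq: "translation_equivalent (deform A ?T) (deform B ?T)" by (rule \<pi>D[OF B(2) BSL])
    \<comment> \<open>Here \<open>A = B ** h\<close> with \<open>h\<close> in the Veech group and
      inverse \<open>k\<close>, so right multiplication by \<open>k\<close> moves \<open>A\<close>
      to the point \<open>B\<close> of \<open>U\<close>.\<close>
    define h where "h = matrix_inv B ** A"
    define k where "k = matrix_inv A ** B"
    have hk: "k ** h = mat 1" "A ** k = B"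
      by (simp_all add: h_def k_def matrix_mul_assoc SL_pm_inverse[OF BSL] SL_pm_inverse[OF A]
          matrix_mul_assoc[of _ B] flip: matrix_mul_assoc[of _ B])
    have kSL: "k \<in> SL_pm" unfolding k_def by (intro SL_pm_mult SL_pm_inverse A BSL)
    have hT: "translation_equivalent (deform h ?T) ?T"
      using translation_equivalent_deform[OF eq, of "matrix_inv B"]
      by (simp add: deform_deform h_def SL_pm_inverse[OF BSL] deform_1)
    \<comment> \<open>The translate of \<open>U\<close> by \<open>h\<close> on the right. Each
      \<open>A'\<close> in it is \<open>(A' ** k) ** h\<close>, hence has the same class as the
      element \<open>A' ** k\<close> of \<open>U\<close>.\<close>
    define N where "N = {A' \<in> SL_pm. A' ** k \<in> U}"
    have "openin (top_of_set SL_pm) N"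
    proof -
      have "continuous_map (top_of_set SL_pm) (top_of_set SL_pm) (\<lambda>A. A ** k)"
        using continuous_on_matrix_mult_right SL_pm_mult[OF _ kSL] by auto
      then show ?thesis using U unfolding N_def continuous_map_def by simp
    qed
    have "A \<in> N" using A hk(2) B(1) by (simp add: N_def)
    moreover have "N \<subseteq> {A \<in> SL_pm. \<pi> A \<in> \<pi> ` U}"
    proof
      fix A' assume A': "A' \<in> N"
      have "A' ** k ** h = A'" using hk(1) by (simp flip: matrix_mul_assoc)
      then have "translation_equivalent (deform A' ?T) (deform (A' ** k) ?T)"
        using translation_equivalent_deform[OF hT, of "A' ** k"] by (simp add: deform_deform)
      then show "A' \<in> {A \<in> SL_pm. \<pi> A \<in> \<pi> ` U}" using \<pi>I A' by (auto simp: N_def)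
    qed
    ultimately show "\<exists>N. openin (top_of_set SL_pm) N \<and> A \<in> N \<and> N \<subseteq> {A \<in> SL_pm. \<pi> A \<in> \<pi> ` U}"
      using \<open>openin (top_of_set SL_pm) N\<close> by blast
  qed
  then show ?thesis
    unfolding orbit_space_def openin_quotient_topology \<pi>_def[symmetric] using USL by auto
qed

text \<open>A matrix \<open>A0\<close> over the limit exists by surjectivity of the projection. As
  the projection is open, the images of balls about \<open>A0\<close> with radii
  \<open>1 / (k + 1)\<close> are neighbourhoods of the limit, so late points of the trajectory have
  representatives in these balls.\<close>

lemma nondivergent_lift:
  assumes S: "holomorphic_1form S" and nd: "nondivergent S"
  obtains t :: "nat \<Rightarrow> real" and A A0 where "filterlim t at_top sequentially" "\<And>n. A n \<in> SL_pm" "A0 \<in> SL_pm"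
    "A \<longlonglongrightarrow> A0"
    "\<And>n. translation_equivalent (deform (teich_flow (t n)) (tstruct_of S)) (deform (A n) (tstruct_of S))"
proof -
  let ?T = "tstruct_of S"
  define \<pi> where "\<pi> = (\<lambda>A. tclass (orbit S) (deform A ?T))"
  obtain t :: "nat \<Rightarrow> real" and L where t: "filterlim t at_top sequentially"
    and L: "limitin (orbit_space S) (\<lambda>n. \<pi> (teich_flow (t n))) L sequentially"
    using nd unfolding nondivergent_def \<pi>_def by blast
  have "L \<in> \<pi> ` SL_pm"
    using limitin_topspace[OF L] by (simp add: orbit_space_def topspace_quotient_topology \<pi>_def)
  then obtain A0 where A0: "A0 \<in> SL_pm" "L = \<pi> A0" by blast
  have "\<exists>n A. k \<le> n \<and> A \<in> SL_pm \<and> dist A0 A < inverse (real (Suc k)) \<and> \<pi> (teich_flow (t n)) = \<pi> A" for k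
  proof -
    define U where "U = SL_pm \<inter> ball A0 (inverse (real (Suc k)))"
    have "openin (top_of_set SL_pm) U" unfolding U_def by (rule openin_open_Int) simp
    then have "openin (orbit_space S) (\<pi> ` U)" unfolding \<pi>_def by (rule orbit_space_open_projection[OF S])
    moreover have "A0 \<in> U" using A0(1) by (simp add: U_def)
    ultimately have "\<forall>\<^sub>F n in sequentially. \<pi> (teich_flow (t n)) \<in> \<pi> ` U"
      using L A0(2) unfolding limitin_def by blast
    then obtain N where "\<And>n. n \<ge> N \<Longrightarrow> \<pi> (teich_flow (t n)) \<in> \<pi> ` U" unfolding eventually_sequentially by blast
    \<comment> \<open>The index must exceed \<open>N\<close> for the trajectory to be in the
      neighbourhood and \<open>k\<close> for the selected times to tend to infinity.\<close>
    then obtain A where "A \<in> U" "\<pi> (teich_flow (t (max N k))) = \<pi> A" by (metis imageE max.cobounded1)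
    then show ?thesis unfolding U_def by (intro exI[of _ "max N k"] exI[of _ A]) simp
  qed
  then obtain n A where nA: "\<And>k. k \<le> n k" "\<And>k. A k \<in> SL_pm" "\<And>k. dist A0 (A k) < inverse (real (Suc k))"
    "\<And>k. \<pi> (teich_flow (t (n k))) = \<pi> (A k)" by metis
  have "filterlim n at_top sequentially"
    by (rule filterlim_at_top_mono[OF filterlim_ident]) (simp add: nA(1))
  then have "filterlim (\<lambda>k. t (n k)) at_top sequentially" by (rule filterlim_compose[OF t])
  moreover have "A \<longlonglongrightarrow> A0"
  proof (rule tendsto_dist_iff[THEN iffD2])
    show "(\<lambda>k. dist (A k) A0) \<longlonglongrightarrow> 0"
      by (rule tendsto_sandwich[OF _ _ tendsto_const LIMSEQ_inverse_real_of_nat])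
         (use nA(3) in \<open>auto simp: dist_commute intro!: always_eventually less_imp_le\<close>)
  qed
  moreover have "translation_equivalent (deform (teich_flow (t (n k))) ?T) (deform (A k) ?T)" for k
  proof -
    have "deform (A k) ?T \<in> \<pi> (A k)"
      using nA(2) translation_equivalent_refl[OF S] by (auto simp: \<pi>_def tclass_def orbit_def)
    then show ?thesis using nA(4) by (auto simp: \<pi>_def tclass_def)
  qed
  ultimately show thesis using that nA(2) A0(1) by blast
qed

section \<open>Compactness of the space of monodromy homomorphisms\<close>

text \<open>Coding the finite set \<open>G\<close> by natural numbers turns the values into bounded
  reals, for which the diagonal argument gives a pointwise convergent subsequence; integers at
  distance below 1 are equal.\<close>

lemma pointwise_eventually_constant_subsequence:
  fixes \<rho> :: "nat \<Rightarrow> 'a \<Rightarrow> 'b"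
  assumes "countable C" "finite G" and \<rho>: "\<And>n x. x \<in> C \<Longrightarrow> \<rho> n x \<in> G"
  obtains r where "strict_mono (r :: nat \<Rightarrow> nat)"
    "\<And>x. x \<in> C \<Longrightarrow> \<exists>v\<in>G. \<forall>\<^sub>F n in sequentially. \<rho> (r n) x = v"
proof -
  let ?c = "to_nat_on G"
  define f where "f = (\<lambda>n x. real (?c (\<rho> n x)))"
  have inj: "inj_on ?c G" by (rule inj_on_to_nat_on[OF countable_finite[OF assms(2)]])
  have "norm (f n x) \<le> real (Max (?c ` G))" if "x \<in> C" for n x
    using \<rho>[OF that] assms(2) by (simp add: f_def)
  then obtain r where r: "strict_mono r" "\<And>x. x \<in> C \<Longrightarrow> \<exists>l. (\<lambda>n. f (r n) x) \<longlonglongrightarrow> l"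
    using function_convergent_subsequence[OF assms(1), of f] by metis
  show thesis
  proof (rule that[OF r(1)])
    fix x assume x: "x \<in> C"
    then have "Cauchy (\<lambda>n. f (r n) x)" using r(2) convergent_Cauchy convergent_def by blast
    then obtain N where N: "\<And>m n. m \<ge> N \<Longrightarrow> n \<ge> N \<Longrightarrow> dist (f (r m) x) (f (r n) x) < 1"
      unfolding Cauchy_def by (metis zero_less_one)
    have "\<rho> (r n) x = \<rho> (r N) x" if "n \<ge> N" for n
    proof -
      have "?c (\<rho> (r n) x) = ?c (\<rho> (r N) x)" using N[of n N] that by (simp add: f_def dist_real_def)
      then show ?thesis using inj_onD[OF inj] \<rho>[OF x] by blast
    qed
    then have "\<forall>\<^sub>F n in sequentially. \<rho> (r n) x = \<rho> (r N) x" unfolding eventually_sequentially by blast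
    then show "\<exists>v\<in>G. \<forall>\<^sub>F n in sequentially. \<rho> (r n) x = v" using \<rho>[OF x] by blast
  qed
qed

text \<open>Values are eventually constant at each of countably many classes. A single
  multiplicativity equation involves three classes, so it holds for the limit because it holds for
  one late index.\<close>

lemma hom_space_convergent_subsequence:
  assumes S: "holomorphic_1form S" "second_countable (topo S)" and G: "subgroup G (sym_group d)"
    and \<rho>: "\<And>n. \<rho> n \<in> topspace (hom_space d G S s)"
  obtains r \<rho>0 where "strict_mono (r :: nat \<Rightarrow> nat)" "limitin (hom_space d G S s) (\<lambda>n. \<rho> (r n)) \<rho>0 sequentially"
proof -
  let ?\<Pi> = "fundamental_group (topo S) s"
  let ?C = "carrier ?\<Pi>" and ?H = "hom ?\<Pi> ((sym_group d)\<lparr>carrier := G\<rparr>)"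
  have top: "topspace (hom_space d G S s) = PiE ?C (\<lambda>_. G) \<inter> ?H"
    by (simp add: hom_space_def)
  have "G \<subseteq> {q. q permutes {1..d}}" using subgroup.subset[OF G] sym_group_carrier by blast
  then have finG: "finite G" using finite_permutations[of "{1..d}"] finite_subset by blast
  have \<rho>P: "\<rho> n \<in> PiE ?C (\<lambda>_. G)" and \<rho>H: "\<rho> n \<in> ?H" for n using \<rho>[of n] unfolding top by blast+
  have \<rho>G: "\<rho> n c \<in> G" if "c \<in> ?C" for n c by (rule PiE_mem[OF \<rho>P that])
  have \<rho>hom: "\<rho> n (a \<otimes>\<^bsub>?\<Pi>\<^esub> b) = \<rho> n a \<circ> \<rho> n b" if "a \<in> ?C" "b \<in> ?C" for n a b
    using hom_mult[OF \<rho>H that, of n] by (simp add: sym_group_mult)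
  obtain r where r: "strict_mono r" "\<And>c. c \<in> ?C \<Longrightarrow> \<exists>v\<in>G. \<forall>\<^sub>F n in sequentially. \<rho> (r n) c = v"
  proof (rule pointwise_eventually_constant_subsequence[where \<rho> = \<rho>, OF countable_fundamental_group[OF S] finG])
    show "\<rho> n c \<in> G" if "c \<in> ?C" for n c by (rule \<rho>G[OF that])
  qed (rule that)
  then obtain v where v: "\<And>c. c \<in> ?C \<Longrightarrow> v c \<in> G" "\<And>c. c \<in> ?C \<Longrightarrow> \<forall>\<^sub>F n in sequentially. \<rho> (r n) c = v c"
    by metis
  \<comment> \<open>Restriction makes the limit extensional, as points of the product space
    are.\<close>
  define \<rho>0 where "\<rho>0 = restrict v ?C"
  have mult: "a \<otimes>\<^bsub>?\<Pi>\<^esub> b \<in> ?C" if "a \<in> ?C" "b \<in> ?C" for a b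
    using fundamental_group_carrierE[OF that(1)] fundamental_group_carrierE[OF that(2)]
      fundamental_group_mult(3)[OF that(1) _ that(2)] by metis
  have "v (a \<otimes>\<^bsub>?\<Pi>\<^esub> b) = v a \<circ> v b" if ab: "a \<in> ?C" "b \<in> ?C" for a b
  proof -
    have "\<forall>\<^sub>F n in sequentially. v (a \<otimes>\<^bsub>?\<Pi>\<^esub> b) = v a \<circ> v b"
      using v(2)[OF ab(1)] v(2)[OF ab(2)] v(2)[OF mult[OF ab]]
      by eventually_elim (use \<rho>hom[OF ab] in metis)
    then show ?thesis by simp
  qed
  then have "\<rho>0 \<in> ?H" using v(1) mult by (auto simp: hom_def \<rho>0_def sym_group_mult)
  moreover have "limitin (product_topology (\<lambda>_. discrete_topology G) ?C) (\<lambda>n. \<rho> (r n)) \<rho>0 sequentially"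
    unfolding limitin_componentwise
  proof (intro conjI ballI)
    show "\<rho>0 \<in> extensional ?C" by (simp add: \<rho>0_def)
    show "\<forall>\<^sub>F n in sequentially. \<rho> (r n) \<in> topspace (product_topology (\<lambda>_. discrete_topology G) ?C)"
      using \<rho> unfolding top by (simp add: always_eventually)
    fix c assume c: "c \<in> ?C"
    show "limitin (discrete_topology G) (\<lambda>n. \<rho> (r n) c) (\<rho>0 c) sequentially"
      unfolding limitin_def using v(1)[OF c] c
      by (auto simp: \<rho>0_def intro: eventually_mono[OF v(2)[OF c]])
  qed
  moreover have "\<forall>\<^sub>F n in sequentially. \<rho> (r n) \<in> ?H" using \<rho> unfolding top by (simp add: always_eventually)
  ultimately have "limitin (hom_space d G S s) (\<lambda>n. \<rho> (r n)) \<rho>0 sequentially"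
    unfolding hom_space_def limitin_subtopology by blast
  then show thesis using that r(1) by blast
qed

text \<open>The quotient map onto the deformed covers takes a union over all members of a class.
  They are all equivalent to \<open>F\<close>, and \<open>tstruct_of M'\<close> is among them, so
  this union is a single non-empty collection of equal classes.\<close>

lemma cover_class_deform:
  fixes S :: "'a surface_form" and M' :: "('a \<times> nat) surface_form"
  assumes S: "holomorphic_1form S" "connected_space (topo S)" and s: "s \<in> topspace (topo S)"
    and M': "is_cover d S M' p'" "is_monodromy d S s M' p' l' \<rho>" "\<rho> ` carrier (fundamental_group (topo S) s) \<subseteq> G"
    and F: "charted F" "translation_equivalent F (tstruct_of M')"
  shows "(\<Union>F'\<in>cover_class d G S s \<rho>. tclass T (deform A F')) = tclass T (deform A F)"
proof -
  let ?M' = "tstruct_of M'"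
  have mem: "?M' \<in> cover_class d G S s \<rho>"
  proof -
    have "?M' \<in> covers d G S s" using M' unfolding covers_def monodromy_in_def by blast
    moreover have "translation_equivalent ?M' ?M'"
      using translation_iso_id[OF is_coverD(1)[OF M'(1)]] translation_equivalent_iff_iso by blast
    ultimately have "?M' \<in> tclass (covers d G S s) ?M'" by (simp add: tclass_def)
    then show ?thesis unfolding cover_class_def using M'(1,2) by blast
  qed
  have chM: "charted ?M'" by (rule charted_tstruct_of[OF is_coverD(1)[OF M'(1)]])
  have "tclass T (deform A F') = tclass T (deform A F)" if F': "F' \<in> cover_class d G S s \<rho>" for F'
  proof -
    obtain M'' :: "('a \<times> nat) surface_form" and p'' l'' where M'': "is_cover d S M'' p''" "is_monodromy d S s M'' p'' l'' \<rho>"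
        "F' \<in> covers d G S s" "translation_equivalent (tstruct_of M'') F'"
      using F' unfolding cover_class_def tclass_def by blast
    have chM'': "charted (tstruct_of M'')" by (rule charted_tstruct_of[OF is_coverD(1)[OF M''(1)]])
    have chF': "charted F'"
      using M''(3) charted_tstruct_of is_coverD(1) unfolding covers_def by blast
    have "translation_equivalent F (tstruct_of M'')"
      by (rule translation_equivalent_trans[OF F(2) same_monodromy_translation_equivalent[OF S s M'(1,2) M''(1,2)] F(1) chM])
    then have "translation_equivalent F F'"
      by (rule translation_equivalent_trans[OF _ M''(4) F(1) chM''])
    then show ?thesis
      using tclass_eq[OF translation_equivalent_deform charted_deform[OF F(1)] charted_deform[OF chF']] by metis
  qed
  then show ?thesis using mem by blast
qed

theorem proposition4:
  fixes S :: "'a surface_form" and M :: "'b surface_form" and p :: "'b \<Rightarrow> 'a"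
    and s :: 'a and d :: nat and G :: "(nat \<Rightarrow> nat) set"
  assumes "d \<ge> 2"
    and "subgroup G (sym_group d)"
    and "translation_surface S"
    and "s \<in> topspace (topo S) - zeros S"
    and "finite_area (tstruct_of S)"
    and "infinite_topological_type (topo S) s"
    and "is_cover d S M p"
    and "monodromy_in d G S s M p"
    and "nondivergent S"
  shows "\<exists>x. omega_limit_point (cover_orbit_space d G S s)
           (\<lambda>t. tclass (deformed_covers d G S s) (deform (teich_flow t) (tstruct_of M))) x"
proof -
  let ?\<Pi> = "fundamental_group (topo S) s"
  let ?DC = "deformed_covers d G S s"
  let ?q = "cover_class d G S s"
  have S: "holomorphic_1form S" "connected_space (topo S)" "second_countable (topo S)"
    using assms(3) by (simp_all add: translation_surface_def)
  have s: "s \<in> topspace (topo S)" using assms(4) by simp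
  obtain l \<rho> where mon: "is_monodromy d S s M p l \<rho>" "\<rho> ` carrier ?\<Pi> \<subseteq> G"
    using assms(8) unfolding monodromy_in_def by blast
  obtain t :: "nat \<Rightarrow> real" and A A0 where t: "filterlim t at_top sequentially"
    and A: "\<And>n. A n \<in> SL_pm" "A0 \<in> SL_pm" "A \<longlonglongrightarrow> A0"
    and eq: "\<And>n. translation_equivalent (deform (teich_flow (t n)) (tstruct_of S)) (deform (A n) (tstruct_of S))"
    using nondivergent_lift[OF S(1) assms(9)] by metis
  \<comment> \<open>The Veech group part of the flow: \<open>A n ** h n\<close> is the flow matrix,
    and cancelling \<open>A n\<close> from \<open>eq\<close> shows that \<open>h n\<close> preserves
    the class of \<open>S\<close>.\<close>
  define h where "h = (\<lambda>n. matrix_inv (A n) ** teich_flow (t n))"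
  have Ah: "A n ** h n = teich_flow (t n)" for n
    by (simp add: h_def matrix_mul_assoc SL_pm_inverse[OF A(1)])
  have "\<exists>f. translation_iso (deform (h n) (tstruct_of S)) (tstruct_of S) f" for n
    using translation_equivalent_deform[OF eq[of n], of "matrix_inv (A n)"]
    by (simp add: deform_deform h_def SL_pm_inverse[OF A(1)] deform_1 flip: translation_equivalent_iff_iso)
  then have "\<exists>(M' :: ('a \<times> nat) surface_form) p' l' \<rho>'. is_cover d S M' p' \<and> is_monodromy d S s M' p' l' \<rho>' \<and>
      \<rho>' ` carrier ?\<Pi> \<subseteq> \<rho> ` carrier ?\<Pi> \<and> \<rho>' \<in> extensional (carrier ?\<Pi>) \<and>
      translation_equivalent (deform (h n) (tstruct_of M)) (tstruct_of M')" for n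
    using deformed_cover_equivalent_cover[OF S(1,2) s assms(7) mon(1)] by metis
  then obtain M' :: "nat \<Rightarrow> ('a \<times> nat) surface_form" and p' l' \<rho>' where M': "\<And>n. is_cover d S (M' n) (p' n)"
      "\<And>n. is_monodromy d S s (M' n) (p' n) (l' n) (\<rho>' n)"
      "\<And>n. \<rho>' n ` carrier ?\<Pi> \<subseteq> \<rho> ` carrier ?\<Pi>" "\<And>n. \<rho>' n \<in> extensional (carrier ?\<Pi>)"
      "\<And>n. translation_equivalent (deform (h n) (tstruct_of M)) (tstruct_of (M' n))"
    by metis
  have \<rho>G: "\<rho>' n ` carrier ?\<Pi> \<subseteq> G" for n using M'(3) mon(2) by blast
  have "\<rho>' n \<in> topspace (hom_space d G S s)" for n
    using is_monodromyD(2)[OF M'(2)] M'(4) \<rho>G[of n]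
    by (auto simp: hom_space_def hom_def PiE_iff image_subset_iff)
  then obtain r \<rho>0 where r: "strict_mono (r :: nat \<Rightarrow> nat)"
    and lim: "limitin (hom_space d G S s) (\<lambda>n. \<rho>' (r n)) \<rho>0 sequentially"
    using hom_space_convergent_subsequence[OF S(1,3) assms(2)] by metis
  define \<Phi> where "\<Phi> = (\<lambda>(A, C :: ('a \<times> nat) tstruct set). \<Union>F\<in>C. tclass ?DC (deform A F))"
  \<comment> \<open>The point of the trajectory is written as the image of a pair whose matrix
    converges and whose homomorphism has a convergent subsequence.\<close>
  have \<Phi>: "\<Phi> (A n, ?q (\<rho>' n)) = tclass ?DC (deform (teich_flow (t n)) (tstruct_of M))" for n
  proof -
    have "charted (deform (h n) (tstruct_of M))"
      using charted_deform charted_tstruct_of is_coverD(1)[OF assms(7)] by blast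
    from cover_class_deform[OF S(1,2) s M'(1,2) \<rho>G this M'(5), where A = "A n" and T = ?DC] show ?thesis
      unfolding \<Phi>_def prod.case by (simp add: deform_deform Ah)
  qed
  have "limitin (cover_space d G S s) (?q \<circ> (\<lambda>n. \<rho>' (r n))) (?q \<rho>0) sequentially"
    unfolding cover_space_def by (rule continuous_map_limit[OF continuous_map_quotient_topology lim])
  moreover have "limitin (top_of_set SL_pm) (\<lambda>n. A (r n)) A0 sequentially"
    using A LIMSEQ_subseq_LIMSEQ[OF A(3) r] by (simp add: limitin_subtopology o_def)
  ultimately have "limitin (prod_topology (top_of_set SL_pm) (cover_space d G S s))
      (\<lambda>n. (A (r n), ?q (\<rho>' (r n)))) (A0, ?q \<rho>0) sequentially"
    by (simp add: limitin_pairwise o_def)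
  \<comment> \<open>The same map \<open>\<Phi>\<close> is the quotient map that defines the
    topology, so convergence of the pairs passes to the trajectory.\<close>
  from continuous_map_limit[OF continuous_map_quotient_topology[of _ \<Phi>] this]
  have "limitin (cover_orbit_space d G S s)
      (\<lambda>n. tclass ?DC (deform (teich_flow (t (r n))) (tstruct_of M))) (\<Phi> (A0, ?q \<rho>0)) sequentially"
    unfolding cover_orbit_space_def \<Phi>_def[symmetric] by (simp add: o_def \<Phi>)
  moreover have "filterlim (\<lambda>n. t (r n)) at_top sequentially"
    by (rule filterlim_compose[OF t filterlim_subseq[OF r]])
  ultimately show ?thesis unfolding omega_limit_point_def by blast
qed

end
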